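(* The following relation holds: $$h_\mu(\mathcal S)=9H_\mu,$$ where $h_\mu(\mathcal S)$ is the metric (Kolmogorov–Sinai) entropy of the goldenshift $\mathcal S$ with respect to the Erdős measure $\mu$ (logarithms to base $\lambda$), and $H_\mu$ is Garsia's entropy of the Erdős measure.
   Context: $\lambda=\frac{1+\sqrt5}{2}$. The Erdős measure $\mu$ on $[0,1]$ is the distribution of $\sum_{k\ge1}x_k\lambda^{-k-1}$, where the $x_k$ are independent and equal to $0$ or $1$ with probability $\frac12$ each. The canonical expansion of $x$ is $x=\sum_{k\ge1}\varepsilon_k\lambda^{-k}$ with $\varepsilon_k=[\lambda T^{k-1}x]$, where $Tx=\{\lambda x\}$ (fractional part); $T$ acts on canonical expansions as the one-sided shift. A block is a finite 0-1 word without two adjacent 1's, starting with 1 and ending with an even (positive) number of zeros, which contains no subword $1(00)^l1$ with $l\ge1$; $\mathfrak B$ is the set of all blocks. A point $x\in[\lambda^{-1},1)$ is regular if its canonical expansion contains infinitely many subwords $1(00)^l1$ with $l\ge1$; $\mu$-almost every point of $(\lambda^{-1},1)$ is regular. The canonical expansion of a regular $x$ starts with 1 and splits uniquely into a sequence of blocks $\Psi(x)=(B_1(x),B_2(x),\dots)$: each block ends as soon as, for the first time, an even positive number of zeros followed by a 1 appears, and this 1 begins the next block. The goldenshift $\mathcal S$ acts on the regular points of $(\lambda^{-1},1)$ by $\mathcal Sx=T^{n(x)}x$, where $n(x)$ is the length of $B_1(x)$; in terms of block expansions it is the one-sided shift $(B_1,B_2,B_3,\dots)\mapsto(B_2,B_3,\dots)$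 on $\mathfrak X=\prod_1^\infty\mathfrak B$. In $h_\mu(\mathcal S)$, $\mu$ stands for the Erdős measure restricted to $(\lambda^{-1},1)$ and normalized (equivalently, for its image under $\Psi$ on $\mathfrak X$). Garsia's entropy: let $H^{(n)}$ be the Shannon entropy $-\sum_w P(w)\log P(w)$ of the distribution of the random variable $\sum_{k=1}^n\varepsilon_k\lambda^{-k-1}$, where the $\varepsilon_k$ are independent and equal to $0$ or $1$ with probability $\frac12$ each; then $H_\mu=\lim_{n\to\infty}\frac{H^{(n)}}{n\log\lambda}$ (the limit exists and does not depend on the base of the logarithm). *)

theory Defs
  imports "HOL-Probability.Probability"
begin

definition golden_ratio :: real where
  "golden_ratio = (1 + sqrt 5) / 2"

text \<open>Sequences are indexed from 0 throughout, so that index \<open>k\<close> here corresponds to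
  index \<open>k + 1\<close> in the usual notation
  \<open>x = (\<Sum>k\<ge>1. \<epsilon>\<^sub>k \<lambda>\<^sup>-\<^sup>k)\<close>.\<close>

definition coin_space :: "(nat \<Rightarrow> bool) measure" where
  "coin_space = PiM UNIV (\<lambda>_. measure_pmf (bernoulli_pmf (1/2)))"

definition erdos_measure :: "real measure" where
  "erdos_measure =
     distr coin_space borel (\<lambda>x. \<Sum>k. of_bool (x k) / golden_ratio ^ (k + 2))"

definition erdos_partial_sum :: "nat \<Rightarrow> (nat \<Rightarrow> bool) \<Rightarrow> real" where
  "erdos_partial_sum n x = (\<Sum>k<n. of_bool (x k) / golden_ratio ^ (k + 2))"

text \<open>Shannon entropy to base \<open>b\<close> of a random variable with finitely many values;
  the convention \<open>0 log 0 = 0\<close> holds automatically because \<open>log b 0 = 0\<close>.\<close>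

definition shannon_entropy :: "real \<Rightarrow> 'a measure \<Rightarrow> ('a \<Rightarrow> 'b) \<Rightarrow> real" where
  "shannon_entropy b M X =
     - (\<Sum>w\<in>X ` space M. measure M (X -` {w} \<inter> space M) * log b (measure M (X -` {w} \<inter> space M)))"

definition garsia_entropy :: real where
  "garsia_entropy =
     lim (\<lambda>n. shannon_entropy (exp 1) coin_space (erdos_partial_sum n) / (real n * ln golden_ratio))"

definition finite_measurable_partition :: "'a measure \<Rightarrow> 'a set set \<Rightarrow> bool" where
  "finite_measurable_partition M P \<longleftrightarrow> finite P \<and> P \<subseteq> sets M \<and> partition_on (space M) P"

definition partition_entropy :: "real \<Rightarrow> 'a measure \<Rightarrow> 'a set set \<Rightarrow> real" where
  "partition_entropy b M P = - (\<Sum>A\<in>P. measure M A * log b (measure M A))"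

definition preimage_partition :: "'a measure \<Rightarrow> ('a \<Rightarrow> 'a) \<Rightarrow> 'a set set \<Rightarrow> 'a set set" where
  "preimage_partition M F P = (\<lambda>A. F -` A \<inter> space M) ` P - {{}}"

text \<open>The join of \<open>P, T\<^sup>-\<^sup>1P, \<dots>, T\<^sup>-\<^sup>(\<^sup>n\<^sup>-\<^sup>1\<^sup>)P\<close>.\<close>

definition iterated_join :: "'a measure \<Rightarrow> ('a \<Rightarrow> 'a) \<Rightarrow> 'a set set \<Rightarrow> nat \<Rightarrow> 'a set set" where
  "iterated_join M T P n = common_refinement ((\<lambda>i. preimage_partition M (T ^^ i) P) ` {..<n})"

text \<open>Entropy of a measure-preserving transformation \<open>T\<close> of the probability space \<open>M\<close>,
  with logarithms to base \<open>b\<close>. The limit exists for measure-preserving \<open>T\<close>.\<close>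

definition ks_entropy :: "real \<Rightarrow> 'a measure \<Rightarrow> ('a \<Rightarrow> 'a) \<Rightarrow> ereal" where
  "ks_entropy b M T =
     (SUP P\<in>{P. finite_measurable_partition M P}.
        ereal (lim (\<lambda>n. partition_entropy b M (iterated_join M T P n) / real n)))"

definition golden_map :: "real \<Rightarrow> real" where
  "golden_map x = frac (golden_ratio * x)"

definition digit :: "real \<Rightarrow> nat \<Rightarrow> int" where
  "digit x k = \<lfloor>golden_ratio * (golden_map ^^ k) x\<rfloor>"

text \<open>The subword \<open>1(00)\<^sup>l1\<close> occurs at position \<open>i\<close> of the canonical expansion of \<open>x\<close>.\<close>

definition even_gap_at :: "real \<Rightarrow> nat \<Rightarrow> nat \<Rightarrow> bool" where
  "even_gap_at x i l \<longleftrightarrow>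
     digit x i = 1 \<and> (\<forall>j\<in>{1..2 * l}. digit x (i + j) = 0) \<and> digit x (i + 2 * l + 1) = 1"

definition regular_points :: "real set" where
  "regular_points =
     {x \<in> {1 / golden_ratio ..< 1}. infinite {i. \<exists>l\<ge>1. even_gap_at x i l}}"

text \<open>The first block consists of the digits with indices \<open>0, \<dots>, i + 2l\<close>, where
  \<open>i + 2l + 1\<close> is the first index carrying the closing digit 1 of a
  subword \<open>1(00)\<^sup>l1\<close> with \<open>l \<ge> 1\<close>.\<close>

definition first_block_length :: "real \<Rightarrow> nat" where
  "first_block_length x = (LEAST n. \<exists>i l. l \<ge> 1 \<and> even_gap_at x i l \<and> n = i + 2 * l + 1)"

definition goldenshift :: "real \<Rightarrow> real" where
  "goldenshift x = (golden_map ^^ first_block_length x) x"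

text \<open>The Erdos measure restricted to \<open>(1/\<lambda>, 1)\<close> and normalized, on the set of regular
  points. These form a subset of the open interval of full measure (\<open>1/\<lambda>\<close> itself has expansion
  \<open>1000\<dots>\<close> and is not regular), and the goldenshift maps this set to itself.\<close>

definition erdos_regular :: "real measure" where
  "erdos_regular =
     restrict_space (uniform_measure erdos_measure {1 / golden_ratio <..< 1}) regular_points"

end

(* Let phi be the golden ratio and let Z be phi times the random series of the Erdos measure. If b is a
   block, then the first |b| digits of any 0-1 expansion of a point in the cylinder of b have the same
   value as b: reading the difference of the two words backwards expands its algebraic conjugate, which
   is bounded by phi^2. Hence the law of Z, conditioned on the regular points, turns the blocks into
   independent random variables B_1, B_2, ... with P(B = b) = f(b) / 2^|b|, where f(b) is the number of
   representations of b. The normalized restriction of the Erdos measure has a density with respect to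
   this law that depends on the first block only, so both have the same entropy, namely the entropy h of
   one block, by the usual argument for Bernoulli shifts.

   The identity m(E) = (m(phi E) + m(phi E - 1)) / 2 for the law m of Z gives a linear recursion for the
   probability that the first block is longer than n. Summing it yields the mean block length 9.

   By the renewal argument the word formed by the complete blocks among the first n digits has entropy
   n h / 9 + o(n). Distinct values of the n-th partial sum differ by at least c phi^(-n), because the
   product of a difference with its conjugate is a nonzero integer. So the n-th partial sum and that
   word determine each other up to a choice of expected logarithm o(n), whence Garsia's entropy
   is h / (9 log phi). *)

theory Submission
  imports Defs
begin

section \<open>Entropy of random variables with finitely many values\<close>

text \<open>The closing even run of zeros is what makes a block forget the past. Two words with the
  same length and different values could compete at the end of a block only if the conjugate of
  their difference is -\<phi> or \<phi>. Traced backwards through the zeros, -\<phi> recurs with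
  period two and is impossible at the 1 in front of them, which fixes the parity; \<phi> is already
  impossible after one zero. The Erdos measure itself is not the law that makes blocks independent.
  Under it only the first block has a different law, so an initial law and an invariant law are
  treated side by side. Points below 1/\<phi> are included by letting their leading zeros count as a
  first block. The number 9 comes from a potential: a linear combination of six masses starts at 6
  and decreases at each step by twice the mass of the points whose first block is still open. These
  masses therefore sum to 3, and conditioning on the regular points, of mass 1/3, gives 9. The
  unfinished last block costs o(n) because the tail of the block length is decreasing and
  summable.\<close>

definition eta :: "real \<Rightarrow> real" where
  "eta t = - (t * ln t)"

text \<open>Natural logarithms are used until the very end. A variable with infinitely many values
  would get the default value 0 of an infinite sum, hence the hypotheses
  \<open>simple_function\<close> below.\<close>

definition ent :: "'a measure \<Rightarrow> ('a \<Rightarrow> 'b) \<Rightarrow> real" where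
  "ent M X = (\<Sum>v\<in>X ` space M. eta (measure M {x \<in> space M. X x = v}))"

lemma eta_0 [simp]: "eta 0 = 0"
  by (simp add: eta_def)

lemma eta_1 [simp]: "eta 1 = 0"
  by (simp add: eta_def)

lemma eta_nonneg: "0 \<le> t \<Longrightarrow> t \<le> 1 \<Longrightarrow> 0 \<le> eta t"
  by (cases "t = 0") (auto simp: eta_def mult_nonneg_nonpos)

lemma eta_mult: "0 \<le> a \<Longrightarrow> 0 \<le> b \<Longrightarrow> eta (a * b) = a * eta b + b * eta a"
  by (cases "a = 0 \<or> b = 0") (auto simp: eta_def ln_mult algebra_simps)

text \<open>Since -ln is decreasing, each part of a total may be charged with the logarithm of the
  total. This is the reason why merging values lowers entropy.\<close>

lemma eta_le_mult_ln:
  assumes "0 \<le> p" "p \<le> t"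
  shows "p * - ln t \<le> eta p"
proof (cases "p = 0")
  case False
  with assms show ?thesis by (simp add: eta_def)
qed simp

lemma eta_sum_le:
  assumes "finite A" "\<And>i. i \<in> A \<Longrightarrow> 0 \<le> p i"
  shows "eta (sum p A) \<le> (\<Sum>i\<in>A. eta (p i))"
proof -
  have "eta (sum p A) = (\<Sum>i\<in>A. p i * - ln (sum p A))"
    by (simp add: eta_def sum_distrib_right sum_negf)
  also have "\<dots> \<le> (\<Sum>i\<in>A. eta (p i))"
    using assms by (intro sum_mono eta_le_mult_ln member_le_sum) auto
  finally show ?thesis .
qed

text \<open>Termwise ln u \<le> u - 1 at u = q/p. With q the product of the marginals it gives
  subadditivity, with q uniform the bound by the logarithm of the number of values.\<close>

lemma gibbs_inequality:
  assumes "finite A" "\<And>i. i \<in> A \<Longrightarrow> 0 \<le> p i" "\<And>i. i \<in> A \<Longrightarrow> 0 \<le> q i"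
    and "\<And>i. i \<in> A \<Longrightarrow> 0 < p i \<Longrightarrow> 0 < q i" "sum q A \<le> sum p A"
  shows "(\<Sum>i\<in>A. eta (p i)) \<le> (\<Sum>i\<in>A. p i * - ln (q i))"
proof -
  have *: "eta (p i) + p i * ln (q i) \<le> q i - p i" if "i \<in> A" for i
  proof (cases "p i = 0")
    case True
    with assms(3)[OF that] show ?thesis by simp
  next
    case False
    with assms(2)[OF that] have p: "p i > 0" by simp
    with assms(4)[OF that] have q: "q i > 0" by simp
    have "eta (p i) + p i * ln (q i) = p i * ln (q i / p i)"
      using p q by (simp add: eta_def ln_div algebra_simps)
    also have "\<dots> \<le> p i * (q i / p i - 1)"
      using p q by (intro mult_left_mono ln_le_minus_one) auto
    also have "\<dots> = q i - p i"
      using p by (simp add: field_simps)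
    finally show ?thesis .
  qed
  have "(\<Sum>i\<in>A. eta (p i) + p i * ln (q i)) \<le> (\<Sum>i\<in>A. q i - p i)"
    by (intro sum_mono *)
  also have "\<dots> \<le> 0"
    using assms(5) by (simp add: sum_subtractf)
  finally show ?thesis
    by (simp add: sum.distrib sum_negf)
qed

lemma ent_superset:
  assumes "finite V" "X ` space M \<subseteq> V"
  shows "ent M X = (\<Sum>v\<in>V. eta (measure M {x \<in> space M. X x = v}))"
  unfolding ent_def
proof (rule sum.mono_neutral_left[OF assms], safe)
  fix v assume "v \<notin> X ` space M"
  then have e: "{x \<in> space M. X x = v} = {}" by auto
  show "eta (measure M {x \<in> space M. X x = v}) = 0" unfolding e by simp
qed

lemma ent_cong:
  assumes "\<And>x. x \<in> space M \<Longrightarrow> X x = Y x"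
  shows "ent M X = ent M Y"
proof -
  have "X ` space M = Y ` space M" using assms by auto
  moreover have "{x \<in> space M. X x = v} = {x \<in> space M. Y x = v}" for v
    using assms by auto
  ultimately show ?thesis by (simp add: ent_def)
qed

lemma simple_function_fiber:
  "simple_function M X \<Longrightarrow> {x \<in> space M. X x = v} \<in> sets M"
proof -
  assume "simple_function M X"
  then have "X -` {v} \<inter> space M \<in> sets M"
    by (rule simple_functionD)
  moreover have "X -` {v} \<inter> space M = {x \<in> space M. X x = v}" by auto
  ultimately show ?thesis by simp
qed

lemma simple_function_pair:
  assumes "simple_function M X" "simple_function M Y"
  shows "simple_function M (\<lambda>x. (X x, Y x))"
  using simple_function_compose2[OF assms, of Pair] .

section \<open>Shannon inequalities for random variables with finitely many values\<close>

context prob_space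
begin

lemma ent_nonneg: "0 \<le> ent M X"
  unfolding ent_def by (intro sum_nonneg eta_nonneg) auto

lemma ent_const: "ent M (\<lambda>x. c) = 0"
proof -
  have "ent M (\<lambda>x. c) = (\<Sum>v\<in>{c}. eta (prob {x \<in> space M. c = v}))"
    by (rule ent_superset) auto
  then show ?thesis by (simp add: prob_space)
qed

lemma prob_eq_sum_fibers:
  assumes "simple_function M X" "finite V" "X ` space M \<subseteq> V" "{x \<in> space M. Q x} \<in> events"
  shows "prob {x \<in> space M. Q x} = (\<Sum>v\<in>V. prob {x \<in> space M. X x = v \<and> Q x})"
proof -
  have eq: "{x \<in> space M. X x = v \<and> Q x} = {x \<in> space M. X x = v} \<inter> {x \<in> space M. Q x}" for v
    by auto
  have "(\<Sum>v\<in>V. prob {x \<in> space M. X x = v \<and> Q x}) = prob (\<Union>v\<in>V. {x \<in> space M. X x = v \<and> Q x})"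
    using assms unfolding eq
    by (intro finite_measure_finite_Union[symmetric])
      (auto simp: disjoint_family_on_def intro!: simple_function_fiber sets.Int)
  also have "(\<Union>v\<in>V. {x \<in> space M. X x = v \<and> Q x}) = {x \<in> space M. Q x}"
    using assms(3) by auto
  finally show ?thesis by simp
qed

lemma sum_prob_fibers:
  assumes "simple_function M X" "finite V" "X ` space M \<subseteq> V"
  shows "(\<Sum>v\<in>V. prob {x \<in> space M. X x = v}) = 1"
  using prob_eq_sum_fibers[OF assms, of "\<lambda>_. True"] by (simp add: prob_space)

text \<open>A fibre of the composition is a disjoint union of fibres of \<open>X\<close>, so
  \<open>eta_sum_le\<close> applies to each value.\<close>

lemma ent_compose_le:
  assumes X: "simple_function M X"
  shows "ent M (\<lambda>x. f (X x)) \<le> ent M X"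
proof -
  let ?V = "X ` space M"
  have fin: "finite ?V" using X by (rule simple_functionD)
  have "ent M (\<lambda>x. f (X x)) = (\<Sum>w\<in>f ` ?V. eta (prob {x \<in> space M. f (X x) = w}))"
    unfolding ent_def by (simp add: image_image)
  also have "\<dots> \<le> (\<Sum>w\<in>f ` ?V. \<Sum>v\<in>{v \<in> ?V. f v = w}. eta (prob {x \<in> space M. X x = v}))"
  proof (rule sum_mono)
    fix w
    have "simple_function M (\<lambda>x. f (X x))"
      using simple_function_compose[OF X, of f] by (simp add: comp_def)
    then have ev: "{x \<in> space M. f (X x) = w} \<in> events" by (rule simple_function_fiber)
    have "prob {x \<in> space M. f (X x) = w} = (\<Sum>v\<in>?V. prob {x \<in> space M. X x = v \<and> f (X x) = w})"
      by (rule prob_eq_sum_fibers[OF X fin _ ev]) simp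
    also have "\<dots> = (\<Sum>v\<in>{v \<in> ?V. f v = w}. prob {x \<in> space M. X x = v})"
    proof (rule sum.mono_neutral_cong_right)
      show "\<forall>i\<in>?V - {v \<in> ?V. f v = w}. prob {x \<in> space M. X x = i \<and> f (X x) = w} = 0"
      proof
        fix i assume "i \<in> ?V - {v \<in> ?V. f v = w}"
        then have e: "{x \<in> space M. X x = i \<and> f (X x) = w} = {}" by auto
        show "prob {x \<in> space M. X x = i \<and> f (X x) = w} = 0" unfolding e by simp
      qed
    qed (use fin in \<open>auto intro!: arg_cong[where f = prob]\<close>)
    finally show "eta (prob {x \<in> space M. f (X x) = w}) \<le>
        (\<Sum>v\<in>{v \<in> ?V. f v = w}. eta (prob {x \<in> space M. X x = v}))"
      using fin by (auto intro!: eta_sum_le)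
  qed
  also have "\<dots> = ent M X"
    unfolding ent_def by (rule sum.image_gen[OF fin, symmetric])
  finally show ?thesis .
qed

lemma ent_inj:
  assumes X: "simple_function M X" and "\<And>x. x \<in> space M \<Longrightarrow> g (f (X x)) = X x"
  shows "ent M (\<lambda>x. f (X x)) = ent M X"
proof (rule antisym)
  show "ent M (\<lambda>x. f (X x)) \<le> ent M X" by (rule ent_compose_le[OF X])
  have "simple_function M (\<lambda>x. f (X x))"
    using simple_function_compose[OF X, of f] by (simp add: comp_def)
  from ent_compose_le[OF this, of g] show "ent M X \<le> ent M (\<lambda>x. f (X x))"
    using ent_cong[of M "\<lambda>x. g (f (X x))" X] assms by simp
qed

lemma ent_pair_sum:
  assumes X: "simple_function M X" and Y: "simple_function M Y"
  shows "ent M (\<lambda>x. (X x, Y x)) =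
    (\<Sum>a\<in>X ` space M. \<Sum>b\<in>Y ` space M. eta (prob {x \<in> space M. X x = a \<and> Y x = b}))"
proof -
  have "finite (X ` space M \<times> Y ` space M)"
    using X Y by (auto dest: simple_functionD)
  then have "ent M (\<lambda>x. (X x, Y x)) = (\<Sum>v\<in>X ` space M \<times> Y ` space M.
      eta (prob {x \<in> space M. (X x, Y x) = v}))"
    by (rule ent_superset) auto
  then show ?thesis
    by (simp add: sum.cartesian_product case_prod_beta prod_eq_iff)
qed

lemma prob_fst_fibers:
  assumes X: "simple_function M X" and Y: "simple_function M Y"
  shows "(\<Sum>b\<in>Y ` space M. prob {x \<in> space M. X x = a \<and> Y x = b}) = prob {x \<in> space M. X x = a}"
proof -
  have "finite (Y ` space M)" using Y by (rule simple_functionD)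
  from prob_eq_sum_fibers[OF Y this order.refl simple_function_fiber[OF X, of a]]
  show ?thesis by (simp add: conj_ac)
qed

lemma prob_snd_fibers:
  assumes X: "simple_function M X" and Y: "simple_function M Y"
  shows "(\<Sum>a\<in>X ` space M. prob {x \<in> space M. X x = a \<and> Y x = b}) = prob {x \<in> space M. Y x = b}"
  using prob_fst_fibers[OF Y X, of b] by (simp add: conj_ac)

lemma ent_pair_le:
  assumes X: "simple_function M X" and Y: "simple_function M Y"
  shows "ent M (\<lambda>x. (X x, Y x)) \<le> ent M X + ent M Y"
proof -
  let ?A = "X ` space M" and ?B = "Y ` space M"
  define p where "p = (\<lambda>(a, b). prob {x \<in> space M. X x = a \<and> Y x = b})"
  define u where "u a = prob {x \<in> space M. X x = a}" for a
  define v where "v b = prob {x \<in> space M. Y x = b}" for b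
  have fA: "finite ?A" and fB: "finite ?B" using X Y by (auto dest: simple_functionD)
  have le_u: "p (a, b) \<le> u a" and le_v: "p (a, b) \<le> v b" for a b
    unfolding p_def u_def v_def
    by (auto intro!: finite_measure_mono simple_function_fiber X Y)
  have su: "(\<Sum>b\<in>?B. p (a, b)) = u a" for a
    unfolding p_def u_def using prob_fst_fibers[OF X Y] by simp
  have sv: "(\<Sum>a\<in>?A. p (a, b)) = v b" for b
    unfolding p_def v_def using prob_snd_fibers[OF X Y] by simp
  have s1: "sum u ?A = 1" "sum v ?B = 1"
    unfolding u_def v_def using fA fB by (auto intro!: sum_prob_fibers X Y)
  have "ent M (\<lambda>x. (X x, Y x)) = (\<Sum>i\<in>?A \<times> ?B. eta (p i))"
    unfolding ent_pair_sum[OF X Y] p_def by (simp add: sum.cartesian_product case_prod_beta)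
  also have "\<dots> \<le> (\<Sum>i\<in>?A \<times> ?B. p i * - ln (u (fst i) * v (snd i)))"
  proof (rule gibbs_inequality)
    show "finite (?A \<times> ?B)" using fA fB by simp
    show "0 < u (fst i) * v (snd i)" if "0 < p i" for i
      using le_u[of "fst i" "snd i"] le_v[of "fst i" "snd i"] that by simp
    have "(\<Sum>i\<in>?A \<times> ?B. u (fst i) * v (snd i)) = sum u ?A * sum v ?B"
      by (simp add: sum_product sum.cartesian_product case_prod_beta)
    moreover have "(\<Sum>i\<in>?A \<times> ?B. p i) = (\<Sum>a\<in>?A. \<Sum>b\<in>?B. p (a, b))"
      by (simp add: sum.cartesian_product case_prod_beta)
    moreover have "\<dots> = sum u ?A" by (simp add: su)
    ultimately show "(\<Sum>i\<in>?A \<times> ?B. u (fst i) * v (snd i)) \<le> sum p (?A \<times> ?B)"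
      using s1 by simp
  qed (auto simp: p_def u_def v_def)
  also have "\<dots> = (\<Sum>i\<in>?A \<times> ?B. p i * - ln (u (fst i)) + p i * - ln (v (snd i)))"
  proof (rule sum.cong[OF refl])
    fix i
    show "p i * - ln (u (fst i) * v (snd i)) = p i * - ln (u (fst i)) + p i * - ln (v (snd i))"
    proof (cases "p i = 0")
      case False
      then have "0 < p i" by (cases i) (auto simp: p_def zero_less_measure_iff)
      with le_u[of "fst i" "snd i"] le_v[of "fst i" "snd i"]
      have "0 < u (fst i)" "0 < v (snd i)" by auto
      then show ?thesis by (simp add: ln_mult algebra_simps)
    qed simp
  qed
  also have "\<dots> = (\<Sum>a\<in>?A. \<Sum>b\<in>?B. p (a, b) * - ln (u a)) + (\<Sum>b\<in>?B. \<Sum>a\<in>?A. p (a, b) * - ln (v b))"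
    unfolding sum.swap[where g = "\<lambda>a b. p (a, b) * - ln (v b)" and A = ?A and B = ?B, symmetric]
    by (simp add: sum.distrib[symmetric] sum.cartesian_product case_prod_beta)
  also have "\<dots> = (\<Sum>a\<in>?A. u a * - ln (u a)) + (\<Sum>b\<in>?B. v b * - ln (v b))"
    unfolding sum_distrib_right[symmetric] su sv ..
  also have "\<dots> = ent M X + ent M Y"
    unfolding ent_def eta_def u_def v_def by simp
  finally show ?thesis .
qed

lemma ent_pair_indep:
  assumes X: "simple_function M X" and Y: "simple_function M Y"
    and indep: "\<And>a b. prob {x \<in> space M. X x = a \<and> Y x = b} =
      prob {x \<in> space M. X x = a} * prob {x \<in> space M. Y x = b}"
  shows "ent M (\<lambda>x. (X x, Y x)) = ent M X + ent M Y"
proof -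
  let ?A = "X ` space M" and ?B = "Y ` space M"
  have fA: "finite ?A" and fB: "finite ?B" using X Y by (auto dest: simple_functionD)
  have s: "(\<Sum>a\<in>?A. prob {x \<in> space M. X x = a}) = 1" "(\<Sum>b\<in>?B. prob {x \<in> space M. Y x = b}) = 1"
    using fA fB by (auto intro!: sum_prob_fibers X Y)
  show ?thesis
    unfolding ent_pair_sum[OF X Y] indep
    by (simp add: eta_mult sum.distrib ent_def s[symmetric] flip: sum_distrib_left sum_distrib_right)
      (simp add: s)
qed

text \<open>Chain rule with the conditional entropy given Y = b bounded by the logarithm of the
  number of values of \<open>X\<close> that still have positive probability. It is the tool for
  passing between partial sums and block words.\<close>

lemma ent_pair_fiber_le:
  assumes X: "simple_function M X" and Y: "simple_function M Y"
    and k: "\<And>b. 0 < prob {x \<in> space M. Y x = b} \<Longrightarrow>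
      real (card {a. 0 < prob {x \<in> space M. X x = a \<and> Y x = b}}) \<le> k b"
  shows "ent M (\<lambda>x. (X x, Y x)) \<le> ent M Y + (\<Sum>b\<in>Y ` space M. prob {x \<in> space M. Y x = b} * ln (k b))"
proof -
  let ?A = "X ` space M" and ?B = "Y ` space M"
  have fA: "finite ?A" using X by (auto dest: simple_functionD)
  have "(\<Sum>a\<in>?A. eta (prob {x \<in> space M. X x = a \<and> Y x = b})) \<le>
      eta (prob {x \<in> space M. Y x = b}) + prob {x \<in> space M. Y x = b} * ln (k b)" for b
  proof -
    define P where "P = prob {x \<in> space M. Y x = b}"
    define p where "p a = prob {x \<in> space M. X x = a \<and> Y x = b}" for a
    have p0: "0 \<le> p a" and pP: "p a \<le> P" for a
      unfolding p_def P_def by (auto intro!: finite_measure_mono simple_function_fiber Y)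
    define A where "A = {a. 0 < p a}"
    have AA: "A \<subseteq> ?A"
    proof
      fix a assume "a \<in> A"
      then have pa: "p a \<noteq> 0" by (simp add: A_def)
      show "a \<in> ?A"
      proof (rule ccontr)
        assume "a \<notin> ?A"
        then have e: "{x \<in> space M. X x = a \<and> Y x = b} = {}" by auto
        from pa show False unfolding p_def e by simp
      qed
    qed
    have fin: "finite A" using AA fA by (rule finite_subset)
    have out: "p a = 0" if "a \<notin> A" for a
      using that p0[of a] by (auto simp: A_def)
    have sumP: "(\<Sum>a\<in>A. p a) = P"
    proof -
      have "(\<Sum>a\<in>A. p a) = (\<Sum>a\<in>?A. p a)"
        by (rule sum.mono_neutral_left) (use AA fA out in auto)
      also have "\<dots> = P" unfolding p_def P_def by (rule prob_snd_fibers[OF X Y])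
      finally show ?thesis .
    qed
    have "(\<Sum>a\<in>?A. eta (p a)) = (\<Sum>a\<in>A. eta (p a))"
      by (rule sum.mono_neutral_right) (use AA fA out in auto)
    also have "\<dots> \<le> eta P + P * ln (k b)"
    proof (cases "P = 0")
      case True
      then have "p a = 0" for a using p0[of a] pP[of a] by simp
      with True show ?thesis by simp
    next
      case False
      then have P: "P > 0" unfolding P_def by (simp add: zero_less_measure_iff)
      have "A \<noteq> {}" using sumP False by auto
      with fin have cA: "0 < card A" by (simp add: card_gt_0_iff)
      have kA: "real (card A) \<le> k b"
        using k[of b] P unfolding A_def p_def P_def by simp
      \<comment> \<open>Comparison with the uniform distribution of the mass \<open>P\<close> on
        \<open>A\<close>.\<close>
      have "(\<Sum>a\<in>A. eta (p a)) \<le> (\<Sum>a\<in>A. p a * - ln (P / card A))"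
        by (rule gibbs_inequality) (use fin P cA p0 sumP in auto)
      also have "\<dots> = P * - ln (P / card A)"
        by (simp only: sum_distrib_right[symmetric] sumP)
      also have "\<dots> = eta P + P * ln (card A)"
        using P cA by (simp add: eta_def ln_div algebra_simps)
      also have "\<dots> \<le> eta P + P * ln (k b)"
        using P cA kA by (intro add_left_mono mult_left_mono) auto
      finally show ?thesis .
    qed
    finally show ?thesis unfolding p_def P_def .
  qed
  then have "(\<Sum>b\<in>?B. \<Sum>a\<in>?A. eta (prob {x \<in> space M. X x = a \<and> Y x = b})) \<le>
      (\<Sum>b\<in>?B. eta (prob {x \<in> space M. Y x = b}) + prob {x \<in> space M. Y x = b} * ln (k b))"
    by (intro sum_mono) auto
  then show ?thesis
    unfolding ent_pair_sum[OF X Y] ent_def[of M Y]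
    by (subst sum.swap) (simp add: sum.distrib)
qed

lemma ent_distr:
  assumes S: "S \<in> measurable M N" and X: "simple_function N X"
  shows "ent (distr M N S) X = ent M (\<lambda>x. X (S x))"
proof -
  have fin: "finite (X ` space N)" using X by (rule simple_functionD)
  have "ent M (\<lambda>x. X (S x)) = (\<Sum>v\<in>X ` space N. eta (prob {x \<in> space M. X (S x) = v}))"
    by (rule ent_superset[OF fin]) (use measurable_space[OF S] in auto)
  moreover have "measure (distr M N S) {x \<in> space N. X x = v} = prob {x \<in> space M. X (S x) = v}" for v
  proof -
    have "S -` {x \<in> space N. X x = v} \<inter> space M = {x \<in> space M. X (S x) = v}"
      using measurable_space[OF S] by auto
    then show ?thesis
      using S simple_function_fiber[OF X, of v] by (simp add: measure_distr)
  qed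
  ultimately show ?thesis
    by (simp add: ent_def)
qed

end

text \<open>Fekete's lemma: the limit is the infimum of u n / n. Division with remainder by a nearly
  optimal m leaves a remainder below m, whose contribution is bounded by the constant
  \<open>C\<close>.\<close>

lemma subadditive_converges:
  fixes u :: "nat \<Rightarrow> real"
  assumes nonneg: "\<And>n. 0 \<le> u n" and sub: "\<And>m n. u (m + n) \<le> u m + u n"
  shows "convergent (\<lambda>n. u n / real n)"
proof -
  define L where "L = (INF n\<in>{1..}. u n / real n)"
  have bdd: "bdd_below ((\<lambda>n. u n / real n) ` {1..})"
    using nonneg by (intro bdd_belowI[of _ 0]) auto
  have mult: "u (k * m) \<le> real k * u m" if "k \<ge> 1" for k m
    using that
  proof (induction k rule: nat_induct_at_least)
    case (Suc k)
    have "u (Suc k * m) \<le> u m + u (k * m)" using sub[of m "k * m"] by simp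
    with Suc show ?case by (simp add: algebra_simps)
  qed simp
  have "(\<lambda>n. u n / real n) \<longlonglongrightarrow> L"
  proof (rule LIMSEQ_I)
    fix e :: real assume e: "e > 0"
    have "\<exists>m\<in>{1..}. u m / real m < L + e / 2"
      using cINF_less_iff[OF _ bdd, of "L + e / 2"] e unfolding L_def by auto
    then obtain m where m: "m \<ge> 1" "u m / real m < L + e / 2" by auto
    define C where "C = Max (u ` {..<m})"
    have C: "u r \<le> C" if "r < m" for r unfolding C_def using that by (intro Max_ge) auto
    have C0: "0 \<le> C" using C[of 0] nonneg[of 0] m by simp
    obtain n0 :: nat where n0: "real n0 > 2 * C / e" using reals_Archimedean2 by blast
    show "\<exists>no. \<forall>n\<ge>no. norm (u n / real n - L) < e"
    proof (intro exI allI impI)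
      fix n assume n: "n \<ge> max (max n0 m) 1"
      then have npos: "n \<ge> 1" "n \<ge> m" by auto
      have lower: "L \<le> u n / real n"
        unfolding L_def using bdd npos by (intro cINF_lower) auto
      define k r where "k = n div m" and "r = n mod m"
      have k: "k \<ge> 1" using npos m by (simp add: k_def div_greater_zero_iff Suc_le_eq)
      have r: "r < m" using m by (simp add: r_def)
      have nkr: "n = k * m + r" by (simp add: k_def r_def)
      have "u n \<le> u (k * m) + u r" unfolding nkr by (rule sub)
      also have "\<dots> \<le> real k * u m + C" using mult[OF k] C[OF r] by (intro add_mono)
      also have "real k * u m = real (k * m) * (u m / real m)" using m by simp
      also have "\<dots> \<le> real n * (u m / real m)"
        using nonneg by (intro mult_right_mono) (auto simp: nkr)
      finally have "u n / real n \<le> u m / real m + C / real n"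
        using npos by (simp add: field_simps)
      moreover have "C / real n < e / 2"
      proof -
        have "real n > 2 * C / e" using n n0 by linarith
        then show ?thesis using e npos by (simp add: field_simps)
      qed
      ultimately show "norm (u n / real n - L) < e"
        using m(2) lower unfolding real_norm_def by linarith
    qed
  qed
  then show ?thesis by (auto simp: convergent_def)
qed

section \<open>Itineraries and iterated joins\<close>

text \<open>The name of x of length n with respect to the labelling \<open>c\<close>. With it the
  entropy of an iterated join becomes the entropy of a random variable.\<close>

definition itin :: "('a \<Rightarrow> 'b) \<Rightarrow> ('a \<Rightarrow> 'a) \<Rightarrow> nat \<Rightarrow> 'a \<Rightarrow> 'b list" where
  "itin c S n x = map (\<lambda>i. c ((S ^^ i) x)) [0..<n]"

lemma length_itin [simp]: "length (itin c S n x) = n"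
  by (simp add: itin_def)

lemma nth_itin [simp]: "i < n \<Longrightarrow> itin c S n x ! i = c ((S ^^ i) x)"
  by (simp add: itin_def)

lemma itin_0 [simp]: "itin c S 0 x = []"
  by (simp add: itin_def)

lemma itin_Suc: "itin c S (Suc n) x = c x # itin c S n (S x)"
  unfolding itin_def upt_conv_Cons[OF zero_less_Suc] map_Suc_upt[symmetric]
  by (simp add: funpow_Suc_right del: funpow.simps)

lemma itin_add: "itin c S (m + n) x = itin c S m x @ itin c S n ((S ^^ m) x)"
proof (rule nth_equalityI)
  fix i assume i: "i < length (itin c S (m + n) x)"
  show "itin c S (m + n) x ! i = (itin c S m x @ itin c S n ((S ^^ m) x)) ! i"
  proof (cases "i < m")
    case False
    then have "(S ^^ i) x = (S ^^ (i - m)) ((S ^^ m) x)"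
      using funpow_add[of "i - m" m S] by simp
    with i False show ?thesis by (simp add: nth_append)
  qed (simp add: nth_append)
qed simp

lemma measurable_funpow: "S \<in> measurable M M \<Longrightarrow> S ^^ n \<in> measurable M M"
  by (induction n) (auto simp: id_def)

lemma simple_function_comp_measurable:
  assumes "S \<in> measurable M N" "simple_function N X"
  shows "simple_function M (\<lambda>x. X (S x))"
  using assms by (simp add: simple_function_compose comp_def simple_function_comp)

lemma simple_function_itin:
  assumes S: "S \<in> measurable M M" and c: "simple_function M c"
  shows "simple_function M (itin c S n)"
proof (induction n)
  case 0
  then show ?case by (simp add: itin_def[abs_def])
next
  case (Suc n)
  have "simple_function M (\<lambda>x. c x # itin c S n (S x))"
    by (rule simple_function_compose2[OF c simple_function_comp_measurable[OF S Suc]])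
  then show ?case by (simp add: itin_Suc[abs_def])
qed

section \<open>From joins of partitions to itineraries\<close>

definition cell :: "'a set set \<Rightarrow> 'a \<Rightarrow> 'a set" where
  "cell P x = (THE A. A \<in> P \<and> x \<in> A)"

lemma cell_eqI:
  assumes "partition_on \<Omega> P" "A \<in> P" "x \<in> A"
  shows "cell P x = A"
  unfolding cell_def
proof (rule the_equality)
  fix B assume "B \<in> P \<and> x \<in> B"
  with assms show "B = A"
    by (metis disjointD disjoint_iff partition_onD2)
qed (use assms in auto)

lemma cell_in:
  assumes "partition_on \<Omega> P" "x \<in> \<Omega>"
  shows "cell P x \<in> P" "x \<in> cell P x"
proof -
  obtain A where "A \<in> P" "x \<in> A" using assms by (auto simp: partition_on_def)
  with cell_eqI[OF assms(1)] show "cell P x \<in> P" "x \<in> cell P x" by auto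
qed

lemma simple_function_cell:
  assumes "finite_measurable_partition M P"
  shows "simple_function M (cell P)"
proof -
  have P: "finite P" "P \<subseteq> sets M" "partition_on (space M) P"
    using assms by (auto simp: finite_measurable_partition_def)
  have sub: "cell P ` space M \<subseteq> P" using cell_in[OF P(3)] by auto
  have "cell P -` {A} \<inter> space M = A" if "A \<in> P" for A
  proof -
    have "A \<subseteq> space M" using that P(2) sets.sets_into_space by auto
    with that cell_eqI[OF P(3) that] cell_in[OF P(3)] show ?thesis by auto
  qed
  with sub P show ?thesis
    unfolding simple_function_def by (metis finite_subset subset_iff)
qed

text \<open>A nonempty member of the join is an intersection of preimages of cells and is determined
  by any of its points; these intersections are the fibres of the itinerary. With n \<ge> 1 the
  empty intersection does not arise.\<close>

lemma iterated_join_eq: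
  assumes P: "partition_on (space M) P" and S: "S \<in> measurable M M" and n: "n \<ge> 1"
  shows "iterated_join M S P n =
    (\<lambda>v. {x \<in> space M. itin (cell P) S n x = v}) ` itin (cell P) S n ` space M"
proof -
  define c where "c i x = {y \<in> space M. (S ^^ i) y \<in> cell P ((S ^^ i) x)}" for i x
  define PP where "PP i = preimage_partition M (S ^^ i) P" for i
  define J where "J = itin (cell P) S n"
  have Sp: "(S ^^ i) x \<in> space M" if "x \<in> space M" for i x
    using measurable_space[OF measurable_funpow[OF S] that] .
  have c_in: "c i x \<in> PP i" "x \<in> c i x" if "x \<in> space M" for i x
    using cell_in[OF P Sp[OF that, of i]] that
    by (auto simp: c_def PP_def preimage_partition_def)
  have c_uniq: "A = c i x" if "A \<in> PP i" "x \<in> A" for A i x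
  proof -
    obtain B where B: "B \<in> P" "A = (S ^^ i) -` B \<inter> space M"
      using \<open>A \<in> PP i\<close> by (auto simp: PP_def preimage_partition_def)
    with that have "cell P ((S ^^ i) x) = B" by (intro cell_eqI[OF P]) auto
    with B show ?thesis by (auto simp: c_def)
  qed
  have Jeq: "{y \<in> space M. J y = J x} = (\<Inter>i<n. c i x)" if "x \<in> space M" for x
  proof -
    have "(\<Inter>i<n. c i x) = {y \<in> space M. \<forall>i<n. (S ^^ i) y \<in> cell P ((S ^^ i) x)}"
      using n by (auto simp: c_def Ball_def Suc_le_eq)
    moreover have "(S ^^ i) y \<in> cell P ((S ^^ i) x) \<longleftrightarrow> cell P ((S ^^ i) y) = cell P ((S ^^ i) x)"
      if "y \<in> space M" for i y
      using cell_in[OF P Sp[OF \<open>x \<in> space M\<close>]] cell_in[OF P Sp[OF that]]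
        cell_eqI[OF P, of "cell P ((S ^^ i) x)" "(S ^^ i) y"] by metis
    moreover have "J y = J x \<longleftrightarrow> (\<forall>i<n. cell P ((S ^^ i) y) = cell P ((S ^^ i) x))" for y
      by (auto simp: J_def itin_def)
    ultimately show ?thesis by auto
  qed
  have "common_refinement (PP ` {..<n}) = (\<lambda>x. {y \<in> space M. J y = J x}) ` space M"
  proof (intro equalityI subsetI)
    fix R assume "R \<in> common_refinement (PP ` {..<n})"
    then obtain f where f: "f \<in> (\<Pi> Q\<in>PP ` {..<n}. Q)" "R = \<Inter> (f ` PP ` {..<n})" "R \<noteq> {}"
      by (auto simp: common_refinement)
    then obtain x where x: "x \<in> R" by auto
    have fx: "f (PP i) = c i x" if "i < n" for i
      using f(1) x that unfolding f(2) by (intro c_uniq) auto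
    have "R = (\<Inter>i<n. c i x)" unfolding f(2) using fx by auto
    moreover have "x \<in> space M"
    proof -
      have "x \<in> c 0 x" using x n unfolding calculation by auto
      then show ?thesis by (simp add: c_def)
    qed
    ultimately show "R \<in> (\<lambda>x. {y \<in> space M. J y = J x}) ` space M"
      using Jeq[of x] by blast
  next
    fix R assume "R \<in> (\<lambda>x. {y \<in> space M. J y = J x}) ` space M"
    then obtain x where x: "x \<in> space M" "R = {y \<in> space M. J y = J x}" by auto
    define f where "f Q = (SOME A. A \<in> Q \<and> x \<in> A)" for Q :: "'a set set"
    have f: "f (PP i) \<in> PP i \<and> x \<in> f (PP i)" for i
      unfolding f_def by (rule someI[of _ "c i x"]) (intro conjI c_in x(1))
    then have "f (PP i) = c i x" for i using c_uniq by auto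
    then have "R = \<Inter> (f ` PP ` {..<n})" using x Jeq[OF x(1)] by simp
    moreover have "f \<in> (\<Pi> Q\<in>PP ` {..<n}. Q)" using f by auto
    moreover have "R \<noteq> {}" using x by auto
    ultimately show "R \<in> common_refinement (PP ` {..<n})"
      unfolding common_refinement by blast
  qed
  then show ?thesis by (simp add: iterated_join_def PP_def J_def image_image)
qed

lemma partition_entropy_iterated_join:
  assumes P: "finite_measurable_partition M P" and S: "S \<in> measurable M M" and n: "n \<ge> 1"
  shows "partition_entropy b M (iterated_join M S P n) = ent M (itin (cell P) S n) / ln b"
proof -
  let ?J = "itin (cell P) S n"
  have part: "partition_on (space M) P" using P by (simp add: finite_measurable_partition_def)
  have inj: "inj_on (\<lambda>v. {x \<in> space M. ?J x = v}) (?J ` space M)"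
    by (rule inj_onI) blast
  show ?thesis
    unfolding partition_entropy_def iterated_join_eq[OF part S n] sum.reindex[OF inj] ent_def
    by (simp add: eta_def log_def sum_negf sum_divide_distrib)
qed

text \<open>The inequality ln u \<le> u - 1 is taken at u = 1 / sqrt t.\<close>

lemma eta_le_sqrt: "0 \<le> t \<Longrightarrow> eta t \<le> 2 * sqrt t"
proof (cases "t = 0")
  case False
  assume "0 \<le> t"
  with False have t: "t > 0" by simp
  have "ln (1 / sqrt t) \<le> 1 / sqrt t - 1" using t by (intro ln_le_minus_one) auto
  then have "- ln t \<le> 2 / sqrt t" using t by (simp add: ln_div ln_sqrt)
  then have "t * - ln t \<le> t * (2 / sqrt t)" using t by (intro mult_left_mono) auto
  also have "\<dots> = 2 * (t / sqrt t)" by simp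
  also have "\<dots> = 2 * sqrt t" using t by (simp only: real_div_sqrt)
  finally show ?thesis by (simp add: eta_def)
qed simp

lemma eta_le_one_minus: "0 \<le> t \<Longrightarrow> t \<le> 1 \<Longrightarrow> eta t \<le> 1 - t"
proof (cases "t = 0")
  case False
  assume "0 \<le> t"
  with False have t: "t > 0" by simp
  have "ln (1 / t) \<le> 1 / t - 1" using t by (intro ln_le_minus_one) auto
  then have "t * - ln t \<le> t * (1 / t - 1)" using t by (intro mult_left_mono) (auto simp: ln_div)
  also have "\<dots> = 1 - t" using t by (simp add: field_simps)
  finally show ?thesis by (simp add: eta_def)
qed simp

text \<open>The dominant value has probability at least 1 - t and contributes at most t; every other
  value has probability at most t and contributes at most 2 sqrt t.\<close>

lemma (in prob_space) ent_concentrated_le: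
  assumes D: "simple_function M D" and V: "finite V" "D ` space M \<subseteq> V" "v0 \<in> V"
    and t: "prob {x \<in> space M. D x \<noteq> v0} \<le> t"
  shows "ent M D \<le> real (card V) * (2 * sqrt t + t)"
proof -
  have ev: "{x \<in> space M. D x \<noteq> v0} \<in> events"
  proof -
    have "{x \<in> space M. D x \<noteq> v0} = space M - {x \<in> space M. D x = v0}" by auto
    then show ?thesis using simple_function_fiber[OF D] by auto
  qed
  have t0: "0 \<le> t" using t measure_nonneg order_trans by blast
  have "eta (prob {x \<in> space M. D x = v}) \<le> 2 * sqrt t + t" for v
  proof (cases "v = v0")
    case True
    have "prob {x \<in> space M. D x \<noteq> v0} = 1 - prob {x \<in> space M. D x = v0}"
      by (rule prob_neg) (rule simple_function_fiber[OF D])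
    then have "eta (prob {x \<in> space M. D x = v}) \<le> t"
      using eta_le_one_minus[of "prob {x \<in> space M. D x = v0}"] t True by simp
    with t0 show ?thesis by (simp add: add_increasing)
  next
    case False
    then have "prob {x \<in> space M. D x = v} \<le> prob {x \<in> space M. D x \<noteq> v0}"
      by (intro finite_measure_mono ev) auto
    then have "eta (prob {x \<in> space M. D x = v}) \<le> 2 * sqrt t"
      using t by (intro order_trans[OF eta_le_sqrt]) auto
    with t0 show ?thesis by simp
  qed
  then have "(\<Sum>v\<in>V. eta (prob {x \<in> space M. D x = v})) \<le> (\<Sum>v\<in>V. 2 * sqrt t + t)"
    by (intro sum_mono) auto
  then show ?thesis using ent_superset[OF V(1,2)] by simp
qed

section \<open>Entropy of a map with independent labels\<close>

text \<open>Only the image \<open>N\<close> of \<open>M\<close> under \<open>S\<close> has to be invariant. This suffices because dropping the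
  first letter of an itinerary changes its entropy by a bounded amount.\<close>

locale bernoulli_factor =
  M: prob_space M + N: prob_space N
  for M N :: "'a measure" +
  fixes S :: "'a \<Rightarrow> 'a" and \<beta> :: "'a \<Rightarrow> 'b :: countable" and p :: "'b \<Rightarrow> real"
  assumes S [measurable]: "S \<in> measurable M M"
    and distr_M: "distr M M S = N" and distr_N: "distr N M S = N"
    and \<beta> [measurable]: "\<beta> \<in> measurable M (count_space UNIV)"
    and indep: "\<And>b E. E \<in> sets M \<Longrightarrow>
      measure N {x \<in> space M. \<beta> x = b \<and> S x \<in> E} = p b * measure N E"
    and generates: "sets M =
      sigma_sets (space M) (range (\<lambda>(k, a). {x \<in> space M. \<forall>i<k. \<beta> ((S ^^ i) x) = a i}))"
    and summable: "(\<lambda>b. eta (p b)) summable_on UNIV"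
begin

lemma sets_N [simp, measurable_cong]: "sets N = sets M"
  using distr_M sets_distr by metis

lemma space_N [simp]: "space N = space M"
  by (rule sets_eq_imp_space_eq) simp

lemma simple_N: "simple_function N X = simple_function M X"
  by (simp add: simple_function_def)

lemma S_N: "S \<in> measurable N N"
  using S by (simp cong: measurable_cong_sets)

lemma distr_N': "distr N N S = N"
  using distr_N distr_cong[of N N M N S S] by simp

section \<open>Entropy rates of itineraries under the two laws\<close>

lemma ent_shift_M:
  assumes "simple_function M X"
  shows "ent M (\<lambda>x. X (S x)) = ent N X"
  using M.ent_distr[OF S assms] by (simp add: distr_M)

lemma ent_shift_N:
  assumes "simple_function M X"
  shows "ent N (\<lambda>x. X (S x)) = ent N X"
  using N.ent_distr[OF S_N, of X] assms by (simp add: distr_N' simple_N)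

lemma ent_funpow_N:
  assumes X: "simple_function M X"
  shows "ent N (\<lambda>x. X ((S ^^ n) x)) = ent N X"
proof (induction n)
  case (Suc n)
  have "simple_function M (\<lambda>x. X ((S ^^ n) x))"
    by (rule simple_function_comp_measurable[OF measurable_funpow[OF S] X])
  from ent_shift_N[OF this] Suc show ?case by (simp add: funpow_swap1)
qed simp

lemma simple_itin: "simple_function M c \<Longrightarrow> simple_function M (itin c S n)"
  by (rule simple_function_itin[OF S])

lemma ent_itin_add_le:
  assumes c: "simple_function M c"
  shows "ent N (itin c S (m + n)) \<le> ent N (itin c S m) + ent N (itin c S n)"
proof -
  have X: "simple_function N (itin c S m)" and Y: "simple_function N (\<lambda>x. itin c S n ((S ^^ m) x))"
    using simple_itin[OF c] simple_function_comp_measurable[OF measurable_funpow[OF S]]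
    by (auto simp: simple_N)
  have "ent N (itin c S (m + n)) = ent N (\<lambda>x. (\<lambda>(u, v). u @ v) (itin c S m x, itin c S n ((S ^^ m) x)))"
    by (rule ent_cong) (simp add: itin_add)
  also have "\<dots> \<le> ent N (\<lambda>x. (itin c S m x, itin c S n ((S ^^ m) x)))"
    by (rule N.ent_compose_le[OF simple_function_pair[OF X Y]])
  also have "\<dots> \<le> ent N (itin c S m) + ent N (\<lambda>x. itin c S n ((S ^^ m) x))"
    by (rule N.ent_pair_le[OF X Y])
  finally show ?thesis by (simp add: ent_funpow_N[OF simple_itin[OF c]])
qed

lemma ent_itin_le:
  assumes c: "simple_function M c"
  shows "ent N (itin c S n) \<le> real n * ent N c"
proof (induction n)
  case 0
  show ?case by (simp add: itin_def[abs_def] N.ent_const)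
next
  case (Suc n)
  have "ent N (itin c S 1) = ent N (\<lambda>x. [c x])"
    by (rule ent_cong) (simp add: itin_def)
  also have "\<dots> \<le> ent N c"
    using N.ent_compose_le[of c "\<lambda>v. [v]"] c by (simp add: simple_N)
  finally show ?case
    using ent_itin_add_le[OF c, of n 1] Suc by (simp add: algebra_simps)
qed

text \<open>Under \<open>N\<close> the entropies are subadditive. Under \<open>M\<close> the
  itinerary from the second letter on has the law it has under \<open>N\<close>, so the entropy of n
  + 1 letters lies between \<open>ent N (itin c S n)\<close> and this number plus
  \<open>ent M c\<close>.\<close>

lemma ent_itin_convergent:
  assumes c: "simple_function M c"
  shows "\<exists>L. (\<lambda>n. ent N (itin c S n) / n) \<longlonglongrightarrow> L \<and> (\<lambda>n. ent M (itin c S n) / n) \<longlonglongrightarrow> L"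
proof -
  have "convergent (\<lambda>n. ent N (itin c S n) / real n)"
    by (rule subadditive_converges) (auto intro: N.ent_nonneg ent_itin_add_le[OF c])
  then obtain L where L: "(\<lambda>n. ent N (itin c S n) / real n) \<longlonglongrightarrow> L"
    by (auto simp: convergent_def)
  have X: "simple_function M (\<lambda>x. itin c S n (S x))" for n
    by (rule simple_function_comp_measurable[OF S simple_itin[OF c]])
  have lower: "ent N (itin c S n) \<le> ent M (itin c S (Suc n))" for n
  proof -
    have "ent N (itin c S n) = ent M (\<lambda>x. itin c S n (S x))"
      by (simp add: ent_shift_M simple_itin[OF c])
    also have "\<dots> = ent M (\<lambda>x. tl (itin c S (Suc n) x))"
      by (rule ent_cong) (simp add: itin_Suc)
    also have "\<dots> \<le> ent M (itin c S (Suc n))"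
      by (rule M.ent_compose_le[OF simple_itin[OF c]])
    finally show ?thesis .
  qed
  have upper: "ent M (itin c S (Suc n)) \<le> ent M c + ent N (itin c S n)" for n
  proof -
    have "ent M (itin c S (Suc n)) = ent M (\<lambda>x. (\<lambda>(u, v). u # v) (c x, itin c S n (S x)))"
      by (rule ent_cong) (simp add: itin_Suc)
    also have "\<dots> \<le> ent M (\<lambda>x. (c x, itin c S n (S x)))"
      by (rule M.ent_compose_le[OF simple_function_pair[OF c X]])
    also have "\<dots> \<le> ent M c + ent M (\<lambda>x. itin c S n (S x))"
      by (rule M.ent_pair_le[OF c X])
    finally show ?thesis by (simp add: ent_shift_M simple_itin[OF c])
  qed
  have quot: "(\<lambda>n. real n / real (Suc n)) \<longlonglongrightarrow> 1"
    by (rule LIMSEQ_n_over_Suc_n)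
  have L': "(\<lambda>n. ent N (itin c S n) / real (Suc n)) \<longlonglongrightarrow> L"
  proof (rule Lim_transform_eventually)
    show "(\<lambda>n. ent N (itin c S n) / real n * (real n / real (Suc n))) \<longlonglongrightarrow> L"
      using tendsto_mult[OF L quot] by simp
    show "\<forall>\<^sub>F n in sequentially. ent N (itin c S n) / real n * (real n / real (Suc n)) =
        ent N (itin c S n) / real (Suc n)"
      using eventually_gt_at_top[of 0] by eventually_elim simp
  qed
  have C: "(\<lambda>n. ent M c / real (Suc n)) \<longlonglongrightarrow> 0"
    by (rule LIMSEQ_Suc) (rule lim_const_over_n)
  have "(\<lambda>n. ent M (itin c S (Suc n)) / real (Suc n)) \<longlonglongrightarrow> L"
  proof (rule tendsto_sandwich[OF _ _ L'])
    show "(\<lambda>n. ent M c / real (Suc n) + ent N (itin c S n) / real (Suc n)) \<longlonglongrightarrow> L"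
      using tendsto_add[OF C L'] by simp
    show "\<forall>\<^sub>F n in sequentially. ent M (itin c S (Suc n)) / real (Suc n) \<le>
        ent M c / real (Suc n) + ent N (itin c S n) / real (Suc n)"
      unfolding add_divide_distrib[symmetric] using upper
      by (intro always_eventually allI divide_right_mono) auto
  qed (use lower in \<open>auto intro!: always_eventually divide_right_mono\<close>)
  then have "(\<lambda>n. ent M (itin c S n) / n) \<longlonglongrightarrow> L"
    by (rule LIMSEQ_imp_Suc)
  with L show ?thesis by blast
qed

text \<open>The labels may be infinitely many, so \<beta> need not be a simple function. Merging all
  labels outside a finite set into \<open>None\<close> makes it one and keeps the independence of
  the letters.\<close>

definition trunc :: "'b set \<Rightarrow> 'a \<Rightarrow> 'b option" where
  "trunc F x = (if \<beta> x \<in> F then Some (\<beta> x) else None)"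

lemma simple_trunc:
  assumes "finite F"
  shows "simple_function M (trunc F)"
  unfolding simple_function_def
proof (intro conjI ballI)
  show "finite (trunc F ` space M)"
    by (rule finite_subset[of _ "insert None (Some ` F)"]) (use assms in \<open>auto simp: trunc_def\<close>)
  fix v
  have "trunc F -` {v} \<inter> space M = {x \<in> space M. (if \<beta> x \<in> F then Some (\<beta> x) else None) = v}"
    by (auto simp: trunc_def)
  also have "\<dots> \<in> sets M" by measurable
  finally show "trunc F -` {v} \<inter> space M \<in> sets M" .
qed

lemma p_eq: "p b = measure N {x \<in> space M. \<beta> x = b}"
proof -
  have "{x \<in> space M. \<beta> x = b \<and> S x \<in> space M} = {x \<in> space M. \<beta> x = b}"
    using measurable_space[OF S] by auto
  then show ?thesis
    using indep[of "space M" b] N.prob_space by simp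
qed

lemma p_nonneg: "0 \<le> p b"
  unfolding p_eq by simp

text \<open>Independence survives the merging: the fibre of \<open>None\<close> is the complement of
  finitely many independent pieces inside the preimage of E.\<close>

lemma trunc_fiber:
  assumes F: "finite F" and E: "E \<in> sets M"
  shows "measure N {x \<in> space M. trunc F x = v \<and> S x \<in> E} =
    (case v of Some b \<Rightarrow> if b \<in> F then p b else 0 | None \<Rightarrow> 1 - sum p F) * measure N E"
proof (cases v)
  case (Some b)
  have eq: "{x \<in> space M. trunc F x = v \<and> S x \<in> E} =
      (if b \<in> F then {x \<in> space M. \<beta> x = b \<and> S x \<in> E} else {})"
    using Some by (auto simp: trunc_def)
  show ?thesis unfolding eq using Some indep[OF E] by simp
next
  case None
  have SE: "{x \<in> space M. S x \<in> E} \<in> sets M" using E by measurable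
  have \<beta>E: "{x \<in> space M. \<beta> x = b \<and> S x \<in> E} \<in> sets M" for b using E by measurable
  have "measure N {x \<in> space M. S x \<in> E} = measure N E"
  proof -
    have "measure (distr N N S) E = measure N (S -` E \<inter> space N)"
      using S_N E by (intro measure_distr) auto
    moreover have "S -` E \<inter> space N = {x \<in> space M. S x \<in> E}" by auto
    ultimately show ?thesis by (simp add: distr_N')
  qed
  moreover have "measure N {x \<in> space M. trunc F x = v \<and> S x \<in> E} =
      measure N {x \<in> space M. S x \<in> E} - measure N (\<Union>b\<in>F. {x \<in> space M. \<beta> x = b \<and> S x \<in> E})"
  proof -
    have "{x \<in> space M. trunc F x = v \<and> S x \<in> E} =
        {x \<in> space M. S x \<in> E} - (\<Union>b\<in>F. {x \<in> space M. \<beta> x = b \<and> S x \<in> E})"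
      using None by (auto simp: trunc_def)
    then show ?thesis
      using F SE \<beta>E by (simp only:) (rule N.finite_measure_Diff, auto)
  qed
  moreover have "measure N (\<Union>b\<in>F. {x \<in> space M. \<beta> x = b \<and> S x \<in> E}) = (\<Sum>b\<in>F. p b * measure N E)"
    unfolding indep[OF E, symmetric] using F \<beta>E
    by (intro N.finite_measure_finite_Union) (auto simp: disjoint_family_on_def)
  ultimately show ?thesis
    using None by (simp add: sum_distrib_right left_diff_distrib)
qed

lemma ent_trunc:
  assumes F: "finite F"
  shows "ent N (trunc F) = (\<Sum>b\<in>F. eta (p b)) + eta (1 - sum p F)"
proof -
  have pr: "measure N {x \<in> space N. trunc F x = v} =
    (case v of Some b \<Rightarrow> if b \<in> F then p b else 0 | None \<Rightarrow> 1 - sum p F)" for v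
  proof -
    have "{x \<in> space N. trunc F x = v} = {x \<in> space M. trunc F x = v \<and> S x \<in> space M}"
      using measurable_space[OF S] by auto
    then show ?thesis
      using trunc_fiber[OF F, of "space M" v] N.prob_space by simp
  qed
  have "ent N (trunc F) = (\<Sum>v\<in>insert None (Some ` F). eta (measure N {x \<in> space N. trunc F x = v}))"
    by (rule ent_superset) (use F in \<open>auto simp: trunc_def\<close>)
  also have "\<dots> = eta (1 - sum p F) + (\<Sum>v\<in>Some ` F. eta (measure N {x \<in> space N. trunc F x = v}))"
    unfolding pr using F by (subst sum.insert) auto
  also have "(\<Sum>v\<in>Some ` F. eta (measure N {x \<in> space N. trunc F x = v})) = (\<Sum>b\<in>F. eta (p b))"
    unfolding pr by (subst sum.reindex) (auto intro!: sum.cong)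
  finally show ?thesis by simp
qed

text \<open>The first truncated letter is independent of the itinerary of \<open>S x\<close>, and
  the latter has the same entropy as before by invariance of \<open>N\<close>.\<close>

lemma ent_itin_trunc:
  assumes F: "finite F"
  shows "ent N (itin (trunc F) S n) = real n * ent N (trunc F)"
proof (induction n)
  case 0
  show ?case by (simp add: itin_def[abs_def] N.ent_const)
next
  case (Suc n)
  let ?I = "itin (trunc F) S n"
  have c: "simple_function N (trunc F)" and I: "simple_function M ?I"
    using simple_trunc[OF F] simple_itin[OF simple_trunc[OF F]] by (simp_all add: simple_N)
  have X: "simple_function N (\<lambda>x. ?I (S x))"
    using simple_function_comp_measurable[OF S I] by (simp add: simple_N)
  have "ent N (itin (trunc F) S (Suc n)) = ent N (\<lambda>x. (\<lambda>(u, v). u # v) (trunc F x, ?I (S x)))"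
    by (rule ent_cong) (simp add: itin_Suc)
  also have "\<dots> = ent N (\<lambda>x. (trunc F x, ?I (S x)))"
    by (rule N.ent_inj[OF simple_function_pair[OF c X], of "\<lambda>l. (hd l, tl l)"]) simp
  also have "\<dots> = ent N (trunc F) + ent N (\<lambda>x. ?I (S x))"
  proof (rule N.ent_pair_indep[OF c X])
    fix a b
    let ?E = "{x \<in> space M. ?I x = b}"
    let ?g = "case a of Some b \<Rightarrow> if b \<in> F then p b else 0 | None \<Rightarrow> 1 - sum p F"
    have E: "?E \<in> sets M" by (rule simple_function_fiber[OF I])
    have 1: "measure N {x \<in> space N. trunc F x = a \<and> ?I (S x) = b} = ?g * measure N ?E"
    proof -
      have "{x \<in> space N. trunc F x = a \<and> ?I (S x) = b} = {x \<in> space M. trunc F x = a \<and> S x \<in> ?E}"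
        using measurable_space[OF S] by auto
      then show ?thesis using trunc_fiber[OF F E, of a] by simp
    qed
    have 2: "measure N {x \<in> space N. trunc F x = a} = ?g"
    proof -
      have "{x \<in> space N. trunc F x = a} = {x \<in> space M. trunc F x = a \<and> S x \<in> space M}"
        using measurable_space[OF S] by auto
      then show ?thesis using trunc_fiber[OF F, of "space M" a] N.prob_space by simp
    qed
    have 3: "measure N {x \<in> space N. ?I (S x) = b} = measure N ?E"
    proof -
      have "measure (distr N N S) ?E = measure N (S -` ?E \<inter> space N)"
        using S_N E by (intro measure_distr) auto
      moreover have "S -` ?E \<inter> space N = {x \<in> space N. ?I (S x) = b}"
        using measurable_space[OF S] by auto
      ultimately show ?thesis by (simp add: distr_N')
    qed
    show "measure N {x \<in> space N. trunc F x = a \<and> ?I (S x) = b} =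
        measure N {x \<in> space N. trunc F x = a} * measure N {x \<in> space N. ?I (S x) = b}"
      unfolding 1 2 3 ..
  qed
  also have "\<dots> = real (Suc n) * ent N (trunc F)"
    using Suc by (simp add: ent_shift_N[OF I] algebra_simps)
  finally show ?case .
qed

section \<open>Arbitrary partitions approximated by codes in truncated labels\<close>

definition label_entropy :: real where
  "label_entropy = (\<Sum>\<^sub>\<infinity>b. eta (p b))"

lemma p_le_1: "p b \<le> 1"
  unfolding p_eq by simp

lemma sum_p_le_1: "finite F \<Longrightarrow> sum p F \<le> 1"
proof -
  assume F: "finite F"
  have "sum p F = measure N (\<Union>b\<in>F. {x \<in> space M. \<beta> x = b})"
    unfolding p_eq using F
    by (intro N.finite_measure_finite_Union[symmetric]) (auto simp: disjoint_family_on_def)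
  then show ?thesis by simp
qed

lemma sum_eta_le: "finite F \<Longrightarrow> (\<Sum>b\<in>F. eta (p b)) \<le> label_entropy"
  unfolding label_entropy_def
  by (rule finite_sum_le_infsum[OF summable]) (auto intro!: eta_nonneg p_nonneg p_le_1)

definition initial_labels :: "nat \<Rightarrow> 'b set" where
  "initial_labels k = from_nat ` {..<k}"

lemma finite_initial_labels: "finite (initial_labels k)"
  by (simp add: initial_labels_def)

lemma initial_labels_mono: "k \<le> l \<Longrightarrow> initial_labels k \<subseteq> initial_labels l"
  by (auto simp: initial_labels_def)

lemma initial_labels_exhausts: "\<exists>k0. \<forall>k\<ge>k0. b \<in> initial_labels k"
  by (rule exI[of _ "Suc (to_nat b)"]) (auto simp: initial_labels_def image_iff intro!: bexI[of _ "to_nat b"])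

text \<open>A single parameter controls both the number of letters and the number of labels that are
  kept, so larger k gives strictly more information in both respects.\<close>

definition code :: "nat \<Rightarrow> 'a \<Rightarrow> 'b option list" where
  "code k = itin (trunc (initial_labels k)) S k"

lemma simple_code: "simple_function M (code k)"
  unfolding code_def by (intro simple_itin simple_trunc finite_initial_labels)

definition diff_set :: "'a set \<Rightarrow> nat \<Rightarrow> 'b option list set \<Rightarrow> 'a set" where
  "diff_set A k D = {x \<in> space M. (x \<in> A) \<noteq> (code k x \<in> D)}"

lemma code_event: "{x \<in> space M. code k x \<in> D} \<in> sets M"
proof -
  have "{x \<in> space M. code k x \<in> D} = code k -` D \<inter> space M" by auto
  with simple_functionD(2)[OF simple_code, of k D] show ?thesis by simp
qed

lemma diff_set_event: "A \<in> sets M \<Longrightarrow> diff_set A k D \<in> sets M"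
proof -
  assume A: "A \<in> sets M"
  have "diff_set A k D = (A - {x \<in> space M. code k x \<in> D}) \<union> ({x \<in> space M. code k x \<in> D} - A)"
    using sets.sets_into_space[OF A] by (auto simp: diff_set_def)
  then show ?thesis using A code_event by auto
qed

text \<open>The sets that can be approximated by codes form a sigma-algebra containing the
  generating cylinders. Asking for all large k, not just one, provides a common k for finite
  unions.\<close>

lemma approximable:
  assumes "A \<in> sets M" "\<delta> > 0"
  shows "\<exists>k0. \<forall>k\<ge>k0. \<exists>D. measure N (diff_set A k D) < \<delta>"
  using assms(1) unfolding generates using assms(2)
proof (induction arbitrary: \<delta> rule: sigma_sets.induct)
  case (Basic A)
  then obtain m a where A: "A = {x \<in> space M. \<forall>i<m. \<beta> ((S ^^ i) x) = a i}" by auto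
  have "\<exists>k0. \<forall>i<m. \<forall>k\<ge>k0. a i \<in> initial_labels k"
  proof (induction m)
    case (Suc m)
    then obtain k0 where k0: "\<forall>i<m. \<forall>k\<ge>k0. a i \<in> initial_labels k" by auto
    obtain k1 where "\<forall>k\<ge>k1. a m \<in> initial_labels k" using initial_labels_exhausts by blast
    with k0 show ?case by (intro exI[of _ "max k0 k1"]) (auto simp: less_Suc_eq)
  qed simp
  then obtain k0 where k0: "\<And>i k. i < m \<Longrightarrow> k \<ge> k0 \<Longrightarrow> a i \<in> initial_labels k" by blast
  show ?case
  proof (intro exI allI impI)
    fix k assume k: "k \<ge> max k0 m"
    have "trunc (initial_labels k) ((S ^^ i) x) = Some (a i) \<longleftrightarrow> \<beta> ((S ^^ i) x) = a i" if "i < m" for i x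
      using k0[OF that, of k] k by (auto simp: trunc_def)
    then have "diff_set A k {l. \<forall>i<m. l ! i = Some (a i)} = {}"
      using k unfolding diff_set_def A code_def by auto
    then show "measure N (diff_set A k {l. \<forall>i<m. l ! i = Some (a i)}) < \<delta>"
      using Basic by simp
  qed
next
  case Empty
  have "diff_set {} k {} = {}" for k by (simp add: diff_set_def)
  with Empty show ?case by (metis measure_empty)
next
  case (Compl A)
  have "diff_set (space M - A) k (- D) = diff_set A k D" for k D
    by (auto simp: diff_set_def)
  with Compl show ?case by metis
next
  case (Union A)
  have A: "A i \<in> sets M" for i using Union.hyps generates by auto
  have "(\<lambda>n. measure N (\<Union>i<n. A i)) \<longlonglongrightarrow> measure N (\<Union>n. \<Union>i<n. A i)"
    using A by (intro N.finite_Lim_measure_incseq) (auto simp: incseq_def intro: less_le_trans)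
  moreover have "(\<Union>n. \<Union>i<n. A i) = (\<Union>i. A i)" by blast
  ultimately have "(\<lambda>n. measure N (\<Union>i<n. A i)) \<longlonglongrightarrow> measure N (\<Union>i. A i)" by simp
  from LIMSEQ_D[OF this, of "\<delta> / 2"] Union.prems
  obtain n where n: "\<bar>measure N (\<Union>i<n. A i) - measure N (\<Union>i. A i)\<bar> < \<delta> / 2" by auto
  \<comment> \<open>A countable union is replaced by its first n members at the cost of half of
    \<delta>; the other half is shared by the n approximation errors.\<close>
  define R where "R = (\<Union>i. A i) - (\<Union>i<n. A i)"
  have R: "R \<in> sets M" unfolding R_def using A by auto
  have "measure N R = measure N (\<Union>i. A i) - measure N (\<Union>i<n. A i)"
    unfolding R_def using A by (intro N.finite_measure_Diff) auto
  with n have R_small: "measure N R < \<delta> / 2" by linarith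
  define \<epsilon> where "\<epsilon> = \<delta> / 2 / (real n + 1)"
  have \<epsilon>: "\<epsilon> > 0" using Union.prems by (simp add: \<epsilon>_def)
  have "\<forall>i. \<exists>k0. \<forall>k\<ge>k0. \<exists>D. measure N (diff_set (A i) k D) < \<epsilon>"
    using Union.IH[OF \<epsilon>] by blast
  then obtain k0 where k0: "\<And>i k. k \<ge> k0 i \<Longrightarrow> \<exists>D. measure N (diff_set (A i) k D) < \<epsilon>" by metis
  show ?case
  proof (intro exI[of _ "\<Sum>i<n. k0 i"] allI impI)
    fix k assume k: "(\<Sum>i<n. k0 i) \<le> k"
    have "\<exists>D. measure N (diff_set (A i) k D) < \<epsilon>" if "i < n" for i
    proof (rule k0)
      have "k0 i \<le> (\<Sum>i<n. k0 i)" using that by (intro member_le_sum) auto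
      with k show "k0 i \<le> k" by simp
    qed
    then obtain D where D: "\<And>i. i < n \<Longrightarrow> measure N (diff_set (A i) k (D i)) < \<epsilon>" by metis
    have sub: "diff_set (\<Union>i. A i) k (\<Union>i<n. D i) \<subseteq> R \<union> (\<Union>i<n. diff_set (A i) k (D i))"
      unfolding diff_set_def R_def by blast
    have "R \<union> (\<Union>i<n. diff_set (A i) k (D i)) \<in> sets N"
      using R A diff_set_event by auto
    then have "measure N (diff_set (\<Union>i. A i) k (\<Union>i<n. D i)) \<le>
        measure N (R \<union> (\<Union>i<n. diff_set (A i) k (D i)))"
      using sub by (rule N.finite_measure_mono[rotated])
    also have "\<dots> \<le> measure N R + measure N (\<Union>i<n. diff_set (A i) k (D i))"
      using R A diff_set_event by (intro measure_Un_le) auto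
    also have "\<dots> \<le> measure N R + (\<Sum>i<n. measure N (diff_set (A i) k (D i)))"
      using A diff_set_event by (intro add_left_mono N.finite_measure_subadditive_finite) auto
    also have "\<dots> \<le> measure N R + (\<Sum>i<n. \<epsilon>)"
      using D by (intro add_left_mono sum_mono) (auto intro: less_imp_le)
    also have "(\<Sum>i<n. \<epsilon>) \<le> \<delta> / 2"
      using Union.prems by (simp add: \<epsilon>_def field_simps)
    finally show "\<exists>D. measure N (diff_set (\<Union>i. A i) k D) < \<delta>"
      using R_small by (intro exI[of _ "\<Union>i<n. D i"]) linarith
  qed
qed

lemma sum_p_exhausts: "(\<lambda>k. sum p (F \<union> initial_labels k)) \<longlonglongrightarrow> 1" if F: "finite F"
proof -
  let ?B = "\<lambda>k. \<Union>b\<in>F \<union> initial_labels k. {x \<in> space M. \<beta> x = b}"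
  have ev: "{x \<in> space M. \<beta> x = b} \<in> sets M" for b by measurable
  have "sum p (F \<union> initial_labels k) = measure N (?B k)" for k
    unfolding p_eq using F finite_initial_labels ev
    by (intro N.finite_measure_finite_Union[symmetric]) (auto simp: disjoint_family_on_def)
  moreover have "(\<lambda>k. measure N (?B k)) \<longlonglongrightarrow> measure N (\<Union>k. ?B k)"
  proof (rule N.finite_Lim_measure_incseq)
    have "?B k \<in> sets N" for k using F finite_initial_labels ev by auto
    then show "range ?B \<subseteq> sets N" by blast
    show "incseq ?B"
      unfolding incseq_def using initial_labels_mono by blast
  qed
  moreover have "(\<Union>k. ?B k) = space N"
    using initial_labels_exhausts by fastforce
  moreover have "N.prob (space N) = 1" by (rule N.prob_space)
  ultimately show ?thesis by simp
qed

text \<open>The labels outside \<open>F\<close> carry the total mass \<open>t\<close>, so each of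
  them has probability at most t and \<open>eta_le_mult_ln\<close> charges it with -ln t. Exhausting
  these labels recovers the term eta t of the merged label.\<close>

lemma ent_trunc_le:
  assumes F: "finite F"
  shows "ent N (trunc F) \<le> label_entropy"
proof -
  define t where "t = 1 - sum p F"
  have "(\<lambda>k. (sum p (F \<union> initial_labels k) - sum p F) * - ln t) \<longlonglongrightarrow> (1 - sum p F) * - ln t"
    by (intro tendsto_intros sum_p_exhausts F)
  moreover have "(sum p (F \<union> initial_labels k) - sum p F) * - ln t \<le> label_entropy - (\<Sum>b\<in>F. eta (p b))" for k
  proof -
    let ?G = "initial_labels k - F"
    have fin: "finite ?G" using finite_initial_labels by auto
    have split: "sum f (F \<union> initial_labels k) = sum f F + sum f ?G" for f :: "'b \<Rightarrow> real"
      using sum.union_disjoint[OF F fin, of f] by simp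
    have "p b \<le> t" if "b \<in> ?G" for b
    proof -
      have "p b \<le> sum p ?G" using that fin by (intro member_le_sum) (auto simp: p_nonneg)
      with sum_p_le_1[of "F \<union> initial_labels k"] F finite_initial_labels show ?thesis
        by (simp add: split t_def)
    qed
    then have "(\<Sum>b\<in>?G. p b * - ln t) \<le> (\<Sum>b\<in>?G. eta (p b))"
      by (intro sum_mono eta_le_mult_ln p_nonneg)
    moreover have "(\<Sum>b\<in>?G. p b * - ln t) = (sum p (F \<union> initial_labels k) - sum p F) * - ln t"
      unfolding split by (simp only: sum_distrib_right[symmetric]) simp
    moreover have "(\<Sum>b\<in>F. eta (p b)) + (\<Sum>b\<in>?G. eta (p b)) \<le> label_entropy"
      unfolding split[symmetric] using F finite_initial_labels by (intro sum_eta_le) auto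
    ultimately show ?thesis by linarith
  qed
  ultimately have "(1 - sum p F) * - ln t \<le> label_entropy - (\<Sum>b\<in>F. eta (p b))"
    by (intro tendsto_upperbound[OF _ always_eventually]) auto
  then show ?thesis
    unfolding ent_trunc[OF F] by (simp add: eta_def t_def)
qed

text \<open>The partition \<open>c\<close> is a function of the code of some length \<open>k\<close> and of the set \<open>d x\<close> of cells on which
  the approximation by codes fails. The latter is almost constant, so it has small entropy.\<close>

lemma ent_itin_limit_le:
  assumes c: "simple_function M c" and L: "(\<lambda>n. ent N (itin c S n) / n) \<longlonglongrightarrow> L"
  shows "L \<le> label_entropy"
proof (rule field_le_epsilon)
  fix e :: real assume e: "e > 0"
  define V where "V = c ` space M"
  have V: "finite V" unfolding V_def using c by (rule simple_functionD)
  define A where "A v = {x \<in> space M. c x = v}" for v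
  have A: "A v \<in> sets M" for v unfolding A_def by (rule simple_function_fiber[OF c])
  define K where "K = real (card (Pow V))"
  have K: "K > 0" unfolding K_def using V by (simp add: card_Pow)
  have "((\<lambda>t. K * (2 * sqrt t + t)) \<longlongrightarrow> K * (2 * sqrt 0 + 0)) (at_right 0)"
    by (intro tendsto_intros)
  then have "\<forall>\<^sub>F t in at_right 0. K * (2 * sqrt t + t) < e"
    using e by (intro order_tendstoD(2)) auto
  then obtain t0 where t0: "t0 > 0" "\<And>t. 0 < t \<Longrightarrow> t < t0 \<Longrightarrow> K * (2 * sqrt t + t) < e"
    by (auto simp: eventually_at_right_field)
  define t where "t = t0 / 2"
  have t: "t > 0" "K * (2 * sqrt t + t) < e" using t0 by (auto simp: t_def)
  \<comment> \<open>The card V exceptional sets together then have mass at most t.\<close>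
  define \<epsilon> where "\<epsilon> = t / (real (card V) + 1)"
  have \<epsilon>: "\<epsilon> > 0" using t by (simp add: \<epsilon>_def)
  obtain k0 where k0: "\<And>v k. k \<ge> k0 v \<Longrightarrow> \<exists>D. measure N (diff_set (A v) k D) < \<epsilon>"
    using approximable[OF A \<epsilon>] by metis
  define k where "k = (\<Sum>v\<in>V. k0 v)"
  have "\<exists>D. measure N (diff_set (A v) k D) < \<epsilon>" if "v \<in> V" for v
    using that V by (intro k0) (auto simp: k_def intro: member_le_sum)
  then obtain D where D: "\<And>v. v \<in> V \<Longrightarrow> measure N (diff_set (A v) k (D v)) < \<epsilon>" by metis
  define d where "d x = {v \<in> V. x \<in> diff_set (A v) k (D v)}" for x
  have d_simple: "simple_function M d"
  proof -
    have "simple_function M (\<lambda>x. {v \<in> V. (c x = v) \<noteq> (code k x \<in> D v)})"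
      by (rule simple_function_compose2[OF c simple_code])
    then show ?thesis
      by (rule simple_function_cong[THEN iffD1, rotated]) (auto simp: d_def diff_set_def A_def)
  qed
  have "measure N {x \<in> space M. d x \<noteq> {}} \<le> measure N (\<Union>v\<in>V. diff_set (A v) k (D v))"
    using V A diff_set_event by (intro N.finite_measure_mono) (auto simp: d_def)
  also have "\<dots> \<le> (\<Sum>v\<in>V. measure N (diff_set (A v) k (D v)))"
    using V A diff_set_event by (intro N.finite_measure_subadditive_finite) auto
  also have "\<dots> \<le> (\<Sum>v\<in>V. \<epsilon>)"
    using D by (intro sum_mono) (auto intro: less_imp_le)
  also have "\<dots> \<le> t"
    using t by (simp add: \<epsilon>_def field_simps)
  finally have "ent N d \<le> K * (2 * sqrt t + t)"
    unfolding K_def using V d_simple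
    by (intro N.ent_concentrated_le[of d "Pow V" "{}"]) (auto simp: simple_N d_def)
  with t have ent_d: "ent N d \<le> e" by simp
  \<comment> \<open>Since v belongs to \<open>d x\<close> exactly when the code misjudges whether c
    x = v, the exclusive or of the two tests holds for v = c x only.\<close>
  define r where "r = (\<lambda>(u, w). SOME v. v \<in> V \<and> ((u \<in> D v) \<noteq> (v \<in> w)))"
  have c_eq: "c x = r (code k x, d x)" if "x \<in> space M" for x
  proof -
    have "v \<in> V \<and> ((code k x \<in> D v) \<noteq> (v \<in> d x)) \<longleftrightarrow> v = c x" for v
      using that by (auto simp: d_def diff_set_def A_def V_def)
    then show ?thesis by (simp add: r_def)
  qed
  let ?q = "trunc (initial_labels k)"
  have q: "simple_function M ?q" by (rule simple_trunc[OF finite_initial_labels])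
  have bound: "ent N (itin c S n) \<le> real n * (label_entropy + e) + real k * label_entropy" for n
  proof -
    \<comment> \<open>The k additional letters give each of the n positions a complete window of
      length k.\<close>
    let ?Q = "itin ?q S (n + k)" and ?d = "itin d S n"
    have Q: "simple_function N ?Q" and dn: "simple_function N ?d"
      using simple_itin[OF q] simple_itin[OF d_simple] by (simp_all add: simple_N)
    define g where "g = (\<lambda>(u, w). map (\<lambda>i. r (take k (drop i u), w ! i)) [0..<n])"
    have "itin c S n x = g (?Q x, ?d x)" if x: "x \<in> space M" for x
    proof (rule nth_equalityI)
      fix i assume "i < length (itin c S n x)"
      then have i: "i < n" by simp
      have Sx: "(S ^^ i) x \<in> space M"
        by (rule measurable_space[OF measurable_funpow[OF S] x])
      have "n + k = i + (k + (n - i))" using i by simp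
      then have "?Q x = itin ?q S i x @ itin ?q S k ((S ^^ i) x) @ itin ?q S (n - i) ((S ^^ k) ((S ^^ i) x))"
        by (simp only: itin_add)
      then have "take k (drop i (?Q x)) = code k ((S ^^ i) x)"
        by (simp add: code_def)
      with i show "itin c S n x ! i = g (?Q x, ?d x) ! i"
        by (simp add: g_def c_eq[OF Sx])
    qed (simp add: g_def)
    then have "ent N (itin c S n) = ent N (\<lambda>x. g (?Q x, ?d x))"
      by (intro ent_cong) simp
    also have "\<dots> \<le> ent N (\<lambda>x. (?Q x, ?d x))"
      by (rule N.ent_compose_le[OF simple_function_pair[OF Q dn]])
    also have "\<dots> \<le> ent N ?Q + ent N ?d"
      by (rule N.ent_pair_le[OF Q dn])
    also have "\<dots> \<le> real (n + k) * ent N ?q + real n * ent N d"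
      by (intro add_mono ent_itin_le q d_simple)
    also have "\<dots> \<le> real (n + k) * label_entropy + real n * e"
      using ent_d by (intro add_mono mult_left_mono ent_trunc_le finite_initial_labels) auto
    finally show ?thesis by (simp add: algebra_simps)
  qed
  have "(\<lambda>n. (label_entropy + e) + real k * label_entropy / real n) \<longlonglongrightarrow> (label_entropy + e) + 0"
    by (intro tendsto_intros lim_const_over_n)
  then have lim: "(\<lambda>n. (label_entropy + e) + real k * label_entropy / real n) \<longlonglongrightarrow> label_entropy + e" by simp
  show "L \<le> label_entropy + e"
  proof (rule tendsto_le[OF _ lim L])
    show "\<forall>\<^sub>F n in sequentially. ent N (itin c S n) / real n \<le> label_entropy + e + real k * label_entropy / real n"
      using eventually_gt_at_top[of 0]
    proof eventually_elim
      case (elim n)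
      with bound[of n] show ?case by (simp add: field_simps)
    qed
  qed simp
qed

text \<open>The upper bound holds for each partition by approximation with codes. For the lower
  bound the partitions by truncated labels have entropy rate exactly \<open>ent N (trunc F)\<close>,
  at least the sum over \<open>F\<close>, and \<open>F\<close> exhausts the labels.\<close>

theorem ks_entropy_eq:
  assumes b: "b > 1"
  shows "ks_entropy b M S = ereal (label_entropy / ln b)"
proof -
  have lnb: "ln b > 0" using b by simp
  have lim_P: "\<exists>L. L \<le> label_entropy \<and> (\<lambda>n. ent N (itin (cell P) S n) / n) \<longlonglongrightarrow> L \<and>
      lim (\<lambda>n. partition_entropy b M (iterated_join M S P n) / real n) = L / ln b"
    if P: "finite_measurable_partition M P" for P
  proof -
    have c: "simple_function M (cell P)" by (rule simple_function_cell[OF P])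
    obtain L where L: "(\<lambda>n. ent N (itin (cell P) S n) / n) \<longlonglongrightarrow> L"
      "(\<lambda>n. ent M (itin (cell P) S n) / n) \<longlonglongrightarrow> L"
      using ent_itin_convergent[OF c] by blast
    have "(\<lambda>n. ent M (itin (cell P) S n) / real n / ln b) \<longlonglongrightarrow> L / ln b"
      using L(2) lnb by (intro tendsto_divide tendsto_const) auto
    then have "(\<lambda>n. partition_entropy b M (iterated_join M S P n) / real n) \<longlonglongrightarrow> L / ln b"
    proof (rule Lim_transform_eventually)
      show "\<forall>\<^sub>F n in sequentially. ent M (itin (cell P) S n) / real n / ln b =
          partition_entropy b M (iterated_join M S P n) / real n"
        using eventually_ge_at_top[of 1]
        by eventually_elim (simp add: partition_entropy_iterated_join[OF P S] mult.commute)
    qed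
    then have "lim (\<lambda>n. partition_entropy b M (iterated_join M S P n) / real n) = L / ln b"
      by (rule limI)
    with L(1) ent_itin_limit_le[OF c L(1)] show ?thesis by blast
  qed
  let ?K = "ks_entropy b M S"
  have "?K \<le> ereal (label_entropy / ln b)"
    unfolding ks_entropy_def
  proof (rule SUP_least)
    fix P assume "P \<in> {P. finite_measurable_partition M P}"
    with lim_P[of P] lnb
    show "ereal (lim (\<lambda>n. partition_entropy b M (iterated_join M S P n) / real n)) \<le> ereal (label_entropy / ln b)"
      by (auto intro!: divide_right_mono[OF _ less_imp_le[OF lnb]])
  qed
  moreover have "ereal (label_entropy / ln b) \<le> ?K"
  proof -
    have sums: "ereal ((\<Sum>b\<in>F. eta (p b)) / ln b) \<le> ?K" if F: "finite F" for F
    proof -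
      let ?q = "trunc F"
      have q: "simple_function M ?q" by (rule simple_trunc[OF F])
      define P where "P = (\<lambda>v. {x \<in> space M. ?q x = v}) ` ?q ` space M"
      have part: "partition_on (space M) P"
        unfolding P_def by (rule partition_onI) (auto simp: disjnt_def)
      have P: "finite_measurable_partition M P"
        unfolding finite_measurable_partition_def using part simple_functionD(1)[OF q]
        by (auto simp: P_def intro: simple_function_fiber[OF q])
      obtain L where L: "(\<lambda>n. ent N (itin (cell P) S n) / n) \<longlonglongrightarrow> L"
        "lim (\<lambda>n. partition_entropy b M (iterated_join M S P n) / real n) = L / ln b"
        using lim_P[OF P] by blast
      \<comment> \<open>The truncated label is constant on cells, so it can be read off from any
        chosen point of a cell.\<close>
      have q_eq: "?q x = ?q (SOME y. y \<in> cell P x)" if x: "x \<in> space M" for x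
      proof -
        have "cell P x = {y \<in> space M. ?q y = ?q x}"
          using x by (intro cell_eqI[OF part]) (auto simp: P_def)
        moreover have "x \<in> cell P x" by (rule cell_in[OF part x])
        ultimately show ?thesis using someI[of "\<lambda>y. y \<in> cell P x" x] by auto
      qed
      have le: "real n * ent N ?q \<le> ent N (itin (cell P) S n)" for n
      proof -
        have "real n * ent N ?q = ent N (itin ?q S n)" by (rule ent_itin_trunc[OF F, symmetric])
        also have "\<dots> = ent N (\<lambda>x. map (\<lambda>A. ?q (SOME y. y \<in> A)) (itin (cell P) S n x))"
        proof (rule ent_cong)
          fix x assume "x \<in> space N"
          then have "(S ^^ i) x \<in> space M" for i
            using measurable_space[OF measurable_funpow[OF S]] by simp
          then show "itin ?q S n x = map (\<lambda>A. ?q (SOME y. y \<in> A)) (itin (cell P) S n x)"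
            using q_eq by (simp add: itin_def)
        qed
        also have "\<dots> \<le> ent N (itin (cell P) S n)"
          using simple_itin[OF simple_function_cell[OF P]]
          by (intro N.ent_compose_le) (simp add: simple_N)
        finally show ?thesis .
      qed
      have "ent N ?q \<le> L"
      proof (rule tendsto_lowerbound[OF L(1)])
        show "\<forall>\<^sub>F n in sequentially. ent N ?q \<le> ent N (itin (cell P) S n) / real n"
          using eventually_gt_at_top[of 0]
        proof eventually_elim
          case (elim n)
          with le[of n] show ?case by (simp add: field_simps)
        qed
      qed simp
      moreover have "(\<Sum>b\<in>F. eta (p b)) \<le> ent N ?q"
        unfolding ent_trunc[OF F] using sum_p_le_1[OF F]
        by (simp add: eta_nonneg sum_nonneg p_nonneg)
      ultimately have "ereal ((\<Sum>b\<in>F. eta (p b)) / ln b) \<le>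
          ereal (lim (\<lambda>n. partition_entropy b M (iterated_join M S P n) / real n))"
        unfolding L(2) using lnb by (auto intro: divide_right_mono)
      also have "\<dots> \<le> ?K"
        unfolding ks_entropy_def using P by (intro SUP_upper) auto
      finally show ?thesis .
    qed
    have "ereal (label_entropy / ln b) \<le> ?K"
    proof (rule tendsto_upperbound)
      have "(sum (\<lambda>b. eta (p b)) \<longlongrightarrow> label_entropy) (finite_subsets_at_top UNIV)"
        using has_sum_infsum[OF summable] by (simp add: has_sum_def label_entropy_def)
      then show "((\<lambda>F. ereal ((\<Sum>b\<in>F. eta (p b)) / ln b)) \<longlongrightarrow> ereal (label_entropy / ln b)) (finite_subsets_at_top UNIV)"
        using lnb by (intro tendsto_intros) auto
      show "\<forall>\<^sub>F F in finite_subsets_at_top UNIV. ereal ((\<Sum>b\<in>F. eta (p b)) / ln b) \<le> ?K"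
        using sums by (intro eventually_finite_subsets_at_top_weakI) auto
    qed simp
    then show ?thesis .
  qed
  ultimately show ?thesis by (rule antisym)
qed

end

section \<open>Expansions in the golden base\<close>

abbreviation \<phi> :: real where
  "\<phi> \<equiv> golden_ratio"

lemma phi_bounds: "1.6 < \<phi>" "\<phi> < 1.7"
proof -
  have "2.2 < sqrt 5" by (rule real_less_rsqrt) (simp add: power2_eq_square)
  moreover have "sqrt 5 < 2.4" by (rule real_less_lsqrt) (simp_all add: power2_eq_square)
  ultimately show "1.6 < \<phi>" "\<phi> < 1.7" by (auto simp: golden_ratio_def)
qed

lemma phi_square: "\<phi> * \<phi> = \<phi> + 1"
  by (simp add: golden_ratio_def field_simps)

lemma phi_pos [simp]: "0 < \<phi>" "0 \<le> \<phi>" "\<phi> \<noteq> 0" "1 < \<phi>" "1 \<le> \<phi>" "\<not> \<phi> < 0" "\<not> \<phi> \<le> 0"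
  using phi_bounds by auto

lemma inverse_phi: "1 / \<phi> = \<phi> - 1"
  using phi_square by (simp add: field_simps)

text \<open>Horner evaluation with the leading digit first. At \<phi> it is the value of the word,
  scaled to an element of Z[\<phi>]; at \<open>phi'\<close> it is the conjugate of this
  value.\<close>

definition hor :: "real \<Rightarrow> int list \<Rightarrow> real" where
  "hor t w = foldl (\<lambda>r c. t * r + of_int c) 0 w"

lemma hor_Nil [simp]: "hor t [] = 0"
  by (simp add: hor_def)

lemma hor_snoc [simp]: "hor t (w @ [c]) = t * hor t w + of_int c"
  by (simp add: hor_def)

lemma hor_append: "hor t (u @ w) = hor t u * t ^ length w + hor t w"
proof (induction w rule: rev_induct)
  case (snoc c w)
  then have "hor t ((u @ w) @ [c]) = hor t u * t ^ length (w @ [c]) + hor t (w @ [c])"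
    unfolding hor_snoc by (simp add: algebra_simps)
  then show ?case by simp
qed simp

lemma hor_singleton [simp]: "hor t [c] = of_int c"
  using hor_snoc[of t "[]" c] by simp

lemma hor_Cons: "hor t (c # w) = of_int c * t ^ length w + hor t w"
  using hor_append[of t "[c]" w] by simp

lemma hor_diff:
  assumes "length u = length w"
  shows "hor t (map2 (-) u w) = hor t u - hor t w"
  using assms by (induction u w rule: list_induct2) (auto simp: hor_Cons algebra_simps)

definition words :: "nat \<Rightarrow> int list set" where
  "words n = {w. length w = n \<and> set w \<subseteq> {0, 1}}"

lemma finite_words [simp]: "finite (words n)"
  using finite_lists_length_eq[of "{0, 1 :: int}" n] by (simp add: words_def conj_commute)

lemma words_0 [simp]: "words 0 = {[]}"
  by (auto simp: words_def)

lemma words_Suc: "words (Suc n) = (\<lambda>(c, w). c # w) ` ({0, 1} \<times> words n)"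
  by (auto simp: words_def length_Suc_conv image_iff)

lemma word_diff_digits:
  assumes "u \<in> words n" "w \<in> words n"
  shows "set (map2 (-) u w) \<subseteq> {-1, 0, 1}"
proof -
  have "a - b \<in> {-1, 0, 1}" if "(a, b) \<in> set (zip u w)" for a b
  proof -
    have "a \<in> {0, 1}" "b \<in> {0, 1}"
      using set_zip_leftD[OF that] set_zip_rightD[OF that] assms by (auto simp: words_def)
    then show ?thesis by auto
  qed
  then show ?thesis by (auto simp only: set_map image_iff split_beta prod.collapse)
qed

section \<open>Conjugation in Z[\<phi>] and separation of values\<close>

abbreviation phi' :: real where
  "phi' \<equiv> 1 - \<phi>"

lemma phi'_eq: "phi' = - (1 / \<phi>)"
  by (simp add: inverse_phi)

text \<open>The bound \<phi>^2 is the fixed point of r \<mapsto> r/\<phi> + 1. Its strictness is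
  essential later, because several remainders have modulus exactly \<phi>^2.\<close>

lemma conj_bound:
  assumes "set w \<subseteq> {-1, 0, 1}"
  shows "\<bar>hor phi' w\<bar> < \<phi> * \<phi>"
  using assms
proof (induction w rule: rev_induct)
  case Nil
  then show ?case by simp
next
  case (snoc c w)
  then have IH: "\<bar>hor phi' w\<bar> < \<phi> * \<phi>" and c: "\<bar>real_of_int c\<bar> \<le> 1" by auto
  have "\<bar>hor phi' (w @ [c])\<bar> \<le> \<bar>phi' * hor phi' w\<bar> + \<bar>real_of_int c\<bar>"
    by simp
  also have "\<bar>phi' * hor phi' w\<bar> = \<bar>hor phi' w\<bar> / \<phi>"
    unfolding phi'_eq by (simp add: abs_mult)
  also have "\<bar>hor phi' w\<bar> / \<phi> < \<phi>"
    using IH by (simp add: divide_less_eq)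
  finally show ?case using c phi_square by linarith
qed

text \<open>The integers do not depend on t, so evaluations at the two roots of t^2 = t + 1 are
  conjugate to each other.\<close>

lemma hor_int_rep: "\<exists>a b :: int. \<forall>t :: real. t * t = t + 1 \<longrightarrow> hor t w = of_int a + of_int b * t"
proof (induction w rule: rev_induct)
  case Nil
  show ?case by (intro exI[of _ 0]) simp
next
  case (snoc c w)
  then obtain a b :: int where ab: "\<And>t :: real. t * t = t + 1 \<Longrightarrow> hor t w = of_int a + of_int b * t" by blast
  have "hor t (w @ [c]) = of_int (b + c) + of_int (a + b) * t" if "t * t = t + 1" for t :: real
  proof -
    have "hor t (w @ [c]) = a * t + b * (t * t) + c"
      by (simp add: ab[OF that] algebra_simps)
    then show ?thesis unfolding that by (simp add: algebra_simps)
  qed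
  then show ?case by blast
qed

lemma phi'_square: "phi' * phi' = phi' + 1"
  using phi_square by (simp add: algebra_simps)

text \<open>Infinite descent: modulo 2 the equation forces both numbers to be even, and halving them
  preserves it.\<close>

lemma golden_norm_zero:
  fixes a b :: int
  assumes "a * a + a * b = b * b"
  shows "a = 0 \<and> b = 0"
  using assms
proof (induction "nat \<bar>a\<bar> + nat \<bar>b\<bar>" arbitrary: a b rule: less_induct)
  case less
  have "even a \<and> even b"
    using less.prems by (metis even_add even_mult_iff)
  then obtain c d where cd: "a = 2 * c" "b = 2 * d" by (auto elim!: evenE)
  have "c * c + c * d = d * d" using less.prems unfolding cd by simp
  moreover have "nat \<bar>c\<bar> + nat \<bar>d\<bar> < nat \<bar>a\<bar> + nat \<bar>b\<bar>" if "a \<noteq> 0 \<or> b \<noteq> 0"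
    using that unfolding cd by linarith
  ultimately show ?case
    using less.hyps[of c d] unfolding cd by linarith
qed

lemma hor_conj_pair:
  obtains a b :: int where "hor \<phi> w = a + b * \<phi>" "hor phi' w = a + b * phi'"
  using hor_int_rep[of w] phi_square phi'_square by blast

lemma norm_ge_1:
  assumes "hor \<phi> w \<noteq> 0"
  shows "1 \<le> \<bar>hor \<phi> w * hor phi' w\<bar>"
proof -
  obtain a b :: int where ab: "hor \<phi> w = a + b * \<phi>" "hor phi' w = a + b * phi'"
    by (rule hor_conj_pair)
  have "hor \<phi> w * hor phi' w = a * a + a * b + b * b * (\<phi> - \<phi> * \<phi>)"
    unfolding ab by (simp add: algebra_simps)
  also have "\<dots> = of_int (a * a + a * b - b * b)"
    unfolding phi_square by simp
  finally have eq: "hor \<phi> w * hor phi' w = of_int (a * a + a * b - b * b)" .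
  have "a * a + a * b - b * b \<noteq> 0"
    using golden_norm_zero[of a b] assms ab by auto
  then have "1 \<le> \<bar>a * a + a * b - b * b\<bar>" by linarith
  then show ?thesis unfolding eq by linarith
qed

text \<open>Garsia's argument: a nonzero difference has norm at least 1 in absolute value, and its
  conjugate is below \<phi>^2.\<close>

lemma hor_separation:
  assumes u: "u \<in> words n" and w: "w \<in> words n" and ne: "hor \<phi> u \<noteq> hor \<phi> w"
  shows "1 / (\<phi> * \<phi>) < \<bar>hor \<phi> u - hor \<phi> w\<bar>"
proof -
  let ?d = "map2 (-) u w"
  have len: "length u = length w" using u w by (simp add: words_def)
  have d: "hor t ?d = hor t u - hor t w" for t by (rule hor_diff[OF len])
  have "1 \<le> \<bar>hor \<phi> ?d\<bar> * \<bar>hor phi' ?d\<bar>"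
    using norm_ge_1[of ?d] ne by (simp add: d abs_mult)
  also have "\<dots> < \<bar>hor \<phi> ?d\<bar> * (\<phi> * \<phi>)"
    using conj_bound[OF word_diff_digits[OF u w]] ne by (intro mult_strict_left_mono) (auto simp: d)
  finally show ?thesis unfolding d by (simp add: divide_less_eq)
qed

text \<open>Among the numbers a + b\<phi> of modulus below 1 whose conjugate is below \<phi>^2, the
  only nonzero ones are \<phi> - 1 and 1 - \<phi>, with conjugates -\<phi> and \<phi>. The
  candidates \<phi> - 2 and 2 - \<phi> have conjugates of modulus exactly \<phi>^2.\<close>

lemma conj_of_small:
  assumes "set w \<subseteq> {-1, 0, 1}" "\<bar>hor \<phi> w\<bar> < 1"
  shows "hor \<phi> w = 0 \<or> hor phi' w = \<phi> \<or> hor phi' w = - \<phi>"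
proof -
  obtain a b :: int where ab: "hor \<phi> w = a + b * \<phi>" "hor phi' w = a + b * phi'"
    by (rule hor_conj_pair)
  have c: "\<bar>a + b * phi'\<bar> < \<phi> + 1" and r: "\<bar>a + b * \<phi>\<bar> < 1"
    using conj_bound[OF assms(1)] assms(2) phi_square by (auto simp: ab)
  \<comment> \<open>Here \<open>2 * \<phi> - 1\<close> is sqrt 5, and \<phi> + 2 < 2 sqrt 5 leaves
    |b| < 2.\<close>
  have diff: "(a + b * \<phi>) - (a + b * phi') = b * (2 * \<phi> - 1)" by (simp add: algebra_simps)
  have "\<bar>real_of_int b * (2 * \<phi> - 1)\<bar> < \<phi> + 2"
    using c r unfolding diff[symmetric] by linarith
  then have "\<bar>real_of_int b\<bar> * (2 * \<phi> - 1) < 2 * (2 * \<phi> - 1)"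
    using phi_bounds by (simp add: abs_mult)
  then have "\<bar>real_of_int b\<bar> < 2" using mult_right_less_imp_less phi_bounds by fastforce
  then have "b = 0 \<or> b = 1 \<or> b = -1" by linarith
  then show ?thesis
  proof (elim disjE)
    assume b: "b = 0"
    with r have "a = 0" by simp
    with b ab show ?thesis by simp
  next
    assume b: "b = 1"
    with r phi_bounds have "real_of_int a < 0" "real_of_int a > -3" by auto
    then have "a = -1 \<or> a = -2" by linarith
    with b ab c show ?thesis by auto
  next
    assume b: "b = -1"
    with r phi_bounds have "real_of_int a > 0" "real_of_int a < 3" by auto
    then have "a = 1 \<or> a = 2" by linarith
    with b ab c show ?thesis by auto
  qed
qed

text \<open>Reading digits backwards divides the conjugate remainder by \<open>phi'\<close>, i.e. expands it by the
  factor \<open>-\<phi>\<close>; every remainder other than 0 leaves the disc of radius \<open>\<phi>\<^sup>2\<close> before the final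
  run \<open>1(00)\<^sup>a\<close> is exhausted.\<close>

lemma conj_step:
  assumes "phi' * r + c = d"
  shows "r = - (\<phi> * (d - c))"
proof -
  have "d - c = phi' * r" using assms by simp
  then have "\<phi> * (d - c) = \<phi> * phi' * r" by (simp only: mult.assoc)
  also have "\<phi> * phi' = -1" using phi_square by (simp add: algebra_simps)
  finally show ?thesis by simp
qed

text \<open>Before -\<phi> the remainder is \<phi>^2 (digit 0, too large) or 1 (digit -1); before 1
  it is -\<phi> (digit 0) or -2\<phi> (digit -1, too large). So two zeros of the block lead from
  -\<phi> back to -\<phi>, and the 1 in front of an even run would need a remainder of at least
  \<phi>^2.\<close>

lemma conj_not_minus_phi:
  assumes "set d \<subseteq> {-1, 0, 1}" "c \<in> {0, 1}" "length zs = 2 * a" "set zs \<subseteq> {-1, 0}"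
  shows "hor phi' (d @ [c] @ zs) \<noteq> - \<phi>"
  using assms(3,4)
proof (induction a arbitrary: zs)
  case 0
  show ?case
  proof
    assume "hor phi' (d @ [c] @ zs) = - \<phi>"
    with 0 have "phi' * hor phi' d + c = - \<phi>" by simp
    from conj_step[OF this] assms(2)
    have "hor phi' d = \<phi> * \<phi> \<or> hor phi' d = \<phi> * \<phi> + \<phi>" by (auto simp: algebra_simps)
    moreover have "\<bar>hor phi' d\<bar> < \<phi> * \<phi>" by (rule conj_bound[OF assms(1)])
    ultimately show False using phi_pos(1) by (elim disjE) linarith+
  qed
next
  case (Suc a)
  obtain zs0 c1 c2 where zs: "zs = (zs0 @ [c1]) @ [c2]"
  proof -
    have "zs \<noteq> []" "butlast zs \<noteq> []" using Suc.prems(1) by (auto simp flip: length_greater_0_conv)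
    then show ?thesis using that[of "butlast (butlast zs)" "last (butlast zs)" "last zs"]
      by (metis append_butlast_last_id)
  qed
  have len: "length zs0 = 2 * a" using Suc.prems zs by simp
  have dig: "set zs0 \<subseteq> {-1, 0}" "c1 \<in> {-1, 0}" "c2 \<in> {-1, 0}" using Suc.prems zs by auto
  let ?u = "d @ [c] @ zs0" and ?v = "d @ [c] @ zs0 @ [c1]"
  have bu: "\<bar>hor phi' ?u\<bar> < \<phi> * \<phi>"
    by (rule conj_bound) (use assms dig in auto)
  have bv: "\<bar>hor phi' ?v\<bar> < \<phi> * \<phi>"
    by (rule conj_bound) (use assms dig in auto)
  have v: "hor phi' ?v = phi' * hor phi' ?u + c1"
    using hor_snoc[of phi' ?u c1] by simp
  have w: "hor phi' (d @ [c] @ zs) = phi' * hor phi' ?v + c2"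
    using hor_snoc[of phi' ?v c2] by (simp add: zs)
  show ?case
  proof
    assume "hor phi' (d @ [c] @ zs) = - \<phi>"
    then have "hor phi' ?v = - (\<phi> * (- \<phi> - c2))" using conj_step w by metis
    with dig(3) have "hor phi' ?v = \<phi> * \<phi> \<or> hor phi' ?v = \<phi> * \<phi> - \<phi>" by (auto simp: algebra_simps)
    with bv phi_square have v1: "hor phi' ?v = 1" by auto
    have "phi' * hor phi' ?u + c1 = 1" using v v1 by simp
    then have "hor phi' ?u = - (\<phi> * (1 - real_of_int c1))" by (rule conj_step)
    with dig(2) have "hor phi' ?u = - \<phi> \<or> hor phi' ?u = - (2 * \<phi>)" by auto
    moreover have "hor phi' ?u \<noteq> - \<phi>" by (rule Suc.IH[OF len dig(1)])
    moreover have "\<phi> * \<phi> < 2 * \<phi>" using phi_bounds by simp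
    ultimately show False using bu by auto
  qed
qed

text \<open>Here a single zero of the block suffices: before \<phi> the remainder would be at most
  -\<phi>^2.\<close>

lemma conj_not_phi:
  assumes "set d \<subseteq> {-1, 0, 1}" "c \<in> {-1, 0}"
  shows "hor phi' (d @ [c]) \<noteq> \<phi>"
proof
  assume "hor phi' (d @ [c]) = \<phi>"
  then have "phi' * hor phi' d + c = \<phi>" by simp
  from conj_step[OF this] assms(2)
  have "hor phi' d = - (\<phi> * \<phi>) \<or> hor phi' d = - (\<phi> * \<phi> + \<phi>)" by (auto simp: algebra_simps)
  with conj_bound[OF assms(1)] phi_pos(1) show False by (elim disjE) linarith+
qed

text \<open>If a tail in \<open>[1/\<phi>, 1)\<close> after \<open>b\<close> and a tail in \<open>[0, \<phi>)\<close> after another word \<open>w\<close> of the same length represent the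
  same number, then \<open>hor \<phi> b\<close> and \<open>hor \<phi> w\<close> differ by less than 1. Hence for admissible \<open>b\<close> the words
  representing a point of the cylinder of \<open>b\<close> are counted independently of the tail.\<close>

definition admissible :: "int list \<Rightarrow> bool" where
  "admissible b \<longleftrightarrow> b \<in> words (length b) \<and>
     (\<forall>w\<in>words (length b). \<bar>hor \<phi> b - hor \<phi> w\<bar> < 1 \<longrightarrow> hor \<phi> w = hor \<phi> b)"

text \<open>The difference from a competing word has digits 0, 1 at the last 1 of the block and -1,
  0 at the zeros after it. The evenness of the run excludes the conjugate -\<phi>, and its last zero
  excludes \<phi>, so the small difference vanishes.\<close>

lemma admissible_block:
  assumes b: "b = u @ [1] @ replicate (2 * l) 0" and l: "l \<ge> 1" and dig: "set b \<subseteq> {0, 1}"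
  shows "admissible b"
  unfolding admissible_def
proof (intro conjI ballI impI)
  show bw: "b \<in> words (length b)" using dig by (simp add: words_def)
  fix w assume w: "w \<in> words (length b)" and small: "\<bar>hor \<phi> b - hor \<phi> w\<bar> < 1"
  have len: "length w = length b" using w by (simp add: words_def)
  let ?d = "map2 (-) b w"
  define n where "n = length u"
  define d c zs where "d = take n ?d" and "c = ?d ! n" and "zs = drop (Suc n) ?d"
  have lend: "length ?d = Suc (n + 2 * l)" using len by (simp add: b n_def)
  then have split: "?d = d @ [c] @ zs"
    using id_take_nth_drop[of n ?d] unfolding d_def c_def zs_def by simp
  have digs: "set ?d \<subseteq> {-1, 0, 1}" by (rule word_diff_digits[OF bw w])
  have d: "set d \<subseteq> {-1, 0, 1}" using digs set_take_subset[of n ?d] by (auto simp: d_def)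
  have wdig: "w ! i \<in> {0, 1}" if "i < length b" for i
  proof -
    have "w ! i \<in> set w" using that len by simp
    then show ?thesis using w unfolding words_def by blast
  qed
  have c: "c \<in> {0, 1}"
    using wdig[of n] len by (auto simp: c_def b n_def nth_append)
  have lz: "length zs = 2 * l" using lend by (simp add: zs_def)
  have zs: "set zs \<subseteq> {-1, 0}"
  proof
    fix x assume "x \<in> set zs"
    then obtain i where i: "i < 2 * l" "x = zs ! i" using lz by (auto simp: in_set_conv_nth)
    then have "x = b ! (Suc n + i) - w ! (Suc n + i)"
      using lend len by (simp add: zs_def b n_def)
    moreover have "b ! (Suc n + i) = 0" using i by (simp add: b n_def nth_append)
    ultimately show "x \<in> {-1, 0}" using wdig[of "Suc n + i"] i by (auto simp: b n_def)
  qed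
  have "hor phi' ?d \<noteq> - \<phi>"
    unfolding split by (rule conj_not_minus_phi[OF d c lz zs])
  moreover have "hor phi' ?d \<noteq> \<phi>"
  proof -
    have ne: "zs \<noteq> []" using lz l by auto
    have "?d = (d @ [c] @ butlast zs) @ [last zs]" unfolding split using ne by simp
    moreover have "set (d @ [c] @ butlast zs) \<subseteq> {-1, 0, 1}"
      using d c zs by (auto dest: in_set_butlastD)
    moreover have "last zs \<in> {-1, 0}" using zs ne last_in_set by blast
    ultimately show ?thesis using conj_not_phi by metis
  qed
  moreover have "\<bar>hor \<phi> ?d\<bar> < 1" using small hor_diff[of b w \<phi>] len by simp
  ultimately have "hor \<phi> ?d = 0" using conj_of_small[OF digs] by blast
  then show "hor \<phi> w = hor \<phi> b" using hor_diff[of b w \<phi>] len by simp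
qed

lemma hor_nonneg: "set w \<subseteq> {0, 1} \<Longrightarrow> 0 \<le> hor \<phi> w"
  by (induction w) (auto simp: hor_Cons)

lemma hor_less_1: "set w \<subseteq> {0, 1} \<Longrightarrow> hor \<phi> w < 1 \<Longrightarrow> hor \<phi> w = 0"
proof (induction w)
  case (Cons c w)
  have "c = 0"
  proof (rule ccontr)
    assume "c \<noteq> 0"
    with Cons.prems have "c = 1" by auto
    with Cons.prems have "\<phi> ^ length w + hor \<phi> w < 1" "0 \<le> hor \<phi> w"
      by (auto simp: hor_Cons intro: hor_nonneg)
    moreover have "1 \<le> \<phi> ^ length w" by (rule one_le_power) simp
    ultimately show False by linarith
  qed
  with Cons show ?case by (simp add: hor_Cons)
qed simp

lemma hor_replicate_0 [simp]: "hor t (replicate n 0) = 0"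
  by (induction n) (auto simp: hor_Cons)

text \<open>This serves the runs of leading zeros of points below 1/\<phi>. A 0-1 word of value
  below 1 can contain no 1.\<close>

lemma admissible_zeros: "admissible (replicate n 0)"
  unfolding admissible_def
proof (intro conjI ballI impI)
  fix w assume "w \<in> words (length (replicate n (0 :: int)))"
    and "\<bar>hor \<phi> (replicate n 0) - hor \<phi> w\<bar> < 1"
  then show "hor \<phi> w = hor \<phi> (replicate n 0)"
    using hor_less_1[of w] by (auto simp: words_def)
qed (simp add: words_def set_replicate_conv_if)

definition val :: "int list \<Rightarrow> real" where
  "val w = hor \<phi> w / \<phi> ^ length w"

lemma val_Nil [simp]: "val [] = 0"
  by (simp add: val_def)

lemma val_append: "val (u @ w) = val u + val w / \<phi> ^ length u"
  by (simp add: val_def hor_append power_add field_simps)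

lemma val_Cons: "val (c # w) = (of_int c + val w) / \<phi>"
  using val_append[of "[c]" w] by (simp add: val_def field_simps)

section \<open>The self-similar law of the random series\<close>

interpretation coin: sequence_space "measure_pmf (bernoulli_pmf (1/2))"
  by unfold_locales

lemma coin_prob_space: "prob_space coin_space"
  unfolding coin_space_def by (rule coin.prob_space_axioms)

lemma space_coin [simp]: "space coin_space = UNIV"
  by (simp add: coin_space_def space_PiM PiE_UNIV_domain)

lemma coin_component [measurable]: "(\<lambda>x. x k) \<in> measurable coin_space (count_space UNIV)"
proof -
  have "(\<lambda>x. x k) \<in> measurable coin_space (measure_pmf (bernoulli_pmf (1/2)))"
    unfolding coin_space_def by (rule measurable_component_singleton) simp
  then show ?thesis by (simp cong: measurable_cong_sets)
qed

text \<open>This is \<open>\<phi>\<close> times the random series defining the Erdos measure, so that its values fill \<open>[0, \<phi>]\<close>.\<close>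

definition coin_sum :: "(nat \<Rightarrow> bool) \<Rightarrow> real" where
  "coin_sum x = (\<Sum>k. of_bool (x k) / \<phi> ^ (k + 1))"

lemma coin_digit_measurable [measurable]: "(\<lambda>x. of_bool (x k) :: real) \<in> borel_measurable coin_space"
  using measurable_compose[OF coin_component, of of_bool borel k] by simp

lemma coin_sum_measurable [measurable]: "coin_sum \<in> borel_measurable coin_space"
  unfolding coin_sum_def[abs_def] by measurable

lemma golden_geometric: "(\<lambda>k. 1 / \<phi> ^ (k + 1)) sums \<phi>"
proof -
  have "norm (1 / \<phi>) < 1" using phi_bounds by simp
  from sums_mult[OF geometric_sums[OF this], of "1 / \<phi>"]
  have "(\<lambda>k. 1 / \<phi> * (1 / \<phi>) ^ k) sums (1 / \<phi> * (1 / (1 - 1 / \<phi>)))" .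
  moreover have "1 / \<phi> * (1 / (1 - 1 / \<phi>)) = \<phi>"
    using phi_square phi_bounds by (simp add: field_simps)
  ultimately show ?thesis by (simp add: power_divide)
qed

lemma coin_sum_summable: "summable (\<lambda>k. of_bool (x k) / \<phi> ^ (k + 1) :: real)"
  by (rule summable_comparison_test'[OF sums_summable[OF golden_geometric]]) (auto simp: of_bool_def)

lemma coin_sum_bounds: "0 \<le> coin_sum x" "coin_sum x \<le> \<phi>"
proof -
  show "0 \<le> coin_sum x"
    unfolding coin_sum_def by (rule suminf_nonneg[OF coin_sum_summable]) simp
  have "coin_sum x \<le> (\<Sum>k. 1 / \<phi> ^ (k + 1))"
    unfolding coin_sum_def
    by (rule suminf_le[OF _ coin_sum_summable sums_summable[OF golden_geometric]])
      (auto simp: of_bool_def)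
  then show "coin_sum x \<le> \<phi>" using sums_unique[OF golden_geometric] by simp
qed

lemma coin_sum_split: "coin_sum x = (\<Sum>k<n. of_bool (x k) / \<phi> ^ (k + 1)) + coin_sum (\<lambda>k. x (k + n)) / \<phi> ^ n"
proof -
  have "coin_sum x = (\<Sum>k<n. of_bool (x k) / \<phi> ^ (k + 1)) + (\<Sum>k. of_bool (x (k + n)) / \<phi> ^ (k + n + 1))"
    unfolding coin_sum_def using suminf_split_initial_segment[OF coin_sum_summable, of x n] by simp
  also have "(\<Sum>k. of_bool (x (k + n)) / \<phi> ^ (k + n + 1)) = (\<Sum>k. of_bool (x (k + n)) / \<phi> ^ (k + 1) / \<phi> ^ n)"
    by (simp add: power_add algebra_simps)
  also have "\<dots> = coin_sum (\<lambda>k. x (k + n)) / \<phi> ^ n"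
    unfolding coin_sum_def by (rule suminf_divide[OF coin_sum_summable])
  finally show ?thesis .
qed

lemma coin_sum_case_nat: "coin_sum (case_nat s x) = (of_bool s + coin_sum x) / \<phi>"
  using coin_sum_split[of "case_nat s x" 1] by (simp add: add_divide_distrib)

definition golden_law :: "real measure" where
  "golden_law = distr coin_space borel coin_sum"

lemma sets_golden_law [simp, measurable_cong]: "sets golden_law = sets borel"
  and space_golden_law [simp]: "space golden_law = UNIV"
  by (simp_all add: golden_law_def)

interpretation golden: prob_space golden_law
  unfolding golden_law_def using coin_prob_space coin_sum_measurable by (rule prob_space.prob_space_distr)

abbreviation m :: "real set \<Rightarrow> real" where
  "m \<equiv> measure golden_law"

text \<open>Conditioning on the first coin, which acts on the sum by y \<mapsto> y/\<phi> or y
  \<mapsto> (1 + y)/\<phi>.\<close>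

lemma self_similar:
  assumes E [measurable]: "E \<in> sets borel"
  shows "m E = (m {y. y / \<phi> \<in> E} + m {y. (1 + y) / \<phi> \<in> E}) / 2"
proof -
  let ?M = "measure_pmf (bernoulli_pmf (1/2))"
  let ?f = "\<lambda>(s :: bool, \<omega>). case_nat s \<omega> :: nat \<Rightarrow> bool"
  define A where "A = {x. coin_sum x \<in> E}"
  have A: "A \<in> sets coin_space"
    using measurable_sets[OF coin_sum_measurable E] by (simp add: A_def vimage_def)
  have f: "?f \<in> measurable (?M \<Otimes>\<^sub>M coin_space) coin_space"
    unfolding coin_space_def by measurable
  interpret C: prob_space coin_space by (rule coin_prob_space)
  have emeasure_m: "emeasure golden_law F = emeasure coin_space {x. coin_sum x \<in> F}"
    if "F \<in> sets borel" for F
    unfolding golden_law_def using that by (subst emeasure_distr) (auto simp: vimage_def)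
  have "emeasure coin_space A = emeasure (distr (?M \<Otimes>\<^sub>M coin_space) coin_space ?f) A"
    using coin.PiM_iter by (simp add: coin_space_def)
  also have "\<dots> = emeasure (?M \<Otimes>\<^sub>M coin_space) (?f -` A \<inter> space (?M \<Otimes>\<^sub>M coin_space))"
    by (rule emeasure_distr[OF f A])
  also have "\<dots> = (\<integral>\<^sup>+ s. emeasure coin_space (Pair s -` (?f -` A \<inter> space (?M \<Otimes>\<^sub>M coin_space))) \<partial>?M)"
    by (rule C.emeasure_pair_measure_alt) (rule measurable_sets[OF f A])
  also have "\<dots> = (\<integral>\<^sup>+ s. emeasure coin_space {x. case_nat s x \<in> A} \<partial>?M)"
    by (intro nn_integral_cong arg_cong2[where f = emeasure]) (auto simp: space_pair_measure)
  also have "\<dots> = emeasure coin_space {x. case_nat True x \<in> A} * ennreal (1/2) +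
      emeasure coin_space {x. case_nat False x \<in> A} * ennreal (1/2)"
    by (subst nn_integral_bernoulli_pmf) auto
  also have "{x. case_nat True x \<in> A} = {x. coin_sum x \<in> {y. (1 + y) / \<phi> \<in> E}}"
    by (simp add: A_def coin_sum_case_nat)
  also have "{x. case_nat False x \<in> A} = {x. coin_sum x \<in> {y. y / \<phi> \<in> E}}"
    by (simp add: A_def coin_sum_case_nat)
  also have "emeasure coin_space {x. coin_sum x \<in> {y. (1 + y) / \<phi> \<in> E}} = emeasure golden_law {y. (1 + y) / \<phi> \<in> E}"
    by (rule emeasure_m[symmetric]) measurable
  also have "emeasure coin_space {x. coin_sum x \<in> {y. y / \<phi> \<in> E}} = emeasure golden_law {y. y / \<phi> \<in> E}"
    by (rule emeasure_m[symmetric]) measurable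
  finally have "emeasure golden_law E = emeasure golden_law {y. (1 + y) / \<phi> \<in> E} * ennreal (1/2) +
      emeasure golden_law {y. y / \<phi> \<in> E} * ennreal (1/2)"
    unfolding A_def emeasure_m[OF E, symmetric] .
  moreover have "ennreal a * ennreal (1/2) + ennreal b * ennreal (1/2) = ennreal ((a + b) / 2)"
    if "0 \<le> a" "0 \<le> b" for a b :: real
  proof -
    have "ennreal (a * (1/2) + b * (1/2)) = ennreal a * ennreal (1/2) + ennreal b * ennreal (1/2)"
      using that by (subst ennreal_plus) (simp_all only: ennreal_mult mult_nonneg_nonneg zero_le_divide_1_iff zero_le_numeral)
    then show ?thesis by (simp only: add_divide_distrib mult_1_right times_divide_eq_right)
  qed
  ultimately have "ennreal (m E) = ennreal ((m {y. (1 + y) / \<phi> \<in> E} + m {y. y / \<phi> \<in> E}) / 2)"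
    unfolding golden.emeasure_eq_measure by simp
  then show ?thesis by (simp add: add.commute)
qed

lemma self_similar_words:
  assumes E [measurable]: "E \<in> sets borel"
  shows "m E = (\<Sum>w\<in>words n. m {y. val w + y / \<phi> ^ n \<in> E}) / 2 ^ n"
  using assms
proof (induction n arbitrary: E)
  case (Suc n)
  note [measurable] = Suc.prems
  have 0: "m {y. y / \<phi> \<in> E} = (\<Sum>w\<in>words n. m {y. val w + y / \<phi> ^ n \<in> {y. y / \<phi> \<in> E}}) / 2 ^ n"
    by (rule Suc.IH) measurable
  have 1: "m {y. (1 + y) / \<phi> \<in> E} = (\<Sum>w\<in>words n. m {y. val w + y / \<phi> ^ n \<in> {y. (1 + y) / \<phi> \<in> E}}) / 2 ^ n"
    by (rule Suc.IH) measurable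
  let ?g = "\<lambda>w. m {y. val w + y / \<phi> ^ Suc n \<in> E}"
  have "(\<Sum>w\<in>words (Suc n). ?g w) = (\<Sum>(c, w)\<in>{0, 1} \<times> words n. ?g (c # w))"
    unfolding words_Suc by (subst sum.reindex) (auto simp: inj_on_def intro!: sum.cong)
  also have "\<dots> = (\<Sum>w\<in>words n. ?g (0 # w)) + (\<Sum>w\<in>words n. ?g (1 # w))"
    unfolding sum.cartesian_product[symmetric] by simp
  finally have "(\<Sum>w\<in>words (Suc n). ?g w) / 2 ^ Suc n =
      ((\<Sum>w\<in>words n. ?g (0 # w)) / 2 ^ n + (\<Sum>w\<in>words n. ?g (1 # w)) / 2 ^ n) / 2"
    by (simp add: field_simps)
  moreover have "?g (0 # w) = m {y. val w + y / \<phi> ^ n \<in> {y. y / \<phi> \<in> E}}" for w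
    by (simp add: val_Cons add_divide_distrib mult.commute)
  moreover have "?g (1 # w) = m {y. val w + y / \<phi> ^ n \<in> {y. (1 + y) / \<phi> \<in> E}}" for w
    by (simp add: val_Cons add_divide_distrib mult.commute add.assoc)
  ultimately show ?case
    using self_similar[OF Suc.prems] 0 1 by simp
qed simp

lemma m_outside: "E \<in> sets borel \<Longrightarrow> E \<inter> {0..\<phi>} = {} \<Longrightarrow> m E = 0"
proof -
  assume E: "E \<in> sets borel" and d: "E \<inter> {0..\<phi>} = {}"
  have "coin_sum -` E = {}" using d coin_sum_bounds by fastforce
  then show ?thesis
    unfolding golden_law_def using E by (simp add: measure_distr)
qed

lemma m_mono: "A \<subseteq> B \<Longrightarrow> B \<in> sets borel \<Longrightarrow> m A \<le> m B"
  by (rule golden.finite_measure_mono) auto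

lemma m_Un: "A \<in> sets borel \<Longrightarrow> B \<in> sets borel \<Longrightarrow> A \<inter> B = {} \<Longrightarrow> m (A \<union> B) = m A + m B"
  by (rule golden.finite_measure_Union) auto

text \<open>The point \<phi> is fixed by y \<mapsto> (1 + y)/\<phi>, while its preimage under y
  \<mapsto> y/\<phi> lies outside the support; so the atom equals half of itself.\<close>

lemma m_phi: "m {\<phi>} = 0"
proof -
  have "m {y. y / \<phi> \<in> {\<phi>}} = 0"
  proof (rule m_outside)
    show "{y. y / \<phi> \<in> {\<phi>}} \<inter> {0..\<phi>} = {}" using phi_square by (auto simp: field_simps)
  qed measurable
  moreover have "{y. (1 + y) / \<phi> \<in> {\<phi>}} = {\<phi>}"
    using phi_square by (auto simp: field_simps)
  ultimately show ?thesis using self_similar[of "{\<phi>}"] by simp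
qed

lemma m_zero: "m {0} = 0"
proof -
  have "m {y. (1 + y) / \<phi> \<in> {0}} = 0"
    by (rule m_outside) auto
  moreover have "{y. y / \<phi> \<in> {0}} = {0}" by auto
  ultimately show ?thesis using self_similar[of "{0}"] by simp
qed

lemma m_null_outside: "E \<in> sets borel \<Longrightarrow> E \<inter> {0..<\<phi>} = {} \<Longrightarrow> m E = 0"
proof -
  assume E: "E \<in> sets borel" and d: "E \<inter> {0..<\<phi>} = {}"
  have "m E \<le> m ((E - {\<phi>}) \<union> {\<phi>})" using E by (intro m_mono) auto
  also have "\<dots> \<le> m (E - {\<phi>}) + m {\<phi>}" using E by (intro measure_Un_le) auto
  also have "m (E - {\<phi>}) = 0" using E d by (intro m_outside) fastforce+
  finally show ?thesis using m_phi measure_nonneg[of golden_law E] by simp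
qed

section \<open>Masses of the inverse branches of admissible words\<close>

abbreviation J :: "real set" where
  "J \<equiv> {1 / \<phi> ..< 1}"

text \<open>The image of \<open>E\<close> under y \<mapsto> val b + y/\<phi>^n with n the length of
  b, written as a preimage so that it is evidently measurable.\<close>

definition branch :: "int list \<Rightarrow> real set \<Rightarrow> real set" where
  "branch b E = {x. (x - val b) * \<phi> ^ length b \<in> E}"

lemma branch_sets [measurable]: "E \<in> sets borel \<Longrightarrow> branch b E \<in> sets borel"
proof -
  assume E: "E \<in> sets borel"
  define k where "k = \<phi> ^ length b"
  have "(\<lambda>x. (x - val b) * k) -` E \<inter> space borel \<in> sets borel"
    by (rule measurable_sets[OF _ E]) simp
  then show ?thesis by (simp add: branch_def k_def vimage_def)
qed

text \<open>If \<open>w\<close> and \<open>b\<close> have different values, a tail y in [0, \<phi>)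
  can reach a point of \<open>E\<close> only when the values differ by less than 1, because E lies
  in [\<phi> - 1, 1). Admissibility forbids this.\<close>

lemma m_branch_word:
  assumes E [measurable]: "E \<in> sets borel" and EJ: "E \<subseteq> J"
    and b: "admissible b" and w: "w \<in> words (length b)"
  shows "m {y. val w + y / \<phi> ^ length b \<in> branch b E} = (if hor \<phi> w = hor \<phi> b then m E else 0)"
proof -
  have lw: "length w = length b" using w by (simp add: words_def)
  have eq: "{y. val w + y / \<phi> ^ length b \<in> branch b E} = {y. y + (hor \<phi> w - hor \<phi> b) \<in> E}"
  proof -
    have "(val w + y / \<phi> ^ length b - val b) * \<phi> ^ length b = y + (hor \<phi> w - hor \<phi> b)" for y
      by (simp add: val_def lw flip: add_divide_distrib diff_divide_distrib)
    then show ?thesis by (simp add: branch_def)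
  qed
  show ?thesis
  proof (cases "hor \<phi> w = hor \<phi> b")
    case True
    then show ?thesis unfolding eq by simp
  next
    case False
    have "m {y. y + (hor \<phi> w - hor \<phi> b) \<in> E} = 0"
    proof (rule m_null_outside)
      show "{y. y + (hor \<phi> w - hor \<phi> b) \<in> E} \<inter> {0..<\<phi>} = {}"
      proof safe
        fix y assume y: "y + (hor \<phi> w - hor \<phi> b) \<in> E" "y \<in> {0..<\<phi>}"
        then have "y + (hor \<phi> w - hor \<phi> b) \<in> {\<phi> - 1 ..< 1}" using EJ inverse_phi by auto
        with y(2) have "\<bar>hor \<phi> b - hor \<phi> w\<bar> < 1" by auto
        with b w False show "y \<in> {}" unfolding admissible_def by blast
      qed
    qed measurable
    with False show ?thesis unfolding eq by simp
  qed
qed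

lemma m_branch:
  assumes E: "E \<in> sets borel" and EJ: "E \<subseteq> J" and b: "admissible b"
  shows "m (branch b E) = card {w \<in> words (length b). hor \<phi> w = hor \<phi> b} / 2 ^ length b * m E"
proof -
  have "m (branch b E) = (\<Sum>w\<in>words (length b). m {y. val w + y / \<phi> ^ length b \<in> branch b E}) / 2 ^ length b"
    by (rule self_similar_words) (rule branch_sets[OF E])
  also have "(\<Sum>w\<in>words (length b). m {y. val w + y / \<phi> ^ length b \<in> branch b E}) =
      (\<Sum>w\<in>words (length b). if hor \<phi> w = hor \<phi> b then m E else 0)"
    by (intro sum.cong refl m_branch_word E EJ b)
  also have "\<dots> = card {w \<in> words (length b). hor \<phi> w = hor \<phi> b} * m E"
    by (simp flip: sum.inter_filter)
  finally show ?thesis by simp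
qed

lemma m_branch_weight_ge:
  assumes "admissible b"
  shows "1 / 2 ^ length b \<le> card {w \<in> words (length b). hor \<phi> w = hor \<phi> b} / (2 ^ length b :: real)"
proof -
  have "b \<in> {w \<in> words (length b). hor \<phi> w = hor \<phi> b}" using assms by (simp add: admissible_def)
  then have "card {w \<in> words (length b). hor \<phi> w = hor \<phi> b} \<noteq> 0"
    by (subst card_0_eq) auto
  then have "1 \<le> card {w \<in> words (length b). hor \<phi> w = hor \<phi> b}" by linarith
  then show ?thesis by (intro divide_right_mono) auto
qed

section \<open>Comparison of the Erdos measure with \<open>golden_law\<close>\<close>

lemma erdos_eq: "erdos_measure = distr golden_law borel (\<lambda>y. y / \<phi>)"
proof -
  have "(\<Sum>k. of_bool (x k) / \<phi> ^ (k + 2)) = coin_sum x / \<phi>" for x :: "nat \<Rightarrow> bool"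
  proof -
    have "(\<Sum>k. of_bool (x k) / \<phi> ^ (k + 2)) = (\<Sum>k. of_bool (x k) / \<phi> ^ (k + 1) / \<phi>)"
      by (simp add: mult.commute)
    also have "\<dots> = coin_sum x / \<phi>"
      unfolding coin_sum_def by (rule suminf_divide[OF coin_sum_summable])
    finally show ?thesis .
  qed
  then show ?thesis
    unfolding erdos_measure_def golden_law_def by (simp add: distr_distr comp_def)
qed

lemma sets_erdos [simp, measurable_cong]: "sets erdos_measure = sets borel"
  and space_erdos [simp]: "space erdos_measure = UNIV"
  by (simp_all add: erdos_measure_def)

interpretation erdos: prob_space erdos_measure
  unfolding erdos_eq by (rule golden.prob_space_distr) simp

abbreviation \<mu> :: "real set \<Rightarrow> real" where
  "\<mu> \<equiv> measure erdos_measure"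

lemma mu_eq: "E \<in> sets borel \<Longrightarrow> \<mu> E = m {y. y / \<phi> \<in> E}"
  unfolding erdos_eq by (subst measure_distr) (auto simp: vimage_def)

text \<open>By self-similarity \<open>golden_law\<close> is the average of the Erdos measure and
  another measure. Null sets of \<open>golden_law\<close> are therefore null for the Erdos
  measure.\<close>

lemma mu_le: "E \<in> sets borel \<Longrightarrow> \<mu> E \<le> 2 * m E"
proof -
  assume E: "E \<in> sets borel"
  show ?thesis
    unfolding self_similar[OF E] mu_eq[OF E] by simp
qed

text \<open>A point with the Erdos law is given by a random expansion whose first digit is 0. Only
  the representations of \<open>b\<close> that begin with 0 count, and the remaining length - 1
  digits are random.\<close>

lemma mu_branch:
  assumes E [measurable]: "E \<in> sets borel" and EJ: "E \<subseteq> J" and b: "admissible b" and ne: "b \<noteq> []"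
  shows "\<mu> (branch b E) =
    card {w \<in> words (length b - 1). hor \<phi> w = hor \<phi> b} / 2 ^ (length b - 1) * m E"
proof -
  define n where "n = length b - 1"
  have n: "length b = Suc n" using ne by (cases b) (auto simp: n_def)
  have "\<mu> (branch b E) = m {y. y / \<phi> \<in> branch b E}" by (rule mu_eq) measurable
  also have "\<dots> = (\<Sum>w\<in>words n. m {y. val w + y / \<phi> ^ n \<in> {y. y / \<phi> \<in> branch b E}}) / 2 ^ n"
    by (rule self_similar_words) measurable
  also have "(\<Sum>w\<in>words n. m {y. val w + y / \<phi> ^ n \<in> {y. y / \<phi> \<in> branch b E}}) =
      (\<Sum>w\<in>words n. if hor \<phi> w = hor \<phi> b then m E else 0)"
  proof (intro sum.cong refl)
    fix w assume "w \<in> words n"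
    then have w: "0 # w \<in> words (length b)" by (auto simp: words_def n)
    have "{y. val w + y / \<phi> ^ n \<in> {y. y / \<phi> \<in> branch b E}} =
        {y. val (0 # w) + y / \<phi> ^ length b \<in> branch b E}"
      by (simp add: val_Cons n add_divide_distrib mult.commute)
    then show "m {y. val w + y / \<phi> ^ n \<in> {y. y / \<phi> \<in> branch b E}} = (if hor \<phi> w = hor \<phi> b then m E else 0)"
      using m_branch_word[OF E EJ b w] by (simp add: hor_Cons)
  qed
  also have "\<dots> = card {w \<in> words n. hor \<phi> w = hor \<phi> b} * m E"
    by (simp flip: sum.inter_filter)
  finally show ?thesis by (simp add: n_def)
qed

text \<open>Self-similarity gives a = (a + j)/2 and c = (j + c)/2 for the three masses a, j, c, and
  they add up to 1.\<close>

lemma m_thirds: "m {0..<1 / \<phi>} = 1 / 3" "m J = 1 / 3" "m {1..<\<phi>} = 1 / 3"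
proof -
  have i1: "1 / \<phi> < 1" by simp
  have "m {0..<1 / \<phi>} = (m {0..<1} + 0) / 2"
  proof -
    have "{y. y / \<phi> \<in> {0..<1 / \<phi>}} = {0..<1}"
      by (auto simp: divide_less_cancel zero_le_divide_iff)
    moreover have "m {y. (1 + y) / \<phi> \<in> {0..<1 / \<phi>}} = 0"
      by (rule m_outside) (auto simp: field_simps mult_less_0_iff)
    ultimately show ?thesis using self_similar[of "{0..<1 / \<phi>}"] by simp
  qed
  moreover have "m {1..<\<phi>} = (0 + m {1 / \<phi>..<\<phi>}) / 2"
  proof -
    have "{y. (1 + y) / \<phi> \<in> {1..<\<phi>}} = {1 / \<phi>..<\<phi>}"
      using phi_square by (auto simp: field_simps inverse_phi)
    moreover have "m {y. y / \<phi> \<in> {1..<\<phi>}} = 0"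
      by (rule m_null_outside) (auto simp: field_simps mult_less_0_iff)
    ultimately show ?thesis using self_similar[of "{1..<\<phi>}"] by simp
  qed
  moreover have "m {0..<1} = m {0..<1 / \<phi>} + m J"
    using i1 m_Un[of "{0..<1 / \<phi>}" J] by (simp add: ivl_disj_un)
  moreover have "m {1 / \<phi>..<\<phi>} = m J + m {1..<\<phi>}"
    using i1 m_Un[of J "{1..<\<phi>}"] by (simp add: ivl_disj_un)
  moreover have "m {0..<1} + m {1..<\<phi>} = 1"
  proof -
    have "m ({0..<\<phi>} \<union> - {0..<\<phi>}) = m {0..<\<phi>} + m (- {0..<\<phi>})"
      by (rule m_Un) auto
    moreover have "m (- {0..<\<phi>}) = 0" by (rule m_null_outside) auto
    moreover have "m {0..<\<phi>} = m {0..<1} + m {1..<\<phi>}"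
      using m_Un[of "{0..<1}" "{1..<\<phi>}"] by (simp add: ivl_disj_un)
    ultimately show ?thesis using golden.prob_space by simp
  qed
  ultimately show "m {0..<1 / \<phi>} = 1 / 3" "m J = 1 / 3" "m {1..<\<phi>} = 1 / 3" by simp_all
qed

section \<open>Digits, blocks and the goldenshift\<close>

abbreviation T :: "real \<Rightarrow> real" where
  "T \<equiv> golden_map"

lemma golden_map_range: "0 \<le> T x" "T x < 1"
  by (auto simp: golden_map_def frac_lt_1)

lemma funpow_range: "x \<in> {0..<1} \<Longrightarrow> (T ^^ k) x \<in> {0..<1}"
  using golden_map_range by (cases k) auto

lemma digit_0_1:
  assumes "x \<in> {0..<1}"
  shows "digit x k \<in> {0, 1}"
proof -
  have "0 \<le> \<phi> * (T ^^ k) x" "\<phi> * (T ^^ k) x < 2"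
    using funpow_range[OF assms, of k] phi_bounds mult_strict_mono'[of \<phi> 2 "(T ^^ k) x" 1] by auto
  then have "0 \<le> digit x k" "digit x k < 2"
    unfolding digit_def by (auto simp: floor_less_iff)
  then show ?thesis by auto
qed

lemma digit_step: "\<phi> * (T ^^ k) x = digit x k + (T ^^ Suc k) x"
  by (simp add: digit_def golden_map_def frac_def)

lemma digit_funpow: "digit ((T ^^ n) x) k = digit x (n + k)"
  by (simp add: digit_def funpow_add add.commute)

lemma digit_Suc: "digit x (Suc k) = digit (T x) k"
  using digit_funpow[of 1 x k] by simp

definition digits :: "real \<Rightarrow> nat \<Rightarrow> int list" where
  "digits x n = map (digit x) [0..<n]"

lemma length_digits [simp]: "length (digits x n) = n"
  by (simp add: digits_def)

lemma nth_digits [simp]: "i < n \<Longrightarrow> digits x n ! i = digit x i"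
  by (simp add: digits_def)

lemma digits_Suc: "digits x (Suc n) = digit x 0 # digits (T x) n"
  by (rule nth_equalityI) (auto simp: nth_Cons digit_Suc split: nat.split)

lemma digits_in_words: "x \<in> {0..<1} \<Longrightarrow> digits x n \<in> words n"
  using digit_0_1 by (fastforce simp: words_def digits_def)

lemma digit_expansion: "x = val (digits x n) + (T ^^ n) x / \<phi> ^ n"
proof (induction n arbitrary: x)
  case 0
  show ?case by (simp add: digits_def)
next
  case (Suc n)
  have "x = (digit x 0 + T x) / \<phi>" using digit_step[of 0 x] by (simp add: field_simps)
  also have "T x = val (digits (T x) n) + (T ^^ Suc n) x / \<phi> ^ n"
    using Suc[of "T x"] by (simp add: funpow_swap1)
  finally show ?case
    by (simp add: digits_Suc val_Cons add_divide_distrib mult.commute add.assoc del: funpow.simps)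
qed

lemma digit_0_eq_1_iff: "x \<in> {0..<1} \<Longrightarrow> digit x 0 = 1 \<longleftrightarrow> 1 / \<phi> \<le> x"
proof -
  assume x: "x \<in> {0..<1}"
  then have "digit x 0 = 1 \<longleftrightarrow> 1 \<le> digit x 0" using digit_0_1[OF x, of 0] by auto
  also have "\<dots> \<longleftrightarrow> 1 / \<phi> \<le> x" by (simp add: digit_def le_floor_iff field_simps)
  finally show ?thesis .
qed

lemma J_iff: "x \<in> J \<longleftrightarrow> x \<in> {0..<1} \<and> digit x 0 = 1"
proof -
  have "x \<in> J \<longleftrightarrow> x \<in> {0..<1} \<and> 1 / \<phi> \<le> x"
    using order_trans[of 0 "1 / \<phi>" x] by auto
  then show ?thesis using digit_0_eq_1_iff[of x] by blast
qed

lemma digit_after_1: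
  assumes "x \<in> {0..<1}" "digit x k = 1"
  shows "digit x (Suc k) = 0"
proof -
  have "(T ^^ Suc k) x = \<phi> * (T ^^ k) x - 1" using digit_step[of k x] assms(2) by simp
  also have "\<dots> < \<phi> - 1" using funpow_range[OF assms(1), of k] by simp
  finally have "(T ^^ Suc k) x < 1 / \<phi>" by (simp only: inverse_phi)
  then have "digit ((T ^^ Suc k) x) 0 \<noteq> 1"
    using digit_0_eq_1_iff[OF funpow_range[OF assms(1), of "Suc k"]] by simp
  then have "digit x (Suc k) \<noteq> 1" unfolding digit_funpow by simp
  then show ?thesis using digit_0_1[OF assms(1), of "Suc k"] by auto
qed

lemma digit_prepend:
  assumes y: "y \<in> {0..<1}"
  shows "T ((of_int c + y) / \<phi>) = y" "digit ((of_int c + y) / \<phi>) 0 = c"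
    "digit ((of_int c + y) / \<phi>) (Suc k) = digit y k"
proof -
  have "frac (of_int c + y) = y" "\<lfloor>of_int c + y\<rfloor> = c"
    using y by (auto simp: frac_eq frac_def floor_eq_iff)
  then show 1: "T ((of_int c + y) / \<phi>) = y" and "digit ((of_int c + y) / \<phi>) 0 = c"
    by (simp_all add: golden_map_def digit_def)
  show "digit ((of_int c + y) / \<phi>) (Suc k) = digit y k" by (simp add: digit_Suc 1)
qed

inductive full :: "int list \<Rightarrow> bool" where
  full_Nil: "full []"
| full_0: "full w \<Longrightarrow> full (0 # w)"
| full_10: "full w \<Longrightarrow> full (1 # 0 # w)"

text \<open>The cylinder of such a word is a full copy of \<open>[0,1)\<close>, see \<open>full_cylinder\<close>.\<close>

lemma full_digits:
  assumes "x \<in> {0..<1}" "n = 0 \<or> digit x (n - 1) = 0"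
  shows "full (digits x n)"
  using assms
proof (induction n arbitrary: x rule: less_induct)
  case (less n)
  show ?case
  proof (cases n)
    case 0
    then show ?thesis by (simp add: digits_def full_Nil)
  next
    case (Suc k)
    have Tx: "T x \<in> {0..<1}" using golden_map_range by simp
    show ?thesis
    proof (cases "digit x 0 = 0")
      case True
      have "k = 0 \<or> digit (T x) (k - 1) = 0"
        using less.prems(2) Suc by (cases k) (auto simp: digit_Suc)
      with less.IH[OF _ Tx] Suc True show ?thesis by (simp add: digits_Suc full_0)
    next
      case False
      then have d0: "digit x 0 = 1" using digit_0_1[OF less.prems(1), of 0] by simp
      then have d1: "digit x 1 = 0" using digit_after_1[OF less.prems(1)] by simp
      have "k \<noteq> 0" using less.prems(2) Suc d0 by (cases k) auto
      then obtain j where j: "k = Suc j" by (cases k) auto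
      have TTx: "T (T x) \<in> {0..<1}" using golden_map_range by simp
      have "j = 0 \<or> digit (T (T x)) (j - 1) = 0"
        using less.prems(2) Suc j by (cases j) (auto simp: digit_Suc)
      with less.IH[OF _ TTx, of j] Suc j d0 d1 show ?thesis
        by (simp add: digits_Suc full_10 digit_Suc)
    qed
  qed
qed

text \<open>Prefixing 0 maps [0,1) onto [0, 1/\<phi>), and prefixing 10 maps it onto [1/\<phi>, 1).
  Both stay inside [0,1), so the greedy digits of the result are the prefixed ones.\<close>

lemma full_cylinder:
  assumes "full b" "y \<in> {0..<1}"
  shows "val b + y / \<phi> ^ length b \<in> {0..<1} \<and> digits (val b + y / \<phi> ^ length b) (length b) = b \<and>
    (T ^^ length b) (val b + y / \<phi> ^ length b) = y"
  using assms(1)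
proof (induction b rule: full.induct)
  case full_Nil
  with assms show ?case by (simp add: digits_def)
next
  case (full_0 w)
  let ?z = "val w + y / \<phi> ^ length w"
  have z: "?z \<in> {0..<1}" using full_0 by blast
  have eq: "val (0 # w) + y / \<phi> ^ length (0 # w) = (of_int 0 + ?z) / \<phi>"
    by (simp add: val_Cons add_divide_distrib mult.commute)
  have "(0 + ?z) / \<phi> \<in> {0..<1}" using z by (simp add: divide_less_eq less_trans[OF _ phi_pos(4)])
  with full_0 digit_prepend[OF z, of 0] show ?case
    unfolding eq by (simp add: digits_Suc funpow_swap1)
next
  case (full_10 w)
  let ?z = "val w + y / \<phi> ^ length w"
  have z: "?z \<in> {0..<1}" using full_10 by blast
  let ?z1 = "(of_int 0 + ?z) / \<phi>"
  have z1: "?z1 \<in> {0..<1}" using z by (simp add: divide_less_eq less_trans[OF _ phi_pos(4)])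
  have eq: "val (1 # 0 # w) + y / \<phi> ^ length (1 # 0 # w) = (of_int 1 + ?z1) / \<phi>"
    by (simp add: val_Cons add_divide_distrib mult_ac)
  have "?z1 < 1 / \<phi>" using z by (simp add: divide_strict_right_mono)
  then have "?z1 < \<phi> - 1" by (simp only: inverse_phi)
  moreover have "(1 + u) / \<phi> \<in> {0..<1}" if "0 \<le> u" "u < \<phi> - 1" for u
    using that by (simp add: divide_less_eq)
  ultimately have "(of_int 1 + ?z1) / \<phi> \<in> {0..<1}" using z1 by simp
  with full_10 digit_prepend[OF z1, of 1] digit_prepend[OF z, of 0] show ?case
    unfolding eq by (simp add: digits_Suc funpow_swap1)
qed

text \<open>The first alternative lets a run of leading zeros count as the first block of a point below \<open>1/\<phi>\<close>;
  \<open>blen x = 0\<close> means that the first block never ends.\<close>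

definition block_end :: "real \<Rightarrow> nat \<Rightarrow> bool" where
  "block_end x t \<longleftrightarrow> t \<ge> 1 \<and> digit x t = 1 \<and>
     ((\<forall>i<t. digit x i = 0) \<or> (\<exists>i l. l \<ge> 1 \<and> even_gap_at x i l \<and> t = i + 2 * l + 1))"

definition blen :: "real \<Rightarrow> nat" where
  "blen x = (if \<exists>t. block_end x t then LEAST t. block_end x t else 0)"

definition blk :: "real \<Rightarrow> int list" where
  "blk x = digits x (blen x)"

definition sh :: "real \<Rightarrow> real" where
  "sh x = (T ^^ blen x) x"

lemma length_blk [simp]: "length (blk x) = blen x"
  by (simp add: blk_def)

lemma block_end_pos: "block_end x t \<Longrightarrow> 0 < t"
  by (simp add: block_end_def)

lemma blen_block_end: "0 < blen x \<Longrightarrow> block_end x (blen x)"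
  unfolding blen_def by (auto split: if_splits intro: LeastI)

lemma blen_le: "block_end x t \<Longrightarrow> blen x \<le> t"
  unfolding blen_def by (auto intro: Least_le)

lemma blen_pos_iff: "0 < blen x \<longleftrightarrow> (\<exists>t. block_end x t)"
proof
  assume "\<exists>t. block_end x t"
  then have "block_end x (LEAST t. block_end x t)" by (rule LeastI_ex)
  then show "0 < blen x" using \<open>\<exists>t. block_end x t\<close> by (simp add: blen_def block_end_pos)
qed (use blen_block_end in blast)

lemma blen_greater_iff: "blen x = 0 \<or> n < blen x \<longleftrightarrow> (\<forall>t. block_end x t \<longrightarrow> n < t)"
  using blen_block_end blen_le blen_pos_iff by (metis neq0_conv order_less_le_trans)

text \<open>The closing 1 stands at index t itself, so the digits up to and including t
  decide.\<close>

lemma block_end_cong: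
  assumes "\<And>i. i \<le> t \<Longrightarrow> digit x i = digit y i"
  shows "block_end x t \<longleftrightarrow> block_end y t"
proof -
  have "even_gap_at x i l \<longleftrightarrow> even_gap_at y i l" if "t = i + 2 * l + 1" for i l
    using assms that by (auto simp: even_gap_at_def)
  with assms show ?thesis unfolding block_end_def by (metis less_imp_le order_refl)
qed

text \<open>In both cases the word ends with a zero, which makes it full. Admissibility comes from
  the leading zeros or from the closing even run.\<close>

lemma block_end_structure:
  assumes x: "x \<in> {0..<1}" and r: "block_end x t"
  shows "full (digits x t)" "admissible (digits x t)"
proof -
  from r consider (zero) "\<forall>i<t. digit x i = 0"
    | (gap) i l where "l \<ge> 1" "even_gap_at x i l" "t = i + 2 * l + 1"
    unfolding block_end_def by blast
  then have "digit x (t - 1) = 0 \<and> admissible (digits x t)"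
  proof cases
    case zero
    then have "digits x t = replicate t 0" by (intro nth_equalityI) auto
    with zero block_end_pos[OF r] show ?thesis by (simp add: admissible_zeros)
  next
    case gap
    have eq: "digits x t = digits x i @ [1] @ replicate (2 * l) 0"
    proof (rule nth_equalityI)
      fix j assume "j < length (digits x t)"
      then have j: "j < i + 2 * l + 1" using gap by simp
      consider "j < i" | "j = i" | k where "j = i + k" "k \<in> {1..2 * l}"
      proof -
        assume a: "j < i \<Longrightarrow> thesis" "j = i \<Longrightarrow> thesis" "\<And>k. j = i + k \<Longrightarrow> k \<in> {1..2 * l} \<Longrightarrow> thesis"
        show thesis
        proof (cases "j \<le> i")
          case True
          with a(1,2) show thesis by linarith
        next
          case False
          with j show thesis by (intro a(3)[of "j - i"]) auto
        qed
      qed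
      then show "digits x t ! j = (digits x i @ [1] @ replicate (2 * l) 0) ! j"
        using gap by cases (auto simp: nth_append nth_Cons' even_gap_at_def)
    qed (use gap in simp)
    moreover have "set (digits x t) \<subseteq> {0, 1}" using digits_in_words[OF x] by (auto simp: words_def)
    ultimately have "admissible (digits x t)" using admissible_block[OF eq gap(1)] by simp
    moreover have "digit x (i + 2 * l) = 0"
      using gap unfolding even_gap_at_def by (auto dest: bspec[of _ _ "2 * l"])
    ultimately show ?thesis using gap by simp
  qed
  then show "full (digits x t)" "admissible (digits x t)"
    using full_digits[OF x, of t] by auto
qed

section \<open>The set of blocks and unique decoding\<close>

definition blocks :: "int list set" where
  "blocks = blk ` {x \<in> {0..<1}. 0 < blen x}"

lemma blocksE:
  assumes "b \<in> blocks"
  obtains x where "x \<in> {0..<1}" "blen x = length b" "b = digits x (length b)" "block_end x (length b)" "0 < length b"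
proof -
  obtain x where x: "x \<in> {0..<1}" "0 < blen x" "b = blk x" using assms by (auto simp: blocks_def)
  then have "b = digits x (length b)" by (simp add: blk_def)
  with x blen_block_end[OF x(2)] show ?thesis by (intro that[of x]) simp_all
qed

lemma blocks_admissible: "b \<in> blocks \<Longrightarrow> admissible b"
  by (metis blocksE block_end_structure(2))

lemma blocks_full: "b \<in> blocks \<Longrightarrow> full b"
  by (metis blocksE block_end_structure(1))

lemma blocks_nonempty: "b \<in> blocks \<Longrightarrow> b \<noteq> []"
  by (metis blocksE length_greater_0_conv)

lemma blocks_words: "b \<in> blocks \<Longrightarrow> b \<in> words (length b)"
  by (metis blocksE digits_in_words)

lemma digit_append:
  assumes "full b" "y \<in> {0..<1}"
  shows "digit (val b + y / \<phi> ^ length b) i = (if i < length b then b ! i else digit y (i - length b))"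
proof -
  let ?z = "val b + y / \<phi> ^ length b"
  have z: "digits ?z (length b) = b" "(T ^^ length b) ?z = y" using full_cylinder[OF assms] by auto
  show ?thesis
  proof (cases "i < length b")
    case True
    then have "digits ?z (length b) ! i = digit ?z i" by simp
    with z True show ?thesis by simp
  next
    case False
    then have "digit ((T ^^ length b) ?z) (i - length b) = digit ?z i" by (simp add: digit_funpow)
    with z False show ?thesis by simp
  qed
qed

text \<open>Since y begins with 1, the new point agrees up to and including index
  \<open>length b\<close> with a point whose first block is \<open>b\<close>. The two points thus
  have the same block ends up to that index.\<close>

lemma blk_append:
  assumes b: "b \<in> blocks" and y: "y \<in> J"
  defines "z \<equiv> val b + y / \<phi> ^ length b"
  shows "z \<in> {0..<1}" "blk z = b" "sh z = y" "blen z = length b"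
proof -
  from b obtain x where x: "x \<in> {0..<1}" "blen x = length b" "b = digits x (length b)"
    "block_end x (length b)" "0 < length b" by (rule blocksE)
  have y1: "y \<in> {0..<1}" "digit y 0 = 1" using y unfolding J_iff by auto
  note f = full_cylinder[OF blocks_full[OF b] y1(1), folded z_def]
  show z: "z \<in> {0..<1}" using f by blast
  have same: "digit z i = digit x i" if "i \<le> length b" for i
  proof (cases "i < length b")
    case True
    have "digit z i = b ! i"
      using digit_append[OF blocks_full[OF b] y1(1)] True by (simp add: z_def)
    also have "\<dots> = digit x i" using x(3) True by (metis nth_digits)
    finally show ?thesis .
  next
    case False
    with that have "i = length b" by simp
    moreover have "digit z (length b) = 1"
      using digit_append[OF blocks_full[OF b] y1(1)] y1(2) by (simp add: z_def)
    ultimately show ?thesis using x(4) by (simp add: block_end_def)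
  qed
  have eq: "block_end z t \<longleftrightarrow> block_end x t" if "t \<le> length b" for t
    using same that by (intro block_end_cong) auto
  have "block_end z (length b)" using eq x(4) by simp
  moreover have "length b \<le> t" if "block_end z t" for t
  proof (rule ccontr)
    assume t: "\<not> length b \<le> t"
    then have "block_end x t" using eq[of t] that by simp
    with t x(2) blen_le show False by force
  qed
  moreover from \<open>block_end z (length b)\<close> have "0 < blen z" unfolding blen_pos_iff by blast
  ultimately show len: "blen z = length b"
    using blen_le[of z "length b"] blen_block_end[of z] by (auto intro: antisym)
  show "blk z = b" "sh z = y" using f unfolding blk_def sh_def len by auto
qed

text \<open>Unique decoding identifies the affine image with an event about the first block and the
  shifted point, which turns \<open>m_branch\<close> into a statement about blocks.\<close>

lemma branch_eq:
  assumes b: "b \<in> blocks" and E: "E \<subseteq> J"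
  shows "branch b E = {x \<in> {0..<1}. blk x = b \<and> sh x \<in> E}"
proof (intro equalityI subsetI)
  fix x assume "x \<in> branch b E"
  then have "(x - val b) * \<phi> ^ length b \<in> E" by (simp add: branch_def)
  moreover define y where "y = (x - val b) * \<phi> ^ length b"
  ultimately have y: "y \<in> E" by simp
  then have yJ: "y \<in> J" using E by blast
  have "x = val b + y / \<phi> ^ length b" by (simp add: y_def)
  then show "x \<in> {x \<in> {0..<1}. blk x = b \<and> sh x \<in> E}"
    using blk_append[OF b yJ] y by simp
next
  fix x assume "x \<in> {x \<in> {0..<1}. blk x = b \<and> sh x \<in> E}"
  then have x: "x \<in> {0..<1}" "blk x = b" "sh x \<in> E" by auto
  have "x = val b + sh x / \<phi> ^ length b"
    using digit_expansion[of x "blen x"] x(2) by (auto simp: blk_def sh_def)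
  then have "(x - val b) * \<phi> ^ length b = sh x" by (simp add: field_simps)
  with x show "x \<in> branch b E" by (simp add: branch_def)
qed

lemma sh_in_J: "x \<in> {0..<1} \<Longrightarrow> 0 < blen x \<Longrightarrow> sh x \<in> J"
  using blen_block_end[of x] funpow_range[of x "blen x"] digit_funpow[of "blen x" x 0]
  unfolding J_iff sh_def by (simp add: block_end_def)

section \<open>Measurability of digits, blocks and the shift\<close>

lemma golden_map_measurable [measurable]: "T \<in> borel_measurable borel"
  unfolding golden_map_def[abs_def] frac_def by measurable

lemma funpow_golden_measurable [measurable]: "T ^^ k \<in> borel_measurable borel"
  by (rule measurable_funpow) measurable

lemma digit_measurable [measurable]: "(\<lambda>x. digit x k) \<in> measurable borel (count_space UNIV)"
proof -
  have "(\<lambda>x. \<phi> * (T ^^ k) x) \<in> borel_measurable borel" by measurable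
  then show ?thesis unfolding digit_def by measurable
qed

lemma even_gap_measurable [measurable]: "Measurable.pred borel (\<lambda>x. even_gap_at x i l)"
  unfolding even_gap_at_def by measurable

lemma block_end_measurable [measurable]: "Measurable.pred borel (\<lambda>x. block_end x t)"
  unfolding block_end_def by measurable

lemma blen_measurable [measurable]: "blen \<in> measurable borel (count_space UNIV)"
  unfolding blen_def[abs_def] by measurable

lemma blk_measurable [measurable]: "blk \<in> measurable borel (count_space UNIV)"
proof -
  have "{x. blk x = b} \<in> sets borel" for b
  proof -
    have "blk x = b \<longleftrightarrow> blen x = length b \<and> (\<forall>i<length b. digit x i = b ! i)" for x
      unfolding blk_def by (metis length_digits nth_digits nth_equalityI)
    then have "{x. blk x = b} = {x. blen x = length b \<and> (\<forall>i<length b. digit x i = b ! i)}" by simp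
    also have "\<dots> \<in> sets borel" by measurable
    finally show ?thesis .
  qed
  then show ?thesis
    by (subst measurable_count_space_eq_countable) (auto simp: vimage_def)
qed

lemma sh_measurable [measurable]: "sh \<in> borel_measurable borel"
  unfolding sh_def[abs_def]
  by (rule measurable_compose_countable[where f = "\<lambda>n x. (T ^^ n) x" and g = blen]) measurable

section \<open>Regular points and the goldenshift\<close>

abbreviation R :: "real set" where
  "R \<equiv> regular_points"

lemma R_altdef: "R = {x \<in> J. \<forall>n. \<exists>i\<ge>n. \<exists>l\<ge>1. even_gap_at x i l}"
  unfolding regular_points_def infinite_nat_iff_unbounded_le by auto

lemma R_sub_J: "R \<subseteq> J"
  by (auto simp: regular_points_def)

lemma R_measurable [measurable]: "R \<in> sets borel"
  unfolding R_altdef by measurable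

lemma even_gap_funpow: "even_gap_at ((T ^^ n) x) i l \<longleftrightarrow> even_gap_at x (n + i) l"
  by (simp add: even_gap_at_def digit_funpow add.assoc)

text \<open>Dropping finitely many digits does not affect whether there are infinitely many even
  gaps.\<close>

lemma R_funpow:
  assumes "x \<in> J" "(T ^^ n) x \<in> J"
  shows "(T ^^ n) x \<in> R \<longleftrightarrow> x \<in> R"
proof -
  have "(\<forall>k. \<exists>i\<ge>k. \<exists>l\<ge>1. even_gap_at x (n + i) l) \<longleftrightarrow> (\<forall>k. \<exists>i\<ge>k. \<exists>l\<ge>1. even_gap_at x i l)"
  proof safe
    fix k assume "\<forall>k. \<exists>i\<ge>k. \<exists>l\<ge>1. even_gap_at x (n + i) l"
    then obtain i l where "i \<ge> k" "l \<ge> 1" "even_gap_at x (n + i) l" by blast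
    then show "\<exists>i\<ge>k. \<exists>l\<ge>1. even_gap_at x i l" by (intro exI[of _ "n + i"]) auto
  next
    fix k assume "\<forall>k. \<exists>i\<ge>k. \<exists>l\<ge>1. even_gap_at x i l"
    then obtain i l where "i \<ge> n + k" "l \<ge> 1" "even_gap_at x i l" by blast
    then show "\<exists>i\<ge>k. \<exists>l\<ge>1. even_gap_at x (n + i) l" by (intro exI[of _ "i - n"]) auto
  qed
  then show ?thesis using assms by (simp add: R_altdef even_gap_funpow)
qed

lemma block_end_J: "x \<in> J \<Longrightarrow> block_end x t \<longleftrightarrow> (\<exists>i l. l \<ge> 1 \<and> even_gap_at x i l \<and> t = i + 2 * l + 1)"
  unfolding J_iff block_end_def by (auto simp: even_gap_at_def)

lemma R_blen: "x \<in> R \<Longrightarrow> 0 < blen x"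
proof -
  assume x: "x \<in> R"
  then obtain i l where "l \<ge> 1" "even_gap_at x i l" unfolding R_altdef by blast
  moreover have "x \<in> J" using x R_sub_J by blast
  ultimately have "block_end x (i + 2 * l + 1)" unfolding block_end_J[OF \<open>x \<in> J\<close>] by blast
  then show ?thesis unfolding blen_pos_iff by blast
qed

lemma goldenshift_eq: "x \<in> R \<Longrightarrow> goldenshift x = sh x"
proof -
  assume x: "x \<in> R"
  have "first_block_length x = (LEAST t. block_end x t)"
    unfolding first_block_length_def block_end_J[OF subsetD[OF R_sub_J x]] ..
  also have "\<dots> = blen x" using R_blen[OF x] unfolding blen_pos_iff by (simp add: blen_def)
  finally show ?thesis by (simp add: goldenshift_def sh_def)
qed

lemma R_iff_sh: "x \<in> J \<Longrightarrow> 0 < blen x \<Longrightarrow> sh x \<in> R \<longleftrightarrow> x \<in> R"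
proof -
  assume x: "x \<in> J" "0 < blen x"
  then have "x \<in> {0..<1}" unfolding J_iff by blast
  from sh_in_J[OF this x(2)] show ?thesis unfolding sh_def using R_funpow x by blast
qed

lemma sh_R: "x \<in> R \<Longrightarrow> sh x \<in> R"
  using R_iff_sh R_blen R_sub_J by blast

section \<open>The length of a block\<close>

text \<open>With \<open>pre0\<close> the two inverse branches of \<open>T\<close>, prefixing a digit
  to the expansion; for \<open>pre1\<close> the argument has to lie below 1/\<phi>, because no 1 may
  follow a 1.\<close>

definition pre1 :: "real \<Rightarrow> real" where
  "pre1 y = (1 + y) / \<phi>"

definition pre0 :: "real \<Rightarrow> real" where
  "pre0 y = y / \<phi>"

lemma pre0_range: "y \<in> {0..<1} \<Longrightarrow> pre0 y \<in> {0..<1 / \<phi>}"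
  by (simp add: pre0_def divide_strict_right_mono)

lemma unit_of_third: "y \<in> {0..<1 / \<phi>} \<Longrightarrow> y \<in> {0..<1}"
  using less_trans[of y "1 / \<phi>" 1] by simp

lemma pre1_J: "y \<in> {0..<1 / \<phi>} \<Longrightarrow> pre1 y \<in> J"
  unfolding pre1_def inverse_phi by (auto simp: field_simps inverse_phi phi_square)

lemma digit_pre0: "y \<in> {0..<1} \<Longrightarrow> digit (pre0 y) k = (case k of 0 \<Rightarrow> 0 | Suc j \<Rightarrow> digit y j)"
  using digit_prepend[of y 0] by (simp add: pre0_def split: nat.split)

lemma digit_pre1: "y \<in> {0..<1} \<Longrightarrow> digit (pre1 y) k = (case k of 0 \<Rightarrow> 1 | Suc j \<Rightarrow> digit y j)"
  using digit_prepend[of y 1] by (simp add: pre1_def split: nat.split)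

lemma pre1_inverse: "pre1 (\<phi> * y - 1) = y"
  and pre0_inverse: "pre0 (\<phi> * y) = y"
  by (simp_all add: pre1_def pre0_def)

text \<open>\<open>U n\<close> consists of the points whose first block does not end within \<open>n\<close> digits. The sets \<open>after_one\<close>,
  \<open>after_odd\<close>, \<open>after_even\<close> contain the tails that leave the block open for \<open>n\<close> more digits after the block
  has started with 1, with 10 (an odd run of zeros), with 100 (an even one).\<close>

definition U :: "nat \<Rightarrow> real set" where
  "U n = {x \<in> J. \<forall>t. block_end x t \<longrightarrow> n < t}"

definition after_one :: "nat \<Rightarrow> real set" where
  "after_one n = {y \<in> {0..<1 / \<phi>}. pre1 y \<in> U n}"

definition after_odd :: "nat \<Rightarrow> real set" where
  "after_odd n = {y \<in> {0..<1}. pre1 (pre0 y) \<in> U (n + 1)}"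

definition after_even :: "nat \<Rightarrow> real set" where
  "after_even n = {y \<in> {0..<1}. pre1 (pre0 (pre0 y)) \<in> U (n + 2)}"

lemma block_end_J_ge_3: "x \<in> J \<Longrightarrow> block_end x t \<Longrightarrow> 3 \<le> t"
  using block_end_J[of x t] by auto

text \<open>The shortest block is 100, hence no block of a point of \<open>J\<close> ends before
  index 3.\<close>

lemma U_0: "n \<le> 2 \<Longrightarrow> U n = J"
  using block_end_J_ge_3 by (fastforce simp: U_def)

lemma U_shift:
  assumes "x \<in> J" "x' \<in> J" "\<And>t. block_end x (t + 2) \<longleftrightarrow> block_end x' t"
  shows "x \<in> U (n + 2) \<longleftrightarrow> x' \<in> U n"
proof
  assume x: "x \<in> U (n + 2)"
  show "x' \<in> U n" unfolding U_def
  proof (intro CollectI conjI allI impI assms(2))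
    fix t assume "block_end x' t"
    then have "block_end x (t + 2)" using assms(3) by simp
    then have "n + 2 < t + 2" using x unfolding U_def by blast
    then show "n < t" by simp
  qed
next
  assume x': "x' \<in> U n"
  show "x \<in> U (n + 2)" unfolding U_def
  proof (intro CollectI conjI allI impI assms(1))
    fix t assume r: "block_end x t"
    then have "t = (t - 2) + 2" using block_end_J_ge_3[OF assms(1)] by fastforce
    then have "block_end x' (t - 2)" using assms(3)[of "t - 2"] r by simp
    then have "n < t - 2" using x' unfolding U_def by blast
    then show "n + 2 < t" by simp
  qed
qed

text \<open>A single zero between two ones is an odd gap and closes nothing. The prefix 10 can be
  deleted, and the block is as open as if it started at the second 1.\<close>

lemma U_101:
  assumes "y \<in> {0..<1 / \<phi>}"
  shows "pre1 (pre0 (pre1 y)) \<in> U (n + 2) \<longleftrightarrow> pre1 y \<in> U n"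
proof (rule U_shift)
  define x' where "x' = pre1 y"
  define x where "x = pre1 (pre0 x')"
  have x'J: "x' \<in> J" unfolding x'_def by (rule pre1_J[OF assms])
  then have x'1: "x' \<in> {0..<1}" "digit x' 0 = 1" unfolding J_iff by auto
  have p0: "pre0 x' \<in> {0..<1 / \<phi>}" by (rule pre0_range[OF x'1(1)])
  have xJ: "x \<in> J" unfolding x_def by (rule pre1_J[OF p0])
  have d: "digit x 0 = 1" "digit x 1 = 0" "digit x (k + 2) = digit x' k" for k
    using digit_pre1[OF unit_of_third[OF p0]] digit_pre0[OF x'1(1)] by (auto simp: x_def)
  show "pre1 (pre0 (pre1 y)) \<in> J" "pre1 y \<in> J" using xJ x'J by (simp_all add: x_def x'_def)
  fix t
  have gap: "even_gap_at x (i + 2) l \<longleftrightarrow> even_gap_at x' i l" for i l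
    using d(3)[of "i + j" for j] d(3)[of i] d(3)[of "i + 2 * l + 1"]
    by (simp add: even_gap_at_def add.assoc add.commute[of 2] add.left_commute[of 2])
  have no: "i \<ge> 2" if "l \<ge> 1" "even_gap_at x i l" for i l
  proof (rule ccontr)
    assume "\<not> 2 \<le> i"
    then have "i = 0 \<or> i = 1" by auto
    then show False
    proof
      assume "i = 0"
      with that have "digit x 2 = 0" by (auto simp: even_gap_at_def)
      with d(3)[of 0] x'1(2) show False by (simp add: numeral_2_eq_2)
    next
      assume "i = 1"
      with that d(2) show False by (simp add: even_gap_at_def)
    qed
  qed
  have "block_end x (t + 2) \<longleftrightarrow> block_end x' t"
    unfolding block_end_J[OF xJ] block_end_J[OF x'J]
  proof safe
    fix i l assume l: "l \<ge> 1" and g: "even_gap_at x i l" and t: "t + 2 = i + 2 * l + 1"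
    have "i = (i - 2) + 2" using no[OF l g] by simp
    then have "even_gap_at x' (i - 2) l" using gap[of "i - 2" l] g by simp
    with l t no[OF l g] show "\<exists>i l. 1 \<le> l \<and> even_gap_at x' i l \<and> t = i + 2 * l + 1"
      by (intro exI[of _ "i - 2"] exI[of _ l]) auto
  next
    fix i l assume "l \<ge> 1" "even_gap_at x' i l" "t = i + 2 * l + 1"
    with gap[of i l] show "\<exists>i' l'. 1 \<le> l' \<and> even_gap_at x i' l' \<and> i + 2 * l + 1 + 2 = i' + 2 * l' + 1"
      by (intro exI[of _ "i + 2"] exI[of _ l]) auto
  qed
  then show "block_end (pre1 (pre0 (pre1 y))) (t + 2) \<longleftrightarrow> block_end (pre1 y) t"
    by (simp add: x_def x'_def)
qed

text \<open>Deleting two zeros from the first run keeps its parity. A closing run of l + 1 pairs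
  becomes one of l pairs; l = 0 does not occur because the run has at least three zeros.\<close>

lemma U_1000:
  assumes "y \<in> {0..<1}"
  shows "pre1 (pre0 (pre0 (pre0 y))) \<in> U (n + 2) \<longleftrightarrow> pre1 (pre0 y) \<in> U n"
proof (rule U_shift)
  define x' where "x' = pre1 (pre0 y)"
  define x where "x = pre1 (pre0 (pre0 (pre0 y)))"
  have p: "pre0 y \<in> {0..<1 / \<phi>}" by (rule pre0_range[OF assms])
  have pp: "pre0 (pre0 y) \<in> {0..<1 / \<phi>}" by (rule pre0_range[OF unit_of_third[OF p]])
  have ppp: "pre0 (pre0 (pre0 y)) \<in> {0..<1 / \<phi>}" by (rule pre0_range[OF unit_of_third[OF pp]])
  show xJ: "pre1 (pre0 (pre0 (pre0 y))) \<in> J" and x'J: "pre1 (pre0 y) \<in> J"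
    using pre1_J p ppp by auto
  have d': "digit x' 0 = 1" "digit x' (Suc 0) = 0" "digit x' (k + 2) = digit y k" for k
    using digit_pre1[OF unit_of_third[OF p]] digit_pre0[OF assms] by (auto simp: x'_def)
  have d: "digit x 0 = 1" "digit x (Suc 0) = 0" "digit x 2 = 0" "digit x 3 = 0" "digit x (k + 4) = digit y k" for k
    using digit_pre1[OF unit_of_third[OF ppp]] digit_pre0[OF unit_of_third[OF pp]]
      digit_pre0[OF unit_of_third[OF p]] digit_pre0[OF assms]
    by (auto simp: x_def numeral_eq_Suc)
  have same: "digit x (k + 2) = digit x' k" if "1 \<le> k" for k
  proof (cases "k = 1")
    case True
    with d(4) d'(2) show ?thesis by (simp add: numeral_eq_Suc)
  next
    case False
    with that have "k = (k - 2) + 2" by simp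
    then show ?thesis using d(5)[of "k - 2"] d'(3)[of "k - 2"] by (simp add: add.commute)
  qed
  fix t
  have gap: "even_gap_at x (i + 2) l \<longleftrightarrow> even_gap_at x' i l" if "1 \<le> i" for i l
  proof -
    have "digit x (i + 2 + j) = digit x' (i + j)" for j
      using same[of "i + j"] that by (simp add: ac_simps)
    from this[of 0] this[of "2 * l + 1"] this show ?thesis
      by (simp add: even_gap_at_def add.assoc)
  qed
  have gap0: "even_gap_at x 0 (Suc l) \<longleftrightarrow> even_gap_at x' 0 l" for l
  proof -
    have "(\<forall>j\<in>{1..2 * Suc l}. digit x j = 0) \<longleftrightarrow> (\<forall>j\<in>{1..2 * l}. digit x' j = 0)"
    proof safe
      fix j assume a: "\<forall>j\<in>{1..2 * Suc l}. digit x j = 0" and j: "j \<in> {1..2 * l}"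
      then have "digit x (j + 2) = 0" by (intro a[rule_format]) auto
      then show "digit x' j = 0" using same[of j] j by simp
    next
      fix j assume a: "\<forall>j\<in>{1..2 * l}. digit x' j = 0" and j: "j \<in> {1..2 * Suc l}"
      show "digit x j = 0"
      proof (cases "j \<le> 2")
        case True
        with j have "j = 1 \<or> j = 2" by auto
        with d show ?thesis by auto
      next
        case False
        then have "j = (j - 2) + 2" by simp
        moreover have "digit x' (j - 2) = 0" using a j False by (intro a[rule_format]) auto
        ultimately show ?thesis using same[of "j - 2"] False by simp
      qed
    qed
    moreover have "digit x (2 * Suc l + 1) = digit x' (2 * l + 1)"
      using same[of "2 * l + 1"] by simp
    ultimately show ?thesis using d d' by (simp add: even_gap_at_def)
  qed
  have xJ': "x \<in> J" and x'J': "x' \<in> J" using xJ x'J by (simp_all add: x_def x'_def)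
  have "block_end x (t + 2) \<longleftrightarrow> block_end x' t"
    unfolding block_end_J[OF xJ'] block_end_J[OF x'J']
  proof safe
    fix i l assume l: "l \<ge> 1" and g: "even_gap_at x i l" and t: "t + 2 = i + 2 * l + 1"
    show "\<exists>i l. 1 \<le> l \<and> even_gap_at x' i l \<and> t = i + 2 * l + 1"
    proof (cases "i = 0")
      case True
      obtain k where k: "l = Suc k" using l by (cases l) auto
      have "k \<noteq> 0"
      proof
        assume "k = 0"
        with g True k d(4) show False by (simp add: even_gap_at_def numeral_eq_Suc)
      qed
      with gap0[of k] g True k t show ?thesis by (intro exI[of _ 0] exI[of _ k]) auto
    next
      case False
      have "i \<noteq> 1" "i \<noteq> 2" "i \<noteq> 3" using g d by (auto simp: even_gap_at_def)
      with False have i: "i = (i - 2) + 2" "1 \<le> i - 2" by auto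
      then have "even_gap_at x' (i - 2) l" using gap[of "i - 2" l] g by simp
      with l t i show ?thesis by (intro exI[of _ "i - 2"] exI[of _ l]) auto
    qed
  next
    fix i l assume l: "l \<ge> 1" "even_gap_at x' i l" "t = i + 2 * l + 1"
    show "\<exists>i' l'. 1 \<le> l' \<and> even_gap_at x i' l' \<and> i + 2 * l + 1 + 2 = i' + 2 * l' + 1"
    proof (cases "i = 0")
      case True
      with gap0[of l] l show ?thesis by (intro exI[of _ 0] exI[of _ "Suc l"]) auto
    next
      case False
      with gap[of i l] l show ?thesis by (intro exI[of _ "i + 2"] exI[of _ l]) auto
    qed
  qed
  then show "block_end (pre1 (pre0 (pre0 (pre0 y)))) (t + 2) \<longleftrightarrow> block_end (pre1 (pre0 y)) t"
    by (simp add: x_def x'_def)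
qed

lemma unit_split: "\<phi> * y < 1 \<Longrightarrow> 0 \<le> y \<Longrightarrow> \<phi> * y \<in> {0..<1}"
  "1 \<le> \<phi> * y \<Longrightarrow> y < 1 \<Longrightarrow> \<phi> * y - 1 \<in> {0..<1 / \<phi>}"
  by (simp_all add: inverse_phi)

text \<open>This and the next two lemmas are the transitions of a three-state automaton: after a 1
  only 0 is possible; after an odd run, 0 leads to an even run and 1 restarts; after an even run, 1
  would close the block and only 0 keeps it open.\<close>

lemma after_one_Suc: "after_one (Suc n) = {y. \<phi> * y \<in> after_odd n}"
proof -
  have "y \<in> {0..<1 / \<phi>} \<longleftrightarrow> \<phi> * y \<in> {0..<1}" for y
    by (auto simp: field_simps zero_le_mult_iff)
  then show ?thesis by (simp add: after_one_def after_odd_def pre0_inverse set_eq_iff)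
qed

lemma after_odd_Suc: "after_odd (Suc n) = {y. \<phi> * y \<in> after_even n} \<union> {y. \<phi> * y - 1 \<in> after_one n}"
proof (intro set_eqI iffI)
  fix y assume "y \<in> after_odd (Suc n)"
  then have y: "y \<in> {0..<1}" "pre1 (pre0 y) \<in> U (n + 2)" by (auto simp: after_odd_def)
  show "y \<in> {y. \<phi> * y \<in> after_even n} \<union> {y. \<phi> * y - 1 \<in> after_one n}"
  proof (cases "\<phi> * y < 1")
    case True
    with y unit_split(1)[OF True] show ?thesis by (simp add: after_even_def pre0_inverse)
  next
    case False
    then have z: "\<phi> * y - 1 \<in> {0..<1 / \<phi>}" using y by (intro unit_split(2)) auto
    have "pre1 (\<phi> * y - 1) \<in> U n" using U_101[OF z, of n] y by (simp add: pre1_inverse)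
    with z show ?thesis by (simp add: after_one_def)
  qed
next
  fix y assume "y \<in> {y. \<phi> * y \<in> after_even n} \<union> {y. \<phi> * y - 1 \<in> after_one n}"
  then consider "\<phi> * y \<in> after_even n" | "\<phi> * y - 1 \<in> after_one n" by blast
  then show "y \<in> after_odd (Suc n)"
  proof cases
    case 1
    then have z: "\<phi> * y \<in> {0..<1}" "pre1 (pre0 (pre0 (\<phi> * y))) \<in> U (n + 2)" by (auto simp: after_even_def)
    then have "y \<in> {0..<1}" using pre0_range[OF z(1)] unit_of_third by (simp only: pre0_inverse)
    with z show ?thesis by (simp add: after_odd_def pre0_inverse)
  next
    case 2
    then have z: "\<phi> * y - 1 \<in> {0..<1 / \<phi>}" "pre1 (\<phi> * y - 1) \<in> U n" by (auto simp: after_one_def)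
    have "y \<in> J" using pre1_J[OF z(1)] by (simp only: pre1_inverse)
    then have "y \<in> {0..<1}" unfolding J_iff by blast
    moreover have "pre1 (pre0 y) \<in> U (n + 2)" using U_101[OF z(1), of n] z(2) by (simp add: pre1_inverse)
    ultimately show ?thesis by (simp add: after_odd_def)
  qed
qed

lemma after_even_Suc: "after_even (Suc n) = {y. \<phi> * y \<in> after_odd n}"
proof (intro set_eqI iffI)
  fix y assume "y \<in> after_even (Suc n)"
  then have y: "y \<in> {0..<1}" "pre1 (pre0 (pre0 y)) \<in> U (n + 3)"
    by (auto simp: after_even_def eval_nat_numeral)
  \<comment> \<open>Otherwise \<open>y\<close> starts with 1 and 1001 closes the block at index
    3.\<close>
  have "\<phi> * y < 1"
  proof (rule ccontr)
    assume "\<not> \<phi> * y < 1"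
    then have "y \<in> J" using y by (auto simp: field_simps)
    then have d: "digit y 0 = 1" unfolding J_iff by blast
    have p: "pre0 y \<in> {0..<1 / \<phi>}" by (rule pre0_range[OF y(1)])
    have pp: "pre0 (pre0 y) \<in> {0..<1 / \<phi>}" by (rule pre0_range[OF unit_of_third[OF p]])
    let ?x = "pre1 (pre0 (pre0 y))"
    have "digit ?x 0 = 1" "digit ?x (Suc 0) = 0" "digit ?x 2 = 0" "digit ?x 3 = 1"
      using digit_pre1[OF unit_of_third[OF pp]] digit_pre0[OF unit_of_third[OF p]]
        digit_pre0[OF y(1)] d by (auto simp: numeral_eq_Suc)
    moreover have "{1..2 :: nat} = {1, 2}" by auto
    ultimately have "even_gap_at ?x 0 1" by (simp add: even_gap_at_def numeral_3_eq_3)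
    then have "block_end ?x 3" unfolding block_end_J[OF pre1_J[OF pp]] by (intro exI[of _ 0] exI[of _ 1]) simp
    with y(2) show False by (auto simp: U_def)
  qed
  then have z: "\<phi> * y \<in> {0..<1}" using y by (intro unit_split(1)) auto
  have "pre1 (pre0 (\<phi> * y)) \<in> U (n + 1)"
    using U_1000[OF z, of "n + 1"] y(2) by (simp add: pre0_inverse eval_nat_numeral)
  with z show "y \<in> {y. \<phi> * y \<in> after_odd n}" by (simp add: after_odd_def)
next
  fix y assume "y \<in> {y. \<phi> * y \<in> after_odd n}"
  then have z: "\<phi> * y \<in> {0..<1}" "pre1 (pre0 (\<phi> * y)) \<in> U (n + 1)" by (auto simp: after_odd_def)
  then have "y \<in> {0..<1}" using pre0_range[OF z(1)] unit_of_third by (simp only: pre0_inverse)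
  moreover have "pre1 (pre0 (pre0 y)) \<in> U (n + 1 + 2)"
    using U_1000[OF z(1), of "n + 1"] z(2) by (simp only: pre0_inverse)
  ultimately show "y \<in> after_even (Suc n)" by (simp add: after_even_def)
qed

section \<open>The linear recursion for the masses of the states\<close>

lemma U_measurable [measurable]: "U n \<in> sets borel"
  unfolding U_def by measurable

lemma pre_measurable [measurable]: "pre1 \<in> borel_measurable borel" "pre0 \<in> borel_measurable borel"
  unfolding pre1_def[abs_def] pre0_def[abs_def] by measurable

lemma after_measurable [measurable]: "after_one n \<in> sets borel" "after_odd n \<in> sets borel" "after_even n \<in> sets borel"
  unfolding after_one_def after_odd_def after_even_def by measurable

text \<open>Self-similarity closes up on six numbers, the masses of these sets and of the translates that
  can carry mass.\<close>

definition mi :: "nat \<Rightarrow> real" where "mi n = m (after_one n)"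
definition mi' :: "nat \<Rightarrow> real" where "mi' n = m {y. y - 1 \<in> after_one n}"
definition mo :: "nat \<Rightarrow> real" where "mo n = m (after_odd n)"
definition mo' :: "nat \<Rightarrow> real" where "mo' n = m {y. y - 1 / \<phi> \<in> after_odd n}"
definition me :: "nat \<Rightarrow> real" where "me n = m (after_even n)"
definition me' :: "nat \<Rightarrow> real" where "me' n = m {y. y - 1 \<in> after_even n}"

lemma after_bounds:
  "y \<in> after_one n \<Longrightarrow> 0 \<le> y \<and> y < 1 / \<phi>"
  "y \<in> after_odd n \<Longrightarrow> 0 \<le> y \<and> y < 1"
  "y \<in> after_even n \<Longrightarrow> 0 \<le> y \<and> y < 1"
  by (auto simp: after_one_def after_odd_def after_even_def)

lemma m_null_of: "E \<in> sets borel \<Longrightarrow> (\<And>y. y \<in> E \<Longrightarrow> 0 \<le> y \<Longrightarrow> y < \<phi> \<Longrightarrow> False) \<Longrightarrow> m E = 0"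
  by (rule m_null_outside) auto

lemma m_Un_of: "A \<in> sets borel \<Longrightarrow> B \<in> sets borel \<Longrightarrow> (\<And>y. y \<in> A \<Longrightarrow> y \<in> B \<Longrightarrow> False) \<Longrightarrow>
    m (A \<union> B) = m A + m B"
  by (rule m_Un) auto

text \<open>Only the digit 0 contributes: for the digit 1 the point 1 + y would have to lie in a
  subset of [0,1), which forces y < 0.\<close>

lemma mi_Suc: "mi (Suc n) = mo n / 2"
proof -
  have "m {y. 1 + y \<in> after_odd n} = 0"
    by (rule m_null_of) (auto dest: after_bounds)
  then show ?thesis
    unfolding mi_def after_one_Suc mo_def by (subst self_similar) auto
qed

lemma me_Suc: "me (Suc n) = mo n / 2"
proof -
  have "m {y. 1 + y \<in> after_odd n} = 0"
    by (rule m_null_of) (auto dest: after_bounds)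
  then show ?thesis
    unfolding me_def after_even_Suc mo_def by (subst self_similar) auto
qed

text \<open>The digit 1 turns the translation by 1 into one by \<phi> - 1 = 1/\<phi>, the digit 0
  turns it into one by \<phi>, which leaves the support.\<close>

lemma m_shifted_odd: "m {y. \<phi> * (y - 1) \<in> after_odd n} = mo' n / 2"
proof -
  have "m {y. y - \<phi> \<in> after_odd n} = 0"
    by (rule m_null_of) (auto dest: after_bounds)
  moreover have "{y. y / \<phi> \<in> {y. \<phi> * (y - 1) \<in> after_odd n}} = {y. y - \<phi> \<in> after_odd n}"
    by (simp add: right_diff_distrib)
  moreover have "{y. (1 + y) / \<phi> \<in> {y. \<phi> * (y - 1) \<in> after_odd n}} = {y. y - 1 / \<phi> \<in> after_odd n}"
  proof -
    have "\<phi> * ((1 + y) / \<phi> - 1) = y - 1 / \<phi>" for y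
      unfolding inverse_phi by (simp add: right_diff_distrib)
    then show ?thesis by simp
  qed
  moreover have "{y. \<phi> * (y - 1) \<in> after_odd n} \<in> sets borel" by measurable
  ultimately show ?thesis
    unfolding mo'_def using self_similar[of "{y. \<phi> * (y - 1) \<in> after_odd n}"] by simp
qed

lemma mi'_Suc: "mi' (Suc n) = mo' n / 2"
  unfolding mi'_def after_one_Suc by (simp add: m_shifted_odd)

lemma me'_Suc: "me' (Suc n) = mo' n / 2"
  unfolding me'_def after_even_Suc by (simp add: m_shifted_odd)

text \<open>For the digit 0 the transition to 1 produces the translate counted by
  \<open>mi'\<close>; for the digit 1 it produces \<open>after_one\<close> itself, and the
  transition to 0 falls below 0.\<close>

lemma mo_Suc: "mo (Suc n) = (me n + mi n + mi' n) / 2"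
proof -
  have 1: "m {y. y / \<phi> \<in> after_odd (Suc n)} = me n + mi' n"
  proof -
    have "{y. y / \<phi> \<in> after_odd (Suc n)} = after_even n \<union> {y. y - 1 \<in> after_one n}"
      by (auto simp: after_odd_Suc)
    then show ?thesis
      unfolding me_def mi'_def by simp (rule m_Un_of, auto dest!: after_bounds)
  qed
  have 2: "m {y. (1 + y) / \<phi> \<in> after_odd (Suc n)} = mi n"
  proof -
    have "{y. (1 + y) / \<phi> \<in> after_odd (Suc n)} = {y. 1 + y \<in> after_even n} \<union> after_one n"
      by (auto simp: after_odd_Suc)
    moreover have "m {y. 1 + y \<in> after_even n} = 0"
      by (rule m_null_of) (auto dest: after_bounds)
    moreover have "m ({y. 1 + y \<in> after_even n} \<union> after_one n) = m {y. 1 + y \<in> after_even n} + m (after_one n)"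
      by (rule m_Un_of) (auto dest!: after_bounds)
    ultimately show ?thesis unfolding mi_def by simp
  qed
  show ?thesis unfolding mo_def self_similar[OF after_measurable(2)] 1 2 by simp
qed

text \<open>Multiplication by \<phi> turns the translation by 1/\<phi> into one by 1. The translate
  of \<open>after_one\<close> by 2 is null because 2 > \<phi>.\<close>

lemma mo'_Suc: "mo' (Suc n) = (me n + me' n + mi' n) / 2"
proof -
  let ?S = "{y. y - 1 / \<phi> \<in> after_odd (Suc n)}"
  have S: "?S \<in> sets borel" by measurable
  have eq: "\<phi> * (y / \<phi> - 1 / \<phi>) = y - 1" "\<phi> * ((1 + y) / \<phi> - 1 / \<phi>) = y" for y
    by (simp_all add: field_simps)
  have 1: "m {y. y / \<phi> \<in> ?S} = me' n"
  proof -
    have "{y. y / \<phi> \<in> ?S} = {y. y - 1 \<in> after_even n} \<union> {y. y - 2 \<in> after_one n}"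
      unfolding after_odd_Suc mem_Collect_eq Un_iff eq by auto
    moreover have "m {y. y - 2 \<in> after_one n} = 0"
      using phi_bounds by (intro m_null_of) (auto dest!: after_bounds)
    moreover have "m ({y. y - 1 \<in> after_even n} \<union> {y. y - 2 \<in> after_one n}) =
        m {y. y - 1 \<in> after_even n} + m {y. y - 2 \<in> after_one n}"
      by (rule m_Un_of) (auto dest!: after_bounds)
    ultimately show ?thesis unfolding me'_def by simp
  qed
  have 2: "m {y. (1 + y) / \<phi> \<in> ?S} = me n + mi' n"
  proof -
    have "{y. (1 + y) / \<phi> \<in> ?S} = after_even n \<union> {y. y - 1 \<in> after_one n}"
      unfolding after_odd_Suc mem_Collect_eq Un_iff eq by auto
    then show ?thesis
      unfolding me_def mi'_def by simp (rule m_Un_of, auto dest!: after_bounds)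
  qed
  show ?thesis unfolding mo'_def self_similar[OF S] 1 2 by simp
qed

lemma m_U: "m (U n) = (mi n + mi' n) / 2"
proof -
  have U_iff: "x \<in> U n \<longleftrightarrow> \<phi> * x - 1 \<in> after_one n" for x
  proof
    assume x: "x \<in> U n"
    then have "x \<in> J" by (simp add: U_def)
    then have "\<phi> * x - 1 \<in> {0..<1 / \<phi>}" by (intro unit_split(2)) (auto simp: field_simps)
    with x show "\<phi> * x - 1 \<in> after_one n" by (simp add: after_one_def pre1_inverse)
  next
    assume "\<phi> * x - 1 \<in> after_one n"
    then show "x \<in> U n" by (simp add: after_one_def pre1_inverse)
  qed
  have "m (U n) = (m {y. y / \<phi> \<in> U n} + m {y. (1 + y) / \<phi> \<in> U n}) / 2"
    by (rule self_similar) measurable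
  then show ?thesis by (simp add: U_iff mi_def mi'_def)
qed

text \<open>At n = 0 nothing is excluded, so the sets are intervals, which up to null sets are
  unions of the three intervals of mass 1/3.\<close>

lemma initial_values:
  "mi 0 = 1 / 3" "mi' 0 = 1 / 3" "mo 0 = 2 / 3" "mo' 0 = 2 / 3" "me 0 = 2 / 3" "me' 0 = 1 / 3"
proof -
  have i: "after_one 0 = {0..<1 / \<phi>}"
    using pre1_J by (auto simp: after_one_def U_0)
  have o: "after_odd 0 = {0..<1}"
    using pre1_J[OF pre0_range] by (auto simp: after_odd_def U_0)
  have e: "after_even 0 = {0..<1}"
    using pre1_J[OF pre0_range[OF unit_of_third[OF pre0_range]]] by (auto simp: after_even_def U_0)
  have i1: "1 / \<phi> < 1" by simp
  have unit: "m {0..<1} = 2 / 3"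
    using m_Un[of "{0..<1 / \<phi>}" J] i1 m_thirds by (simp add: ivl_disj_un)
  have "{y. y - 1 \<in> after_one 0} = {1..<\<phi>}" unfolding i inverse_phi by auto
  then show "mi' 0 = 1 / 3" unfolding mi'_def by (simp add: m_thirds)
  have "{y. y - 1 / \<phi> \<in> after_odd 0} = J \<union> {1..<\<phi>}"
    unfolding o using phi_bounds by (auto simp: inverse_phi)
  moreover have "m (J \<union> {1..<\<phi>}) = m J + m {1..<\<phi>}" by (rule m_Un) auto
  ultimately show "mo' 0 = 2 / 3" unfolding mo'_def by (simp add: m_thirds)
  have "{y. y - 1 \<in> after_even 0} = {1..<\<phi>} \<union> {\<phi>..<2}"
    unfolding e using phi_bounds by auto
  moreover have "m ({1..<\<phi>} \<union> {\<phi>..<2}) = m {1..<\<phi>} + m {\<phi>..<2}" by (rule m_Un) auto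
  moreover have "m {\<phi>..<2} = 0" by (rule m_null_outside) auto
  ultimately show "me' 0 = 1 / 3" unfolding me'_def by (simp add: m_thirds)
  show "mi 0 = 1 / 3" "mo 0 = 2 / 3" "me 0 = 2 / 3"
    unfolding mi_def mo_def me_def i o e using unit m_thirds by simp_all
qed

text \<open>The coefficients are chosen such that \<open>V n - V (n + 1) = mi n + mi' n\<close>.\<close>

definition V :: "nat \<Rightarrow> real" where
  "V n = 2 * mi n + 3 * mi' n + 2 * mo n + 2 * mo' n + 2 * me n + me' n"

lemma V_diff: "V n - V (Suc n) = mi n + mi' n"
  unfolding V_def mi_Suc mi'_Suc mo_Suc mo'_Suc me_Suc me'_Suc by (simp add: field_simps)

lemma V_0: "V 0 = 6"
  by (simp add: V_def initial_values)

lemma masses_nonneg: "0 \<le> mi n" "0 \<le> mi' n" "0 \<le> mo n" "0 \<le> mo' n" "0 \<le> me n" "0 \<le> me' n"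
  by (simp_all add: mi_def mi'_def mo_def mo'_def me_def me'_def)

lemma V_sum: "(\<Sum>k<n. mi k + mi' k) = 6 - V n"
proof (induction n)
  case (Suc n)
  with V_diff[of n] show ?case by simp
qed (simp add: V_0)

text \<open>The telescoping sums are bounded by V 0, so \<open>mi\<close> and \<open>mi'\<close>
  tend to 0; the recursion carries this over to the other four masses.\<close>

lemma V_tendsto: "V \<longlonglongrightarrow> 0"
proof -
  have "summable (\<lambda>k. mi k + mi' k)"
  proof (rule summableI_nonneg_bounded[where x = 6])
    show "(\<Sum>k<n. mi k + mi' k) \<le> 6" for n
      using masses_nonneg[of n] by (simp add: V_sum V_def)
  qed (simp add: masses_nonneg)
  then have lim: "(\<lambda>k. mi k + mi' k) \<longlonglongrightarrow> 0" by (rule summable_LIMSEQ_zero)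
  have i: "mi \<longlonglongrightarrow> 0"
    by (rule tendsto_sandwich[OF _ _ tendsto_const lim]) (use masses_nonneg in auto)
  have i': "mi' \<longlonglongrightarrow> 0"
    by (rule tendsto_sandwich[OF _ _ tendsto_const lim]) (use masses_nonneg in auto)
  have o: "mo \<longlonglongrightarrow> 0"
    using tendsto_mult_right[OF LIMSEQ_Suc[OF i], of 2] by (simp add: mi_Suc)
  have o': "mo' \<longlonglongrightarrow> 0"
    using tendsto_mult_right[OF LIMSEQ_Suc[OF i'], of 2] by (simp add: mi'_Suc)
  have e: "me \<longlonglongrightarrow> 0"
    by (rule LIMSEQ_imp_Suc) (use tendsto_divide[OF o tendsto_const, of 2] in \<open>simp add: me_Suc\<close>)
  have e': "me' \<longlonglongrightarrow> 0"
    by (rule LIMSEQ_imp_Suc) (use tendsto_divide[OF o' tendsto_const, of 2] in \<open>simp add: me'_Suc\<close>)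
  have "V \<longlonglongrightarrow> 2 * 0 + 3 * 0 + 2 * 0 + 2 * 0 + 2 * 0 + 0"
    unfolding V_def[abs_def] by (intro tendsto_intros i i' o o' e e')
  then show ?thesis by simp
qed

text \<open>The telescoped sum V 0 = 6 is halved by \<open>m_U\<close>; the factor 3 is the
  normalization by the mass 1/3.\<close>

lemma unfinished_sums: "(\<lambda>n. 3 * m (U n)) sums 9"
proof -
  have "(\<lambda>n. 6 - V n) \<longlonglongrightarrow> 6 - 0" by (intro tendsto_intros V_tendsto)
  then have "(\<lambda>k. mi k + mi' k) sums 6" by (simp add: sums_def V_sum)
  from sums_mult[OF this, of "3 / 2"] show ?thesis
    by (simp add: m_U field_simps)
qed

lemma m_U_tendsto: "(\<lambda>n. m (U n)) \<longlonglongrightarrow> 0"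
  using tendsto_mult_left[OF summable_LIMSEQ_zero[OF sums_summable[OF unfinished_sums]], of "1 / 3"] by simp

lemma m_never_ending: "m {x \<in> J. \<forall>t. \<not> block_end x t} = 0"
proof -
  have "m {x \<in> J. \<forall>t. \<not> block_end x t} \<le> 0"
  proof (rule tendsto_lowerbound[OF m_U_tendsto])
    show "\<forall>\<^sub>F n in sequentially. m {x \<in> J. \<forall>t. \<not> block_end x t} \<le> m (U n)"
      by (intro always_eventually allI m_mono) (auto simp: U_def)
  qed simp
  then show ?thesis using measure_nonneg[of golden_law] by (simp add: order_antisym)
qed

text \<open>A nonregular point of \<open>J\<close> has a last gap (or none), after which its tail never completes a block.\<close>

lemma m_nonregular: "m (J - R) = 0"
proof -
  define W where "W = {x \<in> J. \<forall>t. \<not> block_end x t}"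
  have W [measurable]: "W \<in> sets borel" unfolding W_def by measurable
  have WJ: "W \<subseteq> J" by (auto simp: W_def)
  define B where "B = {b. admissible b}"
  have "J - R \<subseteq> W \<union> (\<Union>b\<in>B. branch b W)"
  proof
    fix x assume x: "x \<in> J - R"
    then have x1: "x \<in> {0..<1}" and xJ: "x \<in> J" using J_iff by blast+
    show "x \<in> W \<union> (\<Union>b\<in>B. branch b W)"
    proof (cases "\<exists>i l. l \<ge> 1 \<and> even_gap_at x i l")
      case False
      then have "x \<in> W" unfolding W_def using xJ block_end_J[OF xJ] by blast
      then show ?thesis by blast
    next
      case True
      define G where "G = {i. \<exists>l\<ge>1. even_gap_at x i l}"
      have "finite G" using x unfolding G_def regular_points_def by auto
      moreover have "G \<noteq> {}" using True by (auto simp: G_def)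
      ultimately have max: "Max G \<in> G" "\<And>i. i \<in> G \<Longrightarrow> i \<le> Max G" by auto
      then obtain l where l: "l \<ge> 1" "even_gap_at x (Max G) l" by (auto simp: G_def)
      define t where "t = Max G + 2 * l + 1"
      have r: "block_end x t" unfolding block_end_J[OF xJ] t_def using l by blast
      let ?y = "(T ^^ t) x"
      have "digit ?y 0 = 1" using r digit_funpow[of t x 0] by (simp add: block_end_def)
      then have yJ: "?y \<in> J" unfolding J_iff using funpow_range[OF x1] by blast
      have "\<not> even_gap_at ?y i k" if "k \<ge> 1" for i k
      proof
        assume "even_gap_at ?y i k"
        then have "t + i \<in> G" using that by (auto simp: G_def even_gap_funpow)
        with max(2)[of "t + i"] show False by (simp add: t_def)
      qed
      then have yW: "?y \<in> W" unfolding W_def using yJ block_end_J[OF yJ] by blast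
      have "(x - val (digits x t)) * \<phi> ^ t = ?y"
        using digit_expansion[of x t] by (simp add: field_simps)
      with yW have "x \<in> branch (digits x t) W" by (simp add: branch_def)
      moreover have "digits x t \<in> B" unfolding B_def using block_end_structure(2)[OF x1 r] by simp
      ultimately show ?thesis by blast
    qed
  qed
  moreover have "W \<union> (\<Union>b\<in>B. branch b W) \<in> sets borel"
    by (intro sets.Un W sets.countable_UN'') auto
  ultimately have "m (J - R) \<le> m (W \<union> (\<Union>b\<in>B. branch b W))" by (rule m_mono)
  moreover have "W \<union> (\<Union>b\<in>B. branch b W) \<in> null_sets golden_law"
  proof (intro null_sets.Un null_sets_UN')
    have "W \<in> null_sets golden_law"
      using m_never_ending unfolding W_def[symmetric] by (simp add: null_sets_def golden.emeasure_eq_measure)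
    then show "W \<in> null_sets golden_law" .
    fix b assume "b \<in> B"
    then have "m (branch b W) = 0"
      using m_branch[OF W WJ, of b] m_never_ending by (simp add: B_def W_def)
    then show "branch b W \<in> null_sets golden_law"
      by (simp add: null_sets_def golden.emeasure_eq_measure)
  qed simp
  then have "m (W \<union> (\<Union>b\<in>B. branch b W)) = 0"
    by (simp add: null_sets_def golden.emeasure_eq_measure)
  ultimately show ?thesis using measure_nonneg[of golden_law "J - R"] by simp
qed

lemma m_R: "m R = 1 / 3"
proof -
  have "m (R \<union> (J - R)) = m R + m (J - R)" by (rule m_Un) auto
  moreover have "R \<union> (J - R) = J" using R_sub_J by blast
  ultimately show ?thesis by (simp add: m_nonregular m_thirds)
qed

lemma mu_nonregular: "\<mu> (J - R) = 0"
  using mu_le[of "J - R"] m_nonregular measure_nonneg[of erdos_measure "J - R"] by simp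

lemma mu_J: "\<mu> J = 1 / 3"
proof -
  have "{y. y / \<phi> \<in> J} = {1..<\<phi>}" by (auto simp: field_simps)
  then show ?thesis by (simp add: mu_eq m_thirds)
qed

lemma mu_R: "\<mu> R = 1 / 3"
proof -
  have "\<mu> (R \<union> (J - R)) = \<mu> R + \<mu> (J - R)" by (rule erdos.finite_measure_Union) auto
  moreover have "R \<union> (J - R) = J" using R_sub_J by blast
  ultimately show ?thesis by (simp add: mu_nonregular mu_J)
qed

section \<open>Independence of the blocks\<close>

text \<open>The goldenshift does not preserve the normalized restriction of the Erdos measure, but maps it to
  \<open>reg_law\<close>, which is invariant and makes the blocks independent.\<close>

definition reg_law :: "real measure" where
  "reg_law = uniform_measure golden_law R"

abbreviation \<nu> :: "real set \<Rightarrow> real" where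
  "\<nu> \<equiv> measure reg_law"

lemma sets_reg_law [simp, measurable_cong]: "sets reg_law = sets borel"
  and space_reg_law [simp]: "space reg_law = UNIV"
  by (simp_all add: reg_law_def)

lemma nu_eq: "E \<in> sets borel \<Longrightarrow> \<nu> E = 3 * m (R \<inter> E)"
  unfolding reg_law_def
  by (subst measure_uniform_measure) (simp_all add: golden.emeasure_eq_measure m_R)

interpretation reg: prob_space reg_law
  unfolding reg_law_def
  by (rule prob_space_uniform_measure) (simp_all add: golden.emeasure_eq_measure m_R)

lemma blk_hd: "0 < blen x \<Longrightarrow> blk x ! 0 = digit x 0"
  by (simp add: blk_def)

lemma unit_of_R: "x \<in> R \<Longrightarrow> x \<in> {0..<1}"
  using R_sub_J J_iff by blast

lemma blk_in_blocks: "x \<in> {0..<1} \<Longrightarrow> 0 < blen x \<Longrightarrow> blk x \<in> blocks"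
  by (auto simp: blocks_def)

lemma blen_of_blk: "blk x = b \<Longrightarrow> b \<in> blocks \<Longrightarrow> 0 < blen x"
  using blocks_nonempty[of b] by (metis length_blk length_greater_0_conv)

lemma R_block_fiber:
  assumes b: "b \<in> blocks" "b ! 0 = 1"
  shows "{x \<in> R. blk x = b \<and> sh x \<in> E} = branch b (R \<inter> E)"
proof -
  have "branch b (R \<inter> E) = {x \<in> {0..<1}. blk x = b \<and> sh x \<in> R \<inter> E}"
    using R_sub_J by (intro branch_eq b) blast
  also have "\<dots> = {x \<in> R. blk x = b \<and> sh x \<in> E}"
  proof (intro equalityI subsetI)
    fix x assume "x \<in> {x \<in> {0..<1}. blk x = b \<and> sh x \<in> R \<inter> E}"
    then have x: "x \<in> {0..<1}" "blk x = b" "sh x \<in> R" "sh x \<in> E" by auto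
    have len: "0 < blen x" by (rule blen_of_blk[OF x(2) b(1)])
    then have "x \<in> J" unfolding J_iff using x b(2) blk_hd[OF len] by simp
    then have "x \<in> R" using R_iff_sh len x(3) by blast
    with x show "x \<in> {x \<in> R. blk x = b \<and> sh x \<in> E}" by simp
  next
    fix x assume "x \<in> {x \<in> R. blk x = b \<and> sh x \<in> E}"
    then have x: "x \<in> R" "blk x = b" "sh x \<in> E" by auto
    with unit_of_R[OF x(1)] sh_R[OF x(1)]
    show "x \<in> {x \<in> {0..<1}. blk x = b \<and> sh x \<in> R \<inter> E}" by simp
  qed
  finally show ?thesis by simp
qed

lemma R_block_fiber_empty:
  assumes b: "\<not> (b \<in> blocks \<and> b ! 0 = 1)"
  shows "{x \<in> R. blk x = b \<and> P x} = {}"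
proof -
  have False if x: "x \<in> R" "blk x = b" for x
  proof -
    have "blk x \<in> blocks" using blk_in_blocks[OF unit_of_R R_blen] x by blast
    moreover have "digit x 0 = 1" using x(1) R_sub_J J_iff[of x] by blast
    ultimately show False using b x(2) blk_hd[OF R_blen[OF x(1)]] by simp
  qed
  then show ?thesis by blast
qed

text \<open>The carrier used for the Erdos measure on all of [0,1): the first block, possibly a run
  of leading zeros, ends and is followed by a regular point.\<close>

definition good_points :: "real set" where
  "good_points = {x \<in> {0..<1}. 0 < blen x \<and> sh x \<in> R}"

lemma good_measurable [measurable]: "good_points \<in> sets borel"
  unfolding good_points_def by measurable

lemma good_block_fiber:
  assumes b: "b \<in> blocks"
  shows "{x \<in> good_points. blk x = b \<and> sh x \<in> E} = branch b (R \<inter> E)"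
proof -
  have "branch b (R \<inter> E) = {x \<in> {0..<1}. blk x = b \<and> sh x \<in> R \<inter> E}"
    using R_sub_J by (intro branch_eq b) blast
  then show ?thesis using blen_of_blk[OF _ b] by (auto simp: good_points_def)
qed

lemma good_block_fiber_empty: "b \<notin> blocks \<Longrightarrow> {x \<in> good_points. blk x = b \<and> P x} = {}"
  using blk_in_blocks by (auto simp: good_points_def)

lemma m_branch_R: "b \<in> blocks \<Longrightarrow> E \<in> sets borel \<Longrightarrow>
    m (branch b (R \<inter> E)) = card {w \<in> words (length b). hor \<phi> w = hor \<phi> b} / 2 ^ length b * m (R \<inter> E)"
  using R_sub_J by (intro m_branch blocks_admissible) auto

lemma mu_branch_R: "b \<in> blocks \<Longrightarrow> E \<in> sets borel \<Longrightarrow>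
    \<mu> (branch b (R \<inter> E)) = card {w \<in> words (length b - 1). hor \<phi> w = hor \<phi> b} / 2 ^ (length b - 1) * m (R \<inter> E)"
  using R_sub_J by (intro mu_branch blocks_admissible blocks_nonempty) auto

definition bp :: "int list \<Rightarrow> real" where
  "bp b = \<nu> {x. blk x = b}"

definition bq :: "int list \<Rightarrow> real" where
  "bq b = \<mu> {x \<in> good_points. blk x = b}"

text \<open>The branch formula gives a weight depending on \<open>b\<close> only; taking E = UNIV
  identifies the weight as \<open>bp b\<close>.\<close>

lemma nu_block: "\<nu> {x. blk x = b \<and> sh x \<in> E} = bp b * \<nu> E" if E [measurable]: "E \<in> sets borel"
proof (cases "b \<in> blocks \<and> b ! 0 = 1")
  case True
  define c where "c = card {w \<in> words (length b). hor \<phi> w = hor \<phi> b} / (2 ^ length b :: real)"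
  have *: "\<nu> {x. blk x = b \<and> sh x \<in> E} = c * \<nu> E" if E [measurable]: "E \<in> sets borel" for E
  proof -
    have "\<nu> {x. blk x = b \<and> sh x \<in> E} = 3 * m (R \<inter> {x. blk x = b \<and> sh x \<in> E})"
      by (rule nu_eq) measurable
    also have "R \<inter> {x. blk x = b \<and> sh x \<in> E} = branch b (R \<inter> E)"
      using R_block_fiber[of b E] True by auto
    finally show ?thesis using True m_branch_R[OF _ E] by (simp add: c_def nu_eq E)
  qed
  from *[of UNIV] have "bp b = c" using reg.prob_space by (simp add: bp_def)
  with *[OF E] show ?thesis by simp
next
  case False
  have "\<nu> {x. blk x = b \<and> sh x \<in> E} = 3 * m (R \<inter> {x. blk x = b \<and> sh x \<in> E})"
    by (rule nu_eq) measurable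
  moreover have "bp b = 3 * m (R \<inter> {x. blk x = b})"
    unfolding bp_def by (rule nu_eq) measurable
  moreover have "R \<inter> {x. blk x = b \<and> sh x \<in> E} = {}" "R \<inter> {x. blk x = b} = {}"
    using R_block_fiber_empty[OF False, of "\<lambda>_. True"] by auto
  ultimately show ?thesis by simp
qed

lemma mu_block: "\<mu> {x \<in> good_points. blk x = b \<and> sh x \<in> E} = bq b * \<nu> E" if E [measurable]: "E \<in> sets borel"
proof (cases "b \<in> blocks")
  case True
  define c where "c = card {w \<in> words (length b - 1). hor \<phi> w = hor \<phi> b} / (2 ^ (length b - 1) :: real) / 3"
  have *: "\<mu> {x \<in> good_points. blk x = b \<and> sh x \<in> E} = c * \<nu> E" if E: "E \<in> sets borel" for E
    using mu_branch_R[OF True E] by (simp add: good_block_fiber[OF True] c_def nu_eq E)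
  from *[of UNIV] have "bq b = c" using reg.prob_space by (simp add: bq_def)
  with *[OF E] show ?thesis by simp
next
  case False
  have e: "{x \<in> good_points. blk x = b} = {}"
    using good_block_fiber_empty[OF False, of "\<lambda>_. True"] by auto
  have "bq b = 0" unfolding bq_def e by simp
  with good_block_fiber_empty[OF False, of "\<lambda>x. sh x \<in> E"] show ?thesis
    by (simp only: measure_empty mult_zero_left)
qed

lemma bp_nonneg: "0 \<le> bp b" and bq_nonneg: "0 \<le> bq b"
  by (simp_all add: bp_def bq_def)

text \<open>A block represents itself, so its representation count is at least 1. This bounds -ln of
  its probability by a multiple of its length.\<close>

lemma bp_ge:
  assumes "bp b \<noteq> 0"
  shows "1 / 2 ^ length b \<le> bp b" "b \<in> blocks"
proof -
  have eq: "bp b = 3 * m (R \<inter> {x. blk x = b})"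
    unfolding bp_def by (rule nu_eq) measurable
  have b: "b \<in> blocks \<and> b ! 0 = 1"
  proof (rule ccontr)
    assume "\<not> (b \<in> blocks \<and> b ! 0 = 1)"
    from R_block_fiber_empty[OF this, of "\<lambda>_. True"] have "R \<inter> {x. blk x = b} = {}" by auto
    with eq assms show False by simp
  qed
  then show "b \<in> blocks" by simp
  have "R \<inter> {x. blk x = b} = branch b (R \<inter> UNIV)"
    using R_block_fiber[of b UNIV] b by auto
  then have "bp b = card {w \<in> words (length b). hor \<phi> w = hor \<phi> b} / 2 ^ length b"
    using eq m_branch_R[of b UNIV] b m_R by simp
  then show "1 / 2 ^ length b \<le> bp b"
    using m_branch_weight_ge[OF blocks_admissible] b by simp
qed

text \<open>A block starting with 1 need not have a representation starting with 0, but if the count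
  is not zero it is at least 1.\<close>

lemma bq_ge:
  assumes "bq b \<noteq> 0"
  shows "1 / (3 * 2 ^ length b) \<le> bq b" "b \<in> blocks"
proof -
  show b: "b \<in> blocks"
  proof (rule ccontr)
    assume "b \<notin> blocks"
    then have e: "{x \<in> good_points. blk x = b} = {}"
      using good_block_fiber_empty[of b "\<lambda>_. True"] by auto
    from assms show False unfolding bq_def e by simp
  qed
  define k where "k = card {w \<in> words (length b - 1). hor \<phi> w = hor \<phi> b}"
  have "bq b = k / 2 ^ (length b - 1) / 3"
    unfolding bq_def k_def using good_block_fiber[OF b, of UNIV] mu_branch_R[OF b, of UNIV] m_R by simp
  moreover from this assms have "k \<noteq> 0" by auto
  then have "1 \<le> real k" by simp
  moreover have "(2 :: real) ^ (length b - 1) \<le> 2 ^ length b" by (intro power_increasing) auto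
  then have "1 / (2 ^ length b * 3) \<le> 1 / (2 ^ (length b - 1) * 3 :: real)"
    by (intro divide_left_mono mult_right_mono) auto
  ultimately show "1 / (3 * 2 ^ length b) \<le> bq b"
    by (simp add: mult.commute) (erule order_trans, intro divide_right_mono, auto)
qed

lemma small_digits:
  assumes x: "x \<in> {0..<1}" "x \<noteq> 0"
  shows "\<exists>j. digit x j = 1"
proof (rule ccontr)
  assume no: "\<not> (\<exists>j. digit x j = 1)"
  have "x < 1 / \<phi> ^ n" for n
  proof -
    have "digits x n = replicate n 0"
      using no digit_0_1[OF x(1)] by (intro nth_equalityI) auto
    then have "x = (T ^^ n) x / \<phi> ^ n"
      using digit_expansion[of x n] by (simp add: val_def)
    also have "\<dots> < 1 / \<phi> ^ n"
      using funpow_range[OF x(1), of n] by (intro divide_strict_right_mono) auto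
    finally show ?thesis .
  qed
  moreover have "(\<lambda>n. (1 / \<phi>) ^ n) \<longlonglongrightarrow> 0" by (rule LIMSEQ_power_zero) simp
  then have "\<forall>\<^sub>F n in sequentially. (1 / \<phi>) ^ n < x"
    using x by (intro order_tendstoD(2)) auto
  then obtain n where "(1 / \<phi>) ^ n < x" by (auto simp: eventually_sequentially)
  ultimately show False using less_asym[of x "(1 / \<phi>) ^ n"] by (simp add: power_divide)
qed

text \<open>A point of [0,1) other than 0 has a first digit 1. If it is not good, its tail from
  there on is a nonregular point of \<open>J\<close>; the sets \<open>B j\<close> collect these
  points by the number j of leading zeros.\<close>

lemma mu_good: "\<mu> good_points = 1"
proof -
  define B where "B j = branch (replicate j 0) (J - R)" for j :: nat
  have B: "B j \<in> sets borel" for j unfolding B_def by (intro branch_sets) auto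
  have muB: "\<mu> (B j) = 0" for j
  proof (cases j)
    case 0
    have "B 0 = J - R" unfolding B_def branch_def by auto
    with 0 mu_nonregular show ?thesis by simp
  next
    case (Suc k)
    then show ?thesis
      using mu_branch[of "J - R" "replicate j 0"] admissible_zeros[of j]
      by (simp add: B_def m_nonregular)
  qed
  have "- good_points \<subseteq> - {0..<1} \<union> {0} \<union> (\<Union>j. B j)"
  proof
    fix x assume x: "x \<in> - good_points"
    show "x \<in> - {0..<1} \<union> {0} \<union> (\<Union>j. B j)"
    proof (cases "x \<in> {0..<1} \<and> x \<noteq> 0")
      case True
      define j where "j = (LEAST j. digit x j = 1)"
      have j: "digit x j = 1" "\<And>i. i < j \<Longrightarrow> digit x i \<noteq> 1"
        unfolding j_def using small_digits True by (auto intro: LeastI_ex dest: not_less_Least)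
      then have zeros: "digits x j = replicate j 0"
        using digit_0_1[of x] True by (intro nth_equalityI) auto
      have Tj: "(T ^^ j) x \<in> J"
        unfolding J_iff using funpow_range[of x j] True j digit_funpow[of j x 0] by simp
      have "(T ^^ j) x \<notin> R"
      proof
        assume reg: "(T ^^ j) x \<in> R"
        show False
        proof (cases "j = 0")
          case True
          then have "x \<in> R" using reg by simp
          then have "x \<in> good_points" using R_blen sh_R unit_of_R by (simp add: good_points_def)
          with x show False by simp
        next
          case False
          have "\<forall>i<j. digit x i = 0" using j(2) digit_0_1[of x] True by blast
          then have r: "block_end x j" using False j(1) by (simp add: block_end_def)
          have "blen x = j"
          proof (rule antisym[OF blen_le[OF r]])
            have "0 < blen x" using r blen_pos_iff by blast
            then have "digit x (blen x) = 1" using blen_block_end by (simp add: block_end_def)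
            then show "j \<le> blen x" using j(2) by (meson not_le)
          qed
          then have "x \<in> good_points" using reg False True by (simp add: good_points_def sh_def)
          with x show False by simp
        qed
      qed
      moreover have "(x - val (replicate j 0)) * \<phi> ^ j = (T ^^ j) x"
        using digit_expansion[of x j] zeros by (simp add: field_simps)
      ultimately have "x \<in> B j" using Tj by (simp add: B_def branch_def)
      then show ?thesis by blast
    qed auto
  qed
  moreover have "- {0..<1} \<union> {0} \<union> (\<Union>j. B j) \<in> null_sets erdos_measure"
  proof (intro null_sets.Un null_sets_UN')
    have "\<mu> (- {0..<1}) = 0"
      by (subst mu_eq) (auto intro!: m_null_outside)
    then show "- {0..<1} \<in> null_sets erdos_measure"
      by (simp add: null_sets_def erdos.emeasure_eq_measure)
    have "\<mu> {0} = 0" by (subst mu_eq) (auto simp: m_zero)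
    then show "{0} \<in> null_sets erdos_measure"
      by (simp add: null_sets_def erdos.emeasure_eq_measure)
  qed (use B muB in \<open>auto simp: null_sets_def erdos.emeasure_eq_measure\<close>)
  ultimately have "- good_points \<in> null_sets erdos_measure"
    by (rule null_sets_subset[rotated 2]) auto
  then have "\<mu> (- good_points) = 0" by (simp add: null_sets_def erdos.emeasure_eq_measure)
  moreover have "\<mu> (space erdos_measure - good_points) = 1 - \<mu> good_points"
    by (rule erdos.prob_compl) simp
  ultimately show ?thesis by (simp add: Compl_eq_Diff_UNIV)
qed

text \<open>The product formula is summed over the countably many blocks, and E = UNIV identifies
  the total weight. It yields both the invariance of \<open>reg_law\<close> and the fact that one
  goldenshift carries the Erdos measure on \<open>R\<close> to it.\<close>

lemma sh_law:
  assumes Q: "finite_measure Q" "sets Q = sets borel" and G [measurable]: "G \<in> sets borel"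
    and fib: "\<And>b E. E \<in> sets borel \<Longrightarrow> measure Q {x \<in> G. blk x = b \<and> sh x \<in> E} = c b * \<nu> E"
    and E [measurable]: "E \<in> sets borel"
  shows "measure Q {x \<in> G. sh x \<in> E} = measure Q G * \<nu> E"
proof -
  interpret Q: finite_measure Q by fact
  have c: "0 \<le> c b" for b
  proof -
    have "c b = measure Q {x \<in> G. blk x = b \<and> sh x \<in> UNIV}"
      using fib[of UNIV b] reg.prob_space by simp
    then show ?thesis by simp
  qed
  have eq: "emeasure Q {x \<in> G. sh x \<in> E} = (\<integral>\<^sup>+b. ennreal (c b) \<partial>count_space UNIV) * ennreal (\<nu> E)"
    if E [measurable]: "E \<in> sets borel" for E
  proof -
    have ev: "{x \<in> G. blk x = b \<and> sh x \<in> E} \<in> sets borel" for b by measurable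
    have "{x \<in> G. sh x \<in> E} = (\<Union>b. {x \<in> G. blk x = b \<and> sh x \<in> E})" by auto
    then have "emeasure Q {x \<in> G. sh x \<in> E} = (\<integral>\<^sup>+b. emeasure Q {x \<in> G. blk x = b \<and> sh x \<in> E} \<partial>count_space UNIV)"
      using ev Q(2) by (simp only:) (rule emeasure_UN_countable, auto simp: disjoint_family_on_def)
    also have "\<dots> = (\<integral>\<^sup>+b. ennreal (c b) * ennreal (\<nu> E) \<partial>count_space UNIV)"
      by (simp add: Q.emeasure_eq_measure fib[OF E] ennreal_mult c)
    also have "\<dots> = (\<integral>\<^sup>+b. ennreal (c b) \<partial>count_space UNIV) * ennreal (\<nu> E)"
      by (rule nn_integral_multc) simp
    finally show ?thesis .
  qed
  from eq[of UNIV] have "(\<integral>\<^sup>+b. ennreal (c b) \<partial>count_space UNIV) = ennreal (measure Q G)"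
    using reg.prob_space by (simp add: Q.emeasure_eq_measure)
  with eq[OF E] have "ennreal (measure Q {x \<in> G. sh x \<in> E}) = ennreal (measure Q G * \<nu> E)"
    by (simp add: Q.emeasure_eq_measure ennreal_mult)
  then show ?thesis by simp
qed

lemma nu_sh: "\<nu> {x. sh x \<in> E} = \<nu> E" if E: "E \<in> sets borel"
  using sh_law[OF reg.finite_measure_axioms, of UNIV bp E] nu_block E reg.prob_space by simp

lemma mu_R_sh: "3 * \<mu> {x \<in> R. sh x \<in> E} = \<nu> E" if E: "E \<in> sets borel"
proof -
  have fib: "\<mu> {x \<in> R. blk x = b \<and> sh x \<in> E} = (if b \<in> blocks \<and> b ! 0 = 1 then bq b else 0) * \<nu> E"
    if E: "E \<in> sets borel" for b E
  proof (cases "b \<in> blocks \<and> b ! 0 = 1")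
    case True
    with mu_block[OF E, of b] good_block_fiber[of b E] R_block_fiber[of b E] show ?thesis by simp
  next
    case False
    with R_block_fiber_empty[OF False, of "\<lambda>x. sh x \<in> E"] show ?thesis by (simp only: if_False measure_empty mult_zero_left)
  qed
  have "\<mu> {x \<in> R. sh x \<in> E} = \<mu> R * \<nu> E"
    by (rule sh_law[OF erdos.finite_measure_axioms _ R_measurable fib E]) auto
  then show ?thesis by (simp add: mu_R)
qed

lemma nu_tail: "\<nu> {x. n < blen x} = 3 * m (U n)"
proof -
  have "\<nu> {x. n < blen x} = 3 * m (R \<inter> {x. n < blen x})" by (rule nu_eq) measurable
  also have "m (R \<inter> {x. n < blen x}) = m (U n)"
  proof -
    have "m (U n) = m ((R \<inter> {x. n < blen x}) \<union> (U n \<inter> (J - R)))"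
    proof (rule arg_cong[where f = m])
      have "x \<in> U n \<longleftrightarrow> n < blen x" if "x \<in> R" for x
        using blen_greater_iff[of x n] R_blen[OF that] that R_sub_J by (auto simp: U_def)
      then show "U n = (R \<inter> {x. n < blen x}) \<union> (U n \<inter> (J - R))" by (auto simp: U_def)
    qed
    also have "\<dots> = m (R \<inter> {x. n < blen x}) + m (U n \<inter> (J - R))"
      by (rule m_Un) auto
    also have "m (U n \<inter> (J - R)) = 0"
      using m_mono[of "U n \<inter> (J - R)" "J - R"] m_nonregular measure_nonneg[of golden_law "U n \<inter> (J - R)"] by simp
    finally show ?thesis by simp
  qed
  finally show ?thesis .
qed

lemma nu_tail_sums: "(\<lambda>n. \<nu> {x. n < blen x}) sums 9"
  using unfinished_sums by (simp add: nu_tail)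

lemma sum_bp_le:
  assumes F: "finite F" and P: "\<And>b. b \<in> F \<Longrightarrow> n < length b"
  shows "sum bp F \<le> \<nu> {x. n < blen x}"
proof -
  have "sum bp F = \<nu> (\<Union>b\<in>F. {x. blk x = b})"
    unfolding bp_def using F
    by (intro reg.finite_measure_finite_Union[symmetric]) (auto simp: disjoint_family_on_def)
  also have "\<dots> \<le> \<nu> {x. n < blen x}"
    using P by (intro reg.finite_measure_mono) (auto simp flip: length_blk)
  finally show ?thesis .
qed

text \<open>The length is written as the number of n below it; exchanging the sums gives the tail
  probabilities, whose sum is 9.\<close>

lemma sum_length_bp_le:
  assumes F: "finite F"
  shows "(\<Sum>b\<in>F. bp b * length b) \<le> 9"
proof -
  define K where "K = Max (insert 0 (length ` F))"
  have K: "length b \<le> K" if "b \<in> F" for b unfolding K_def using F that by (intro Max_ge) auto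
  have "(\<Sum>b\<in>F. bp b * length b) = (\<Sum>b\<in>F. \<Sum>n<K. if n < length b then bp b else 0)"
  proof (rule sum.cong[OF refl])
    fix b assume "b \<in> F"
    have "(\<Sum>n<K. if n < length b then bp b else 0) = (\<Sum>n\<in>{..<K} \<inter> {n. n < length b}. bp b)"
      by (subst sum.inter_restrict) auto
    also have "{..<K} \<inter> {n. n < length b} = {..<length b}" using K[OF \<open>b \<in> F\<close>] by auto
    finally show "bp b * length b = (\<Sum>n<K. if n < length b then bp b else 0)" by simp
  qed
  also have "\<dots> = (\<Sum>n<K. \<Sum>b\<in>F. if n < length b then bp b else 0)" by (rule sum.swap)
  also have "\<dots> \<le> (\<Sum>n<K. \<nu> {x. n < blen x})"
  proof (rule sum_mono)
    fix n
    have "(\<Sum>b\<in>F. if n < length b then bp b else 0) = sum bp (F \<inter> {b. n < length b})"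
      by (subst sum.inter_restrict[OF F]) simp
    also have "\<dots> \<le> \<nu> {x. n < blen x}" using F by (intro sum_bp_le) auto
    finally show "(\<Sum>b\<in>F. if n < length b then bp b else 0) \<le> \<nu> {x. n < blen x}" .
  qed
  also have "\<dots> \<le> 9"
    using nu_tail_sums sum_le_suminf[OF sums_summable[OF nu_tail_sums], of "{..<K}"]
    by (simp add: sums_iff)
  finally show ?thesis .
qed

lemma eta_bp_le: "eta (bp b) \<le> bp b * length b * ln 2"
proof (cases "bp b = 0")
  case False
  then have "0 < bp b" using bp_nonneg[of b] by simp
  moreover have "ln (1 / 2 ^ length b) \<le> ln (bp b)"
    using bp_ge[OF False] by (intro ln_mono) auto
  then have "- ln (bp b) \<le> length b * ln 2" by (simp add: ln_div ln_realpow)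
  ultimately have "bp b * - ln (bp b) \<le> bp b * (length b * ln 2)" by (intro mult_left_mono) auto
  then show ?thesis by (simp add: eta_def)
qed simp

lemma bp_le_1: "bp b \<le> 1"
  by (simp add: bp_def)

text \<open>Entropy is bounded by the mean block length times ln 2.\<close>

lemma eta_bp_summable: "(\<lambda>b. eta (bp b)) summable_on UNIV"
proof (rule nonneg_bdd_above_summable_on)
  show "0 \<le> eta (bp b)" for b by (rule eta_nonneg[OF bp_nonneg bp_le_1])
  show "bdd_above (sum (\<lambda>b. eta (bp b)) ` {F. F \<subseteq> UNIV \<and> finite F})"
  proof (rule bdd_aboveI2)
    fix F :: "int list set" assume "F \<in> {F. F \<subseteq> UNIV \<and> finite F}"
    then have F: "finite F" by simp
    have "(\<Sum>b\<in>F. eta (bp b)) \<le> (\<Sum>b\<in>F. bp b * length b * ln 2)"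
      by (intro sum_mono eta_bp_le)
    also have "\<dots> = (\<Sum>b\<in>F. bp b * length b) * ln 2" by (rule sum_distrib_right[symmetric])
    also have "\<dots> \<le> 9 * ln 2" using sum_length_bp_le[OF F] by (intro mult_right_mono) auto
    finally show "(\<Sum>b\<in>F. eta (bp b)) \<le> 9 * ln 2" .
  qed
qed

section \<open>The entropy of the goldenshift\<close>

text \<open>The expansion of 1/\<phi> is 1000..., without any gap. The regular points therefore lie
  in the open interval on which the Erdos measure is normalized.\<close>

lemma inverse_phi_not_R: "1 / \<phi> \<notin> R"
proof
  assume "1 / \<phi> \<in> R"
  then have "\<forall>n. \<exists>i\<ge>n. \<exists>l\<ge>1. even_gap_at (1 / \<phi>) i l" unfolding R_altdef by blast
  then obtain i l where i: "i \<ge> 1" "even_gap_at (1 / \<phi>) i l" by blast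
  have "T (1 / \<phi>) = 0" by (simp add: golden_map_def)
  moreover have "(T ^^ k) 0 = 0" for k by (induction k) (simp_all add: golden_map_def)
  ultimately have "digit (1 / \<phi>) i = 0"
    using i(1) digit_Suc[of "1 / \<phi>" "i - 1"] by (simp add: digit_def)
  with i(2) show False by (simp add: even_gap_at_def)
qed

lemma R_open_J: "R \<subseteq> {1 / \<phi> <..< 1}"
proof
  fix x assume x: "x \<in> R"
  then have "x \<in> J" "x \<noteq> 1 / \<phi>" using R_sub_J inverse_phi_not_R by blast+
  then show "x \<in> {1 / \<phi> <..< 1}" by simp
qed

lemma R_Int_sh_sets: "A \<in> sets borel \<Longrightarrow> R \<inter> {x. sh x \<in> A} \<in> sets borel"
  using measurable_sets[OF sh_measurable, of A] by (intro sets.Int R_measurable) (simp add: vimage_def)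

lemma mu_open_J: "\<mu> {1 / \<phi> <..< 1} = 1 / 3"
proof (rule antisym)
  show "\<mu> {1 / \<phi> <..< 1} \<le> 1 / 3"
    unfolding mu_J[symmetric] by (intro erdos.finite_measure_mono) auto
  show "1 / 3 \<le> \<mu> {1 / \<phi> <..< 1}"
    unfolding mu_R[symmetric] by (intro erdos.finite_measure_mono R_open_J) auto
qed

lemma space_erdos_regular [simp]: "space erdos_regular = R"
  by (simp add: erdos_regular_def space_restrict_space)

lemma sets_erdos_regular: "A \<in> sets erdos_regular \<longleftrightarrow> A \<in> sets borel \<and> A \<subseteq> R"
  unfolding erdos_regular_def by (subst sets_restrict_space_iff) auto

lemma measure_erdos_regular:
  assumes "A \<in> sets borel" "A \<subseteq> R"
  shows "measure erdos_regular A = 3 * \<mu> A"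
proof -
  have "{1 / \<phi> <..< 1} \<inter> A = A" using assms(2) R_open_J by blast
  moreover have "measure erdos_regular A = measure (uniform_measure erdos_measure {1 / \<phi> <..< 1}) A"
    unfolding erdos_regular_def using assms by (intro measure_restrict_space) auto
  ultimately show ?thesis
    using assms by (subst (asm) measure_uniform_measure)
      (simp_all add: erdos.emeasure_eq_measure mu_open_J)
qed

interpretation er: prob_space erdos_regular
proof -
  interpret u: prob_space "uniform_measure erdos_measure {1 / \<phi> <..< 1}"
    by (rule prob_space_uniform_measure) (simp_all add: erdos.emeasure_eq_measure mu_open_J)
  have "measure (uniform_measure erdos_measure {1 / \<phi> <..< 1}) R = 1"
    using measure_erdos_regular[of R] mu_R measure_restrict_space[of R "uniform_measure erdos_measure {1 / \<phi> <..< 1}" R]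
    by (simp add: erdos_regular_def)
  then show "prob_space erdos_regular"
    unfolding erdos_regular_def
    by (intro prob_space_restrict_space) (simp_all add: u.emeasure_eq_measure)
qed

lemma goldenshift_space: "x \<in> R \<Longrightarrow> goldenshift x \<in> R"
  by (simp add: goldenshift_eq sh_R)

lemma goldenshift_measurable: "goldenshift \<in> measurable erdos_regular erdos_regular"
proof (rule measurableI)
  fix A assume "A \<in> sets erdos_regular"
  then have A [measurable]: "A \<in> sets borel" and "A \<subseteq> R" by (auto simp: sets_erdos_regular)
  have "goldenshift -` A \<inter> space erdos_regular = R \<inter> {x. sh x \<in> A}"
    by (auto simp: goldenshift_eq)
  also have "\<dots> \<in> sets erdos_regular"
    unfolding sets_erdos_regular using R_Int_sh_sets[OF A] by blast
  finally show "goldenshift -` A \<inter> space erdos_regular \<in> sets erdos_regular" .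
qed (simp add: goldenshift_space)

text \<open>This is \<open>reg_law\<close> seen on the space \<open>R\<close>, and it takes the
  place of \<open>N\<close> in \<open>bernoulli_factor\<close>.\<close>

definition erdos_shifted :: "real measure" where
  "erdos_shifted = distr erdos_regular erdos_regular goldenshift"

lemma measure_erdos_shifted:
  assumes A [measurable]: "A \<in> sets borel" and "A \<subseteq> R"
  shows "measure erdos_shifted A = \<nu> A"
proof -
  have "measure erdos_shifted A = measure erdos_regular (goldenshift -` A \<inter> R)"
    unfolding erdos_shifted_def
    using assms by (subst measure_distr) (auto simp: sets_erdos_regular goldenshift_measurable)
  also have "goldenshift -` A \<inter> R = R \<inter> {x. sh x \<in> A}" by (auto simp: goldenshift_eq)
  also have "measure erdos_regular \<dots> = 3 * \<mu> (R \<inter> {x. sh x \<in> A})"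
    by (rule measure_erdos_regular[OF R_Int_sh_sets[OF A]]) blast
  also have "R \<inter> {x. sh x \<in> A} = {x \<in> R. sh x \<in> A}" by blast
  also have "3 * \<mu> \<dots> = \<nu> A" by (rule mu_R_sh[OF A])
  finally show ?thesis .
qed

lemma nu_R_Int: "E \<in> sets borel \<Longrightarrow> \<nu> (R \<inter> E) = \<nu> E"
  by (subst (1 2) nu_eq) (auto simp: Int_absorb)

text \<open>Each common block contracts the distance at least by the factor \<phi>.\<close>

lemma same_blocks_close:
  assumes "x \<in> R" "y \<in> R" "\<forall>i<k. blk ((goldenshift ^^ i) x) = blk ((goldenshift ^^ i) y)"
  shows "\<bar>x - y\<bar> \<le> 1 / \<phi> ^ k"
  using assms
proof (induction k arbitrary: x y)
  case 0
  then show ?case using unit_of_R[of x] unit_of_R[of y] by auto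
next
  case (Suc k)
  have b: "blk x = blk y" using Suc.prems(3) by auto
  have "blk ((goldenshift ^^ i) (sh x)) = blk ((goldenshift ^^ i) (sh y))" if "i < k" for i
    using Suc.prems(3)[rule_format, of "Suc i"] that Suc.prems(1,2)
    by (simp add: funpow_swap1 goldenshift_eq)
  then have IH: "\<bar>sh x - sh y\<bar> \<le> 1 / \<phi> ^ k"
    using sh_R Suc.prems(1,2) by (intro Suc.IH) auto
  have "blen x = blen y" using b by (metis length_blk)
  then have "x - y = (sh x - sh y) / \<phi> ^ blen x"
    using digit_expansion[of x "blen x"] digit_expansion[of y "blen y"] b
    by (simp add: blk_def sh_def diff_divide_distrib)
  then have "\<bar>x - y\<bar> = \<bar>sh x - sh y\<bar> / \<phi> ^ blen x" by (simp add: abs_divide)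
  also have "\<dots> \<le> \<bar>sh x - sh y\<bar> / \<phi> ^ 1"
  proof (rule divide_left_mono)
    show "\<phi> ^ 1 \<le> \<phi> ^ blen x"
      using R_blen[OF Suc.prems(1)] by (intro power_increasing) auto
  qed auto
  also have "\<dots> \<le> (1 / \<phi> ^ k) / \<phi>"
    using divide_right_mono[OF IH, of \<phi>] by simp
  finally show ?case by (simp add: mult.commute)
qed

definition cyl :: "nat \<Rightarrow> (nat \<Rightarrow> int list) \<Rightarrow> real set" where
  "cyl k a = {x \<in> R. \<forall>i<k. blk ((goldenshift ^^ i) x) = a i}"

text \<open>An open set is the union of the cylinders inside it, because cylinders around a point
  shrink to it. Cylinders are indexed by finite lists of blocks, so the union is countable.\<close>

lemma open_in_cylinders:
  assumes "open O'"
  shows "R \<inter> O' \<in> sigma_sets R (range (\<lambda>(k, a). cyl k a))"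
proof -
  define CC where "CC = {C. \<exists>l :: int list list. C = cyl (length l) ((!) l) \<and> C \<subseteq> O'}"
  have "countable (range (\<lambda>l :: int list list. cyl (length l) ((!) l)))" by simp
  then have count: "countable CC"
    by (rule countable_subset[rotated]) (auto simp: CC_def)
  have "R \<inter> O' = \<Union>CC"
  proof (intro equalityI subsetI)
    fix x assume x: "x \<in> R \<inter> O'"
    then obtain e where e: "e > 0" "\<And>y. dist y x < e \<Longrightarrow> y \<in> O'"
      using assms unfolding open_dist by blast
    have "(\<lambda>n. (1 / \<phi>) ^ n) \<longlonglongrightarrow> 0" by (rule LIMSEQ_power_zero) simp
    then have "\<forall>\<^sub>F n in sequentially. (1 / \<phi>) ^ n < e"
      using e by (intro order_tendstoD(2)) auto
    then obtain k where k: "(1 / \<phi>) ^ k < e" by (auto simp: eventually_sequentially)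
    define l where "l = map (\<lambda>i. blk ((goldenshift ^^ i) x)) [0..<k]"
    have xC: "x \<in> cyl (length l) ((!) l)" using x by (simp add: cyl_def l_def)
    have "cyl (length l) ((!) l) \<subseteq> O'"
    proof
      fix y assume "y \<in> cyl (length l) ((!) l)"
      then have "y \<in> R" "\<forall>i<k. blk ((goldenshift ^^ i) y) = blk ((goldenshift ^^ i) x)"
        by (auto simp: cyl_def l_def)
      with x have "\<bar>y - x\<bar> \<le> 1 / \<phi> ^ k" by (intro same_blocks_close) auto
      with k show "y \<in> O'" by (intro e(2)) (simp add: dist_real_def power_divide)
    qed
    with xC show "x \<in> \<Union>CC" by (auto simp: CC_def)
  qed (auto simp: CC_def cyl_def)
  moreover have "\<Union>CC \<in> sigma_sets R (range (\<lambda>(k, a). cyl k a))"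
  proof (rule sigma_sets_UNION[OF count])
    fix C assume "C \<in> CC"
    then obtain l :: "int list list" where "C = (\<lambda>(k, a). cyl k a) (length l, (!) l)" by (auto simp: CC_def)
    then show "C \<in> sigma_sets R (range (\<lambda>(k, a). cyl k a))" by (blast intro: sigma_sets.Basic)
  qed
  ultimately show ?thesis by simp
qed

lemma erdos_regular_generated: "sets erdos_regular = sigma_sets R (range (\<lambda>(k, a). cyl k a))"
proof (rule antisym)
  have "sets erdos_regular = (\<inter>) R ` sets (borel :: real measure)"
    unfolding erdos_regular_def by (simp add: sets_restrict_space)
  also have b: "sets (borel :: real measure) = sigma_sets UNIV {S. open S}" by (simp add: borel_def)
  also have "(\<inter>) R ` sigma_sets UNIV {S. open S} = sigma_sets R ((\<inter>) R ` {S. open S})"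
    by (rule sigma_sets_Int[OF R_measurable[unfolded b]]) simp
  also have "\<dots> \<subseteq> sigma_sets R (range (\<lambda>(k, a). cyl k a))"
  proof (rule sigma_sets_mono, rule subsetI)
    fix A assume "A \<in> (\<inter>) R ` {S. open S}"
    then obtain O' where "open O'" "A = R \<inter> O'" by blast
    with open_in_cylinders show "A \<in> sigma_sets R (range (\<lambda>(k, a). cyl k a))" by simp
  qed
  finally show "sets erdos_regular \<subseteq> sigma_sets R (range (\<lambda>(k, a). cyl k a))" .
  have "cyl k a \<in> sets erdos_regular" for k a
  proof -
    have "(\<lambda>x. blk ((goldenshift ^^ i) x)) \<in> measurable erdos_regular (count_space UNIV)" for i
    proof (rule measurable_compose[OF measurable_funpow[OF goldenshift_measurable]])
      show "blk \<in> measurable erdos_regular (count_space UNIV)"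
        unfolding erdos_regular_def
        by (rule measurable_restrict_space1) (simp cong: measurable_cong_sets)
    qed
    note [measurable] = this
    have "{x \<in> space erdos_regular. \<forall>i<k. blk ((goldenshift ^^ i) x) = a i} \<in> sets erdos_regular"
      by measurable
    then show ?thesis by (simp only: cyl_def space_erdos_regular)
  qed
  then have "range (\<lambda>(k, a). cyl k a) \<subseteq> sets erdos_regular" by auto
  from sets.sigma_sets_subset[OF this]
  show "sigma_sets R (range (\<lambda>(k, a). cyl k a)) \<subseteq> sets erdos_regular" by simp
qed

interpretation goldenshift: bernoulli_factor erdos_regular erdos_shifted goldenshift blk bp
proof (intro bernoulli_factor.intro bernoulli_factor_axioms.intro)
  show "prob_space erdos_regular" by unfold_locales
  show "prob_space erdos_shifted"
    unfolding erdos_shifted_def by (rule er.prob_space_distr[OF goldenshift_measurable])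
  then interpret s: prob_space erdos_shifted .
  show "goldenshift \<in> measurable erdos_regular erdos_regular" by (rule goldenshift_measurable)
  show "distr erdos_regular erdos_regular goldenshift = erdos_shifted" by (simp add: erdos_shifted_def)
  have sets_s: "sets erdos_shifted = sets erdos_regular" by (simp add: erdos_shifted_def)
  have space_s: "space erdos_shifted = R" using sets_eq_imp_space_eq[OF sets_s] by simp
  have gs: "goldenshift \<in> measurable erdos_shifted erdos_regular"
    using goldenshift_measurable sets_s by (simp cong: measurable_cong_sets)
  show "distr erdos_shifted erdos_regular goldenshift = erdos_shifted"
  proof (rule measure_eqI)
    fix A assume "A \<in> sets (distr erdos_shifted erdos_regular goldenshift)"
    then have A: "A \<in> sets erdos_regular" by simp
    then have A' [measurable]: "A \<in> sets borel" and AR: "A \<subseteq> R" by (auto simp: sets_erdos_regular)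
    have "emeasure (distr erdos_shifted erdos_regular goldenshift) A =
        emeasure erdos_shifted (goldenshift -` A \<inter> R)"
      using emeasure_distr[OF gs A] by (simp add: space_s)
    also have "goldenshift -` A \<inter> R = R \<inter> {x. sh x \<in> A}" by (auto simp: goldenshift_eq)
    also have "emeasure erdos_shifted \<dots> = ennreal (\<nu> (R \<inter> {x. sh x \<in> A}))"
      unfolding s.emeasure_eq_measure
      by (subst measure_erdos_shifted[OF R_Int_sh_sets[OF A']]) auto
    also have "\<nu> (R \<inter> {x. sh x \<in> A}) = \<nu> {x. sh x \<in> A}"
      by (rule nu_R_Int) measurable
    also have "\<dots> = \<nu> A" by (rule nu_sh[OF A'])
    also have "ennreal \<dots> = emeasure erdos_shifted A"
      unfolding s.emeasure_eq_measure by (simp add: measure_erdos_shifted AR)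
    finally show "emeasure (distr erdos_shifted erdos_regular goldenshift) A = emeasure erdos_shifted A" .
  qed (simp add: sets_s)
  show "blk \<in> measurable erdos_regular (count_space UNIV)"
    unfolding erdos_regular_def
    by (rule measurable_restrict_space1) (simp cong: measurable_cong_sets)
  fix b E assume "E \<in> sets erdos_regular"
  then have E [measurable]: "E \<in> sets borel" and ER: "E \<subseteq> R" by (auto simp: sets_erdos_regular)
  have "{x \<in> space erdos_regular. blk x = b \<and> goldenshift x \<in> E} = R \<inter> {x. blk x = b \<and> sh x \<in> E}"
    by (auto simp: goldenshift_eq)
  moreover have ev: "{x. blk x = b \<and> sh x \<in> E} \<in> sets borel" by measurable
  then have "measure erdos_shifted (R \<inter> {x. blk x = b \<and> sh x \<in> E}) = \<nu> (R \<inter> {x. blk x = b \<and> sh x \<in> E})"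
    by (intro measure_erdos_shifted sets.Int R_measurable) auto
  moreover have "\<dots> = \<nu> {x. blk x = b \<and> sh x \<in> E}" by (rule nu_R_Int[OF ev])
  ultimately show "measure erdos_shifted {x \<in> space erdos_regular. blk x = b \<and> goldenshift x \<in> E} =
      bp b * measure erdos_shifted E"
    using nu_block[OF E] by (simp add: measure_erdos_shifted ER)
next
  show "sets erdos_regular = sigma_sets (space erdos_regular)
      (range (\<lambda>(k, a). {x \<in> space erdos_regular. \<forall>i<k. blk ((goldenshift ^^ i) x) = a i}))"
    using erdos_regular_generated by (simp add: cyl_def)
qed (rule eta_bp_summable)

definition block_entropy :: real where
  "block_entropy = (\<Sum>\<^sub>\<infinity>b. eta (bp b))"

lemma ks_entropy_goldenshift:
  "ks_entropy \<phi> erdos_regular goldenshift = ereal (block_entropy / ln \<phi>)"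
  using goldenshift.ks_entropy_eq[of \<phi>] by (simp add: goldenshift.label_entropy_def block_entropy_def)

section \<open>Block words of bounded length\<close>

text \<open>A block of length exactly n is kept although its closing 1 is the digit with index n.
  Points outside [0,1), in particular the endpoint 1, get the empty word.\<close>

function word_to :: "nat \<Rightarrow> real \<Rightarrow> int list list" where
  "word_to n x = (if x \<in> {0..<1} \<and> 0 < blen x \<and> blen x \<le> n
     then blk x # word_to (n - blen x) (sh x) else [])"
  by auto
termination by (relation "Wellfounded.measure fst") auto

declare word_to.simps [simp del]

lemma word_to_Nil_iff: "word_to n x = [] \<longleftrightarrow> \<not> (x \<in> {0..<1} \<and> 0 < blen x \<and> blen x \<le> n)"
  by (subst word_to.simps) auto

lemma word_to_Cons_iff: "word_to n x = b # w \<longleftrightarrow>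
    x \<in> {0..<1} \<and> 0 < blen x \<and> length b \<le> n \<and> blk x = b \<and> word_to (n - length b) (sh x) = w"
  by (subst word_to.simps) auto

lemma word_to_measurable [measurable]: "{x. word_to n x = v} \<in> sets borel"
proof (induction v arbitrary: n)
  case Nil
  have "{x. word_to n x = []} = {x. \<not> (x \<in> {0..<1} \<and> 0 < blen x \<and> blen x \<le> n)}"
    by (simp only: word_to_Nil_iff)
  also have "\<dots> \<in> sets borel" by measurable
  finally show ?case .
next
  case (Cons b w)
  note [measurable] = Cons.IH
  have "{x. word_to n x = b # w} = {x. x \<in> {0..<1} \<and> 0 < blen x \<and> length b \<le> n \<and> blk x = b \<and>
      sh x \<in> {y. word_to (n - length b) y = w}}"
    by (simp only: word_to_Cons_iff mem_Collect_eq)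
  also have "\<dots> \<in> sets borel" by measurable
  finally show ?case .
qed

definition short_blocks :: "nat \<Rightarrow> int list set" where
  "short_blocks n = {b \<in> blocks. length b \<le> n}"

lemma finite_short_blocks [simp]: "finite (short_blocks n)"
proof (rule finite_subset)
  show "short_blocks n \<subseteq> (\<Union>k\<le>n. words k)" using blocks_words by (auto simp: short_blocks_def)
qed auto

definition block_words :: "nat \<Rightarrow> int list list set" where
  "block_words n = {v. set v \<subseteq> blocks \<and> length (concat v) \<le> n}"

lemma block_words_split:
  "block_words n = insert [] ((\<lambda>(b, w). b # w) ` (SIGMA b:short_blocks n. block_words (n - length b)))"
proof (intro equalityI subsetI)
  fix v assume v: "v \<in> block_words n"
  show "v \<in> insert [] ((\<lambda>(b, w). b # w) ` (SIGMA b:short_blocks n. block_words (n - length b)))"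
  proof (cases v)
    case (Cons b w)
    with v show ?thesis by (auto simp: block_words_def short_blocks_def image_iff)
  qed simp
qed (auto simp: block_words_def short_blocks_def)

lemma finite_block_words [simp]: "finite (block_words n)"
proof (induction n rule: less_induct)
  case (less n)
  have "finite (block_words (n - length b))" if "b \<in> short_blocks n" for b
  proof (rule less.IH)
    have "0 < length b" using that blocks_nonempty by (auto simp: short_blocks_def)
    moreover have "length b \<le> n" using that by (simp add: short_blocks_def)
    ultimately show "n - length b < n" by linarith
  qed
  then show ?case by (subst block_words_split) auto
qed

lemma word_to_block_words: "word_to n x \<in> block_words n"
proof (induction n arbitrary: x rule: less_induct)
  case (less n)
  show ?case
  proof (cases "word_to n x")
    case Nil
    then show ?thesis by (simp add: block_words_def)
  next
    case (Cons b w)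
    then have x: "x \<in> {0..<1}" "0 < blen x" "length b \<le> n" "blk x = b" "word_to (n - length b) (sh x) = w"
      by (auto simp: word_to_Cons_iff)
    then have "b \<in> short_blocks n" using blk_in_blocks by (auto simp: short_blocks_def)
    moreover have "w \<in> block_words (n - length b)"
      using less.IH[of "n - length b" "sh x"] x by (metis diff_less length_blk less_le_trans)
    ultimately show ?thesis unfolding Cons by (subst block_words_split) auto
  qed
qed

lemma sum_block_words:
  "(\<Sum>v\<in>block_words n. F v) = F [] + (\<Sum>b\<in>short_blocks n. \<Sum>w\<in>block_words (n - length b). F (b # w))"
  for F :: "int list list \<Rightarrow> real"
proof -
  let ?S = "SIGMA b:short_blocks n. block_words (n - length b)"
  have "(\<Sum>v\<in>block_words n. F v) = F [] + (\<Sum>v\<in>(\<lambda>(b, w). b # w) ` ?S. F v)"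
    by (subst block_words_split, subst sum.insert) auto
  also have "(\<Sum>v\<in>(\<lambda>(b, w). b # w) ` ?S. F v) = (\<Sum>(b, w)\<in>?S. F (b # w))"
    by (subst sum.reindex) (auto simp: inj_on_def intro!: sum.cong)
  also have "\<dots> = (\<Sum>b\<in>short_blocks n. \<Sum>w\<in>block_words (n - length b). F (b # w))"
    by (rule sum.Sigma[symmetric]) auto
  finally show ?thesis .
qed

definition word_entropy :: "real measure \<Rightarrow> nat \<Rightarrow> real" where
  "word_entropy Q n = (\<Sum>v\<in>block_words n. eta (measure Q {x. word_to n x = v}))"

text \<open>The mean number of digits, out of n, that follow the last complete block: the age in the
  language of renewal theory.\<close>

definition word_age :: "real measure \<Rightarrow> nat \<Rightarrow> real" where
  "word_age Q n = (\<Sum>v\<in>block_words n. measure Q {x. word_to n x = v} * (real n - length (concat v)))"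

text \<open>A law under which the first block is followed by an independent point with law \<open>reg_law\<close>.\<close>

locale block_start = prob_space Q for Q :: "real measure" +
  fixes G :: "real set" and c :: "int list \<Rightarrow> real"
  assumes sets_Q [simp, measurable_cong]: "sets Q = sets borel"
    and G [measurable]: "G \<in> sets borel" and prob_G: "prob G = 1"
    and G_sub: "G \<subseteq> {x \<in> {0..<1}. 0 < blen x}"
    and fib: "\<And>b E. E \<in> sets borel \<Longrightarrow> prob {x \<in> G. blk x = b \<and> sh x \<in> E} = c b * \<nu> E"
begin

lemma space_Q [simp]: "space Q = UNIV"
  using sets_eq_imp_space_eq[OF sets_Q] by simp

lemma prob_Int_G: "A \<in> sets borel \<Longrightarrow> prob A = prob {x \<in> G. x \<in> A}"
proof -
  assume A [measurable]: "A \<in> sets borel"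
  have "prob (A - G) \<le> prob (space Q - G)" by (rule finite_measure_mono) auto
  also have "\<dots> = 0" using prob_compl[of G] prob_G by simp
  finally have "prob (A - G) = 0" using measure_nonneg[of Q "A - G"] by simp
  moreover have "prob ((A \<inter> G) \<union> (A - G)) = prob (A \<inter> G) + prob (A - G)"
    by (rule finite_measure_Union) auto
  moreover have "(A \<inter> G) \<union> (A - G) = A" by blast
  moreover have "A \<inter> G = {x \<in> G. x \<in> A}" by auto
  ultimately show ?thesis by simp
qed

lemma c_eq: "c b = prob {x \<in> G. blk x = b}"
  using fib[of UNIV b] reg.prob_space by simp

lemma c_nonneg: "0 \<le> c b"
  by (simp add: c_eq)

lemma c_outside: "b \<notin> blocks \<Longrightarrow> c b = 0"
proof -
  assume b: "b \<notin> blocks"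
  then have e: "{x \<in> G. blk x = b} = {}" using G_sub blk_in_blocks by auto
  show ?thesis unfolding c_eq e by simp
qed

definition tail :: "nat \<Rightarrow> real" where
  "tail n = prob {x \<in> G. n < blen x}"

lemma tail_bounds: "0 \<le> tail n" "tail n \<le> 1"
  by (simp_all add: tail_def)

lemma tail_0: "tail 0 = 1"
proof -
  have "{x \<in> G. 0 < blen x} = G" using G_sub by auto
  then show ?thesis by (simp add: tail_def prob_G)
qed

lemma tail_split:
  assumes "k \<le> n"
  shows "tail k = tail n + (\<Sum>b\<in>short_blocks n. if k < length b then c b else 0)"
proof -
  let ?S = "short_blocks n \<inter> {b. k < length b}"
  have ev: "{x \<in> G. blk x = b} \<in> sets borel" for b by measurable
  have "{x \<in> G. k < blen x} = {x \<in> G. n < blen x} \<union> (\<Union>b\<in>?S. {x \<in> G. blk x = b})"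
    using assms G_sub blk_in_blocks by (auto simp: short_blocks_def simp flip: length_blk)
  moreover have "prob ({x \<in> G. n < blen x} \<union> (\<Union>b\<in>?S. {x \<in> G. blk x = b})) =
      prob {x \<in> G. n < blen x} + prob (\<Union>b\<in>?S. {x \<in> G. blk x = b})"
    using ev by (intro finite_measure_Union) (auto simp: short_blocks_def simp flip: length_blk)
  moreover have "prob (\<Union>b\<in>?S. {x \<in> G. blk x = b}) = (\<Sum>b\<in>?S. c b)"
    unfolding c_eq using ev by (intro finite_measure_finite_Union) (auto simp: disjoint_family_on_def)
  ultimately show ?thesis by (simp add: tail_def sum.inter_restrict)
qed

lemma sum_c: "(\<Sum>b\<in>short_blocks n. c b) = 1 - tail n"
proof -
  have "(\<Sum>b\<in>short_blocks n. if 0 < length b then c b else 0) = (\<Sum>b\<in>short_blocks n. c b)"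
    using blocks_nonempty by (intro sum.cong) (auto simp: short_blocks_def)
  with tail_split[of 0 n] tail_0 show ?thesis by simp
qed

text \<open>Both sides are the mean of the minimum of n and the length of the first block.\<close>

lemma sum_tail: "(\<Sum>k<n. tail k) = real n * tail n + (\<Sum>b\<in>short_blocks n. c b * length b)"
proof -
  have "(\<Sum>k<n. tail k) = (\<Sum>k<n. tail n + (\<Sum>b\<in>short_blocks n. if k < length b then c b else 0))"
    by (intro sum.cong refl tail_split) auto
  also have "\<dots> = real n * tail n + (\<Sum>b\<in>short_blocks n. \<Sum>k<n. if k < length b then c b else 0)"
    by (simp add: sum.distrib sum.swap[of _ "{..<n}"])
  also have "(\<Sum>b\<in>short_blocks n. \<Sum>k<n. if k < length b then c b else 0) = (\<Sum>b\<in>short_blocks n. c b * length b)"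
  proof (rule sum.cong[OF refl])
    fix b assume b: "b \<in> short_blocks n"
    have "(\<Sum>k<n. if k < length b then c b else 0) = (\<Sum>k\<in>{..<n} \<inter> {k. k < length b}. c b)"
      by (subst sum.inter_restrict) auto
    also have "{..<n} \<inter> {k. k < length b} = {..<length b}" using b by (auto simp: short_blocks_def)
    finally show "(\<Sum>k<n. if k < length b then c b else 0) = c b * length b" by simp
  qed
  finally show ?thesis .
qed

lemma tail_tendsto: "tail \<longlonglongrightarrow> 0"
proof -
  have "(\<lambda>n. prob {x \<in> G. n < blen x}) \<longlonglongrightarrow> prob (\<Inter>n. {x \<in> G. n < blen x})"
    by (rule finite_Lim_measure_decseq) (auto simp: decseq_def)
  moreover have "(\<Inter>n. {x \<in> G. n < blen x}) = {}" by auto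
  ultimately show ?thesis by (simp add: tail_def[abs_def])
qed

lemma prob_word_Nil: "prob {x. word_to n x = []} = tail n"
proof -
  have "prob {x. word_to n x = []} = prob {x \<in> G. x \<in> {x. word_to n x = []}}"
    by (rule prob_Int_G) measurable
  also have "{x \<in> G. x \<in> {x. word_to n x = []}} = {x \<in> G. n < blen x}"
    using G_sub by (auto simp: word_to_Nil_iff)
  finally show ?thesis by (simp add: tail_def)
qed

lemma prob_word_Cons:
  assumes "b \<in> short_blocks n"
  shows "prob {x. word_to n x = b # w} = c b * \<nu> {x. word_to (n - length b) x = w}"
proof -
  have "prob {x. word_to n x = b # w} = prob {x \<in> G. x \<in> {x. word_to n x = b # w}}"
    by (rule prob_Int_G) measurable
  also have "{x \<in> G. x \<in> {x. word_to n x = b # w}} =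
      {x \<in> G. blk x = b \<and> sh x \<in> {x. word_to (n - length b) x = w}}"
    using G_sub assms by (auto simp: word_to_Cons_iff short_blocks_def)
  also have "prob \<dots> = c b * \<nu> {x. word_to (n - length b) x = w}"
    by (rule fib) measurable
  finally show ?thesis .
qed

lemma sum_nu_words: "(\<Sum>w\<in>block_words k. \<nu> {x. word_to k x = w}) = 1"
proof -
  have "(\<Sum>w\<in>block_words k. \<nu> {x. word_to k x = w}) = \<nu> (\<Union>w\<in>block_words k. {x. word_to k x = w})"
    by (rule reg.finite_measure_finite_Union[symmetric]) (auto simp: disjoint_family_on_def)
  also have "(\<Union>w\<in>block_words k. {x. word_to k x = w}) = UNIV" using word_to_block_words by auto
  finally show ?thesis using reg.prob_space by simp
qed

text \<open>Given the first block, the rest of the word has the law of a word under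
  \<open>reg_law\<close> with the remaining length. The product rule for \<open>eta\<close> splits
  off the entropy of the first block, where \<open>tail n\<close> is the probability of the empty
  word.\<close>

lemma word_entropy_rec: "word_entropy Q n =
    (\<Sum>b\<in>short_blocks n. c b * word_entropy reg_law (n - length b)) +
    ((\<Sum>b\<in>short_blocks n. eta (c b)) + eta (tail n))"
proof -
  have "word_entropy Q n = eta (tail n) + (\<Sum>b\<in>short_blocks n. \<Sum>w\<in>block_words (n - length b).
      eta (c b * \<nu> {x. word_to (n - length b) x = w}))"
    unfolding word_entropy_def
    by (subst sum_block_words) (auto simp: prob_word_Nil prob_word_Cons intro!: sum.cong)
  also have "(\<Sum>b\<in>short_blocks n. \<Sum>w\<in>block_words (n - length b).
      eta (c b * \<nu> {x. word_to (n - length b) x = w})) =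
      (\<Sum>b\<in>short_blocks n. c b * word_entropy reg_law (n - length b) + eta (c b))"
  proof (rule sum.cong[OF refl])
    fix b :: "int list"
    let ?k = "n - length b"
    have "(\<Sum>w\<in>block_words ?k. eta (c b * \<nu> {x. word_to ?k x = w})) =
        c b * word_entropy reg_law ?k + (\<Sum>w\<in>block_words ?k. \<nu> {x. word_to ?k x = w}) * eta (c b)"
      by (simp add: eta_mult c_nonneg sum.distrib word_entropy_def sum_distrib_left sum_distrib_right)
    then show "(\<Sum>w\<in>block_words ?k. eta (c b * \<nu> {x. word_to ?k x = w})) =
        c b * word_entropy reg_law ?k + eta (c b)"
      by (simp add: sum_nu_words)
  qed
  finally show ?thesis by (simp add: sum.distrib)
qed

lemma word_age_rec: "word_age Q n =
    (\<Sum>b\<in>short_blocks n. c b * word_age reg_law (n - length b)) + real n * tail n"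
proof -
  have "word_age Q n = tail n * n + (\<Sum>b\<in>short_blocks n. \<Sum>w\<in>block_words (n - length b).
      c b * \<nu> {x. word_to (n - length b) x = w} * (real n - length (concat (b # w))))"
    unfolding word_age_def
    by (subst sum_block_words) (auto simp: prob_word_Nil prob_word_Cons intro!: sum.cong)
  also have "(\<Sum>b\<in>short_blocks n. \<Sum>w\<in>block_words (n - length b).
      c b * \<nu> {x. word_to (n - length b) x = w} * (real n - length (concat (b # w)))) =
      (\<Sum>b\<in>short_blocks n. c b * word_age reg_law (n - length b))"
    by (intro sum.cong refl)
      (auto simp: word_age_def sum_distrib_left short_blocks_def of_nat_diff algebra_simps intro!: sum.cong)
  finally show ?thesis by simp
qed

end

interpretation reg: block_start reg_law R bp
proof (intro block_start.intro block_start_axioms.intro)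
  show "prob_space reg_law" by unfold_locales
  show "\<nu> R = 1" by (subst nu_eq) (simp_all add: m_R)
  show "R \<subseteq> {x \<in> {0..<1}. 0 < blen x}" using unit_of_R R_blen by blast
  fix b and E :: "real set" assume E [measurable]: "E \<in> sets borel"
  have "\<nu> {x \<in> R. blk x = b \<and> sh x \<in> E} = 3 * m (R \<inter> {x \<in> R. blk x = b \<and> sh x \<in> E})"
    by (rule nu_eq) measurable
  also have "R \<inter> {x \<in> R. blk x = b \<and> sh x \<in> E} = R \<inter> {x. blk x = b \<and> sh x \<in> E}" by blast
  also have "3 * m \<dots> = \<nu> {x. blk x = b \<and> sh x \<in> E}" by (rule nu_eq[symmetric]) measurable
  also have "\<dots> = bp b * \<nu> E" by (rule nu_block[OF E])
  finally show "\<nu> {x \<in> R. blk x = b \<and> sh x \<in> E} = bp b * \<nu> E" .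
qed auto

interpretation erdos: block_start erdos_measure good_points bq
proof (intro block_start.intro block_start_axioms.intro)
  show "prob_space erdos_measure" by unfold_locales
  show "good_points \<subseteq> {x \<in> {0..<1}. 0 < blen x}" by (auto simp: good_points_def)
  show "\<mu> {x \<in> good_points. blk x = b \<and> sh x \<in> E} = bq b * \<nu> E" if "E \<in> sets borel" for b E
    by (rule mu_block[OF that])
qed (rule sets_erdos good_measurable mu_good)+

section \<open>Renewal asymptotics\<close>

lemma cesaro_zero:
  fixes f :: "nat \<Rightarrow> real"
  assumes "f \<longlonglongrightarrow> 0"
  shows "(\<lambda>n. (\<Sum>k<n. f k) / real n) \<longlonglongrightarrow> 0"
proof (rule LIMSEQ_I)
  fix e :: real assume e: "e > 0"
  obtain N where N: "\<And>k. k \<ge> N \<Longrightarrow> \<bar>f k\<bar> < e / 2"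
    using LIMSEQ_D[OF assms, of "e / 2"] e by auto
  define C where "C = (\<Sum>k<N. \<bar>f k\<bar>)"
  have C: "0 \<le> C" by (simp add: C_def sum_nonneg)
  obtain n0 :: nat where n0: "real n0 > 2 * C / e" using reals_Archimedean2 by blast
  show "\<exists>no. \<forall>n\<ge>no. norm ((\<Sum>k<n. f k) / real n - 0) < e"
  proof (intro exI allI impI)
    fix n assume n: "n \<ge> max (max n0 N) 1"
    then have n': "n \<ge> N" "n \<ge> n0" "real n > 0" by auto
    have "\<bar>\<Sum>k<n. f k\<bar> \<le> (\<Sum>k<n. \<bar>f k\<bar>)" by (rule sum_abs)
    also have "\<dots> = C + (\<Sum>k\<in>{N..<n}. \<bar>f k\<bar>)"
      unfolding C_def using n'(1) by (subst sum.union_disjoint[symmetric]) (auto intro!: sum.cong)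
    also have "(\<Sum>k\<in>{N..<n}. \<bar>f k\<bar>) \<le> (\<Sum>k\<in>{N..<n}. e / 2)"
      using N by (intro sum_mono less_imp_le) auto
    also have "\<dots> \<le> real n * (e / 2)" using e by (simp add: mult_right_mono)
    finally have b: "\<bar>\<Sum>k<n. f k\<bar> \<le> C + real n * (e / 2)" by simp
    have "2 * C / e < real n" using n0 n'(2) by simp
    then have "C < real n * (e / 2)" using e by (simp add: field_simps)
    with b have "\<bar>\<Sum>k<n. f k\<bar> < real n * e" by simp
    then show "norm ((\<Sum>k<n. f k) / real n - 0) < e"
      using n'(3) by (simp add: abs_divide divide_less_eq mult.commute)
  qed
qed

text \<open>The solution is dominated by the partial sums of the forcing term.\<close>

lemma renewal_sublinear:
  fixes z \<delta> :: "nat \<Rightarrow> real"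
  assumes rec: "\<And>n. z n = (\<Sum>b\<in>short_blocks n. c b * z (n - length b)) + \<delta> n"
    and c: "\<And>b. 0 \<le> c b" "\<And>n. (\<Sum>b\<in>short_blocks n. c b) \<le> 1" and \<delta>: "\<delta> \<longlonglongrightarrow> 0"
  obtains D :: "nat \<Rightarrow> real" where "mono D" "(\<lambda>n. D n / n) \<longlonglongrightarrow> 0" "\<And>n. \<bar>z n\<bar> \<le> D n"
proof
  define D where "D n = (\<Sum>k<Suc n. \<bar>\<delta> k\<bar>)" for n
  show mono: "mono D" unfolding D_def by (intro monoI sum_mono2) auto
  have D0: "0 \<le> D n" for n by (simp add: D_def sum_nonneg)
  show "\<bar>z n\<bar> \<le> D n" for n
  proof (induction n rule: less_induct)
    case (less n)
    have "\<bar>\<Sum>b\<in>short_blocks n. c b * z (n - length b)\<bar> \<le> (\<Sum>k<n. \<bar>\<delta> k\<bar>)"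
    proof (cases n)
      case 0
      then have "short_blocks n = {}" using blocks_nonempty by (auto simp: short_blocks_def)
      then show ?thesis by (simp add: sum_nonneg)
    next
      case (Suc k)
      have "\<bar>\<Sum>b\<in>short_blocks n. c b * z (n - length b)\<bar> \<le> (\<Sum>b\<in>short_blocks n. c b * D k)"
      proof (rule order_trans[OF sum_abs sum_mono])
        fix b assume "b \<in> short_blocks n"
        then have b: "0 < length b" "length b \<le> n" using blocks_nonempty by (auto simp: short_blocks_def)
        then have "n - length b < n" by linarith
        then have "\<bar>z (n - length b)\<bar> \<le> D (n - length b)" by (rule less.IH)
        also have "\<dots> \<le> D k" using b Suc by (intro monoD[OF mono]) linarith
        finally show "\<bar>c b * z (n - length b)\<bar> \<le> c b * D k"
          using c(1)[of b] by (simp add: abs_mult mult_left_mono)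
      qed
      also have "\<dots> = (\<Sum>b\<in>short_blocks n. c b) * D k" by (rule sum_distrib_right[symmetric])
      also have "\<dots> \<le> 1 * D k" by (rule mult_right_mono[OF c(2) D0])
      finally show ?thesis using Suc by (simp add: D_def)
    qed
    then show ?case using rec[of n] by (simp add: D_def)
  qed
  have "(\<lambda>n. \<bar>\<delta> n\<bar>) \<longlonglongrightarrow> 0" using tendsto_rabs[OF \<delta>] by simp
  note 1 = cesaro_zero[OF this] and 2 = this
  have "(\<lambda>n. \<bar>\<delta> n\<bar> / real n) \<longlonglongrightarrow> 0"
    using tendsto_mult[OF 2 lim_inverse_n] by (simp add: divide_inverse)
  from tendsto_add[OF 1 this] show "(\<lambda>n. D n / n) \<longlonglongrightarrow> 0"
    by (simp add: D_def add_divide_distrib)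
qed

text \<open>Only the first step has another law; the monotone bound \<open>D\<close> applies to
  whatever length remains after it.\<close>

lemma delayed_renewal_sublinear:
  fixes z z' \<delta> D :: "nat \<Rightarrow> real"
  assumes rec: "\<And>n. z' n = (\<Sum>b\<in>short_blocks n. c b * z (n - length b)) + \<delta> n"
    and c: "\<And>b. 0 \<le> c b" "\<And>n. (\<Sum>b\<in>short_blocks n. c b) \<le> 1"
    and \<delta>: "(\<lambda>n. \<delta> n / n) \<longlonglongrightarrow> 0"
    and D: "mono D" "(\<lambda>n. D n / n) \<longlonglongrightarrow> 0" "\<And>n. \<bar>z n\<bar> \<le> D n"
  shows "(\<lambda>n. z' n / n) \<longlonglongrightarrow> 0"
proof -
  have D0: "0 \<le> D n" for n using D(3)[of n] by linarith
  have bound: "\<bar>\<Sum>b\<in>short_blocks n. c b * z (n - length b)\<bar> \<le> D n" for n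
  proof -
    have "\<bar>\<Sum>b\<in>short_blocks n. c b * z (n - length b)\<bar> \<le> (\<Sum>b\<in>short_blocks n. c b * D n)"
    proof (rule order_trans[OF sum_abs sum_mono])
      fix b :: "int list"
      have "\<bar>z (n - length b)\<bar> \<le> D n"
        using D(3)[of "n - length b"] monoD[OF D(1), of "n - length b" n] by simp
      then show "\<bar>c b * z (n - length b)\<bar> \<le> c b * D n"
        using c(1)[of b] by (simp add: abs_mult mult_left_mono)
    qed
    also have "\<dots> = (\<Sum>b\<in>short_blocks n. c b) * D n" by (rule sum_distrib_right[symmetric])
    also have "\<dots> \<le> 1 * D n" by (rule mult_right_mono[OF c(2) D0])
    finally show ?thesis by simp
  qed
  have "(\<lambda>n. (\<Sum>b\<in>short_blocks n. c b * z (n - length b)) / n) \<longlonglongrightarrow> 0"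
  proof (rule Lim_null_comparison[OF _ D(2)])
    show "\<forall>\<^sub>F n in sequentially. norm ((\<Sum>b\<in>short_blocks n. c b * z (n - length b)) / n) \<le> D n / n"
      using bound by (auto intro!: always_eventually divide_right_mono simp: abs_divide)
  qed
  from tendsto_add[OF this \<delta>] show ?thesis by (simp add: rec add_divide_distrib)
qed

lemma eta_tendsto_0: "t \<longlonglongrightarrow> 0 \<Longrightarrow> (\<And>n. 0 \<le> t n) \<Longrightarrow> (\<And>n. t n \<le> 1) \<Longrightarrow> (\<lambda>n. eta (t n)) \<longlonglongrightarrow> 0"
proof (rule tendsto_sandwich[where f = "\<lambda>_. 0"])
  assume t: "t \<longlonglongrightarrow> 0"
  have "(\<lambda>n. 2 * sqrt (t n)) \<longlonglongrightarrow> 2 * sqrt 0" by (intro tendsto_intros t)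
  then show "(\<lambda>n. 2 * sqrt (t n)) \<longlonglongrightarrow> 0" by simp
qed (auto intro!: always_eventually eta_nonneg eta_le_sqrt)

text \<open>Entropy per digit: the entropy of a block divided by the mean block length.\<close>

definition \<kappa> :: real where
  "\<kappa> = block_entropy / 9"

lemma reg_tail_sums: "reg.tail sums 9"
proof -
  have "reg.tail n = \<nu> {x. n < blen x}" for n
  proof -
    have "\<nu> {x. n < blen x} = \<nu> {x \<in> R. x \<in> {x. n < blen x}}" by (rule reg.prob_Int_G) measurable
    then show ?thesis by (simp add: reg.tail_def)
  qed
  then have "reg.tail = (\<lambda>n. \<nu> {x. n < blen x})" by (rule ext)
  with nu_tail_sums show ?thesis by simp
qed

lemma reg_entropy_sum: "(\<lambda>n. \<Sum>b\<in>short_blocks n. eta (bp b)) \<longlonglongrightarrow> block_entropy"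
proof -
  have "((\<lambda>b. eta (bp b)) has_sum block_entropy) UNIV"
    unfolding block_entropy_def by (rule has_sum_infsum[OF eta_bp_summable])
  then have "((\<lambda>b. eta (bp b)) has_sum block_entropy) blocks"
    by (rule has_sum_cong_neutral[THEN iffD1, rotated -1]) (auto simp: reg.c_outside)
  then have "(sum (\<lambda>b. eta (bp b)) \<longlongrightarrow> block_entropy) (finite_subsets_at_top blocks)"
    by (simp add: has_sum_def)
  moreover have "filterlim short_blocks (finite_subsets_at_top blocks) sequentially"
    unfolding filterlim_finite_subsets_at_top
  proof (intro allI impI)
    fix X assume X: "finite X \<and> X \<subseteq> blocks"
    have "\<forall>\<^sub>F n in sequentially. Max (insert 0 (length ` X)) \<le> n" by (rule eventually_ge_at_top)
    then show "\<forall>\<^sub>F n in sequentially. finite (short_blocks n) \<and> X \<subseteq> short_blocks n \<and> short_blocks n \<subseteq> blocks"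
    proof eventually_elim
      case (elim n)
      have "length b \<le> n" if "b \<in> X" for b
        using elim X that by (intro order_trans[OF Max_ge elim]) auto
      with X finite_short_blocks[of n] show ?case by (auto simp: short_blocks_def)
    qed
  qed
  ultimately show ?thesis by (rule filterlim_compose)
qed

context block_start
begin

lemma sum_c_remaining: "(\<Sum>b\<in>short_blocks n. c b * real (n - length b)) = real n - (\<Sum>k<n. tail k)"
proof -
  have "(\<Sum>b\<in>short_blocks n. c b * real (n - length b)) =
      (\<Sum>b\<in>short_blocks n. c b * real n - c b * length b)"
    by (rule sum.cong) (auto simp: short_blocks_def of_nat_diff algebra_simps)
  also have "\<dots> = (\<Sum>b\<in>short_blocks n. c b) * real n - (\<Sum>b\<in>short_blocks n. c b * length b)"
    by (simp add: sum_subtractf sum_distrib_right)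
  finally show ?thesis unfolding sum_c sum_tail by (simp add: algebra_simps)
qed

text \<open>Subtracting the linear part adds -\<kappa> times the truncated mean length to the
  forcing term. For \<open>reg_law\<close> the forcing term then tends to the block entropy minus
  9\<kappa>, which is 0.\<close>

lemma centred_entropy_rec: "word_entropy Q n - \<kappa> * n =
    (\<Sum>b\<in>short_blocks n. c b * (word_entropy reg_law (n - length b) - \<kappa> * real (n - length b))) +
    ((\<Sum>b\<in>short_blocks n. eta (c b)) + eta (tail n) - \<kappa> * (\<Sum>k<n. tail k))"
proof -
  have "(\<Sum>b\<in>short_blocks n. c b * (word_entropy reg_law (n - length b) - \<kappa> * real (n - length b))) =
      (\<Sum>b\<in>short_blocks n. c b * word_entropy reg_law (n - length b)) -
      \<kappa> * (\<Sum>b\<in>short_blocks n. c b * real (n - length b))"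
    by (simp add: algebra_simps sum_subtractf sum_distrib_left)
  then show ?thesis
    unfolding sum_c_remaining word_entropy_rec by (simp add: algebra_simps)
qed

lemma sum_c_le_1: "(\<Sum>b\<in>short_blocks n. c b) \<le> 1"
  using tail_bounds[of n] by (simp add: sum_c)

lemma tail_antimono: "k \<le> n \<Longrightarrow> tail n \<le> tail k"
  unfolding tail_def by (rule finite_measure_mono) auto

lemma tail_average: "(\<lambda>n. (\<Sum>k<n. tail k) / n) \<longlonglongrightarrow> 0"
  by (rule cesaro_zero[OF tail_tendsto])

end

text \<open>The tail is decreasing, so n times its value at n is at most twice the sum over the
  indices from n/2 to n, a piece of a convergent series.\<close>

lemma reg_n_tail: "(\<lambda>n. real n * reg.tail n) \<longlonglongrightarrow> 0"
proof -
  define S where "S n = (\<Sum>k<n. reg.tail k)" for n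
  have S: "S \<longlonglongrightarrow> 9" using reg_tail_sums by (simp add: sums_def S_def[abs_def])
  have "filterlim (\<lambda>n :: nat. n div 2) at_top sequentially"
    unfolding filterlim_at_top
  proof
    fix Z :: nat
    show "\<forall>\<^sub>F n in sequentially. Z \<le> n div 2"
      using eventually_ge_at_top[of "2 * Z"] by eventually_elim simp
  qed
  from filterlim_compose[OF S this] have "(\<lambda>n. S (n div 2)) \<longlonglongrightarrow> 9" .
  from tendsto_mult_left[OF tendsto_diff[OF S this], of 2]
  have lim: "(\<lambda>n. 2 * (S n - S (n div 2))) \<longlonglongrightarrow> 0" by simp
  have le: "real n * reg.tail n \<le> 2 * (S n - S (n div 2))" for n
  proof -
    have "real n * reg.tail n \<le> 2 * (real (n - n div 2) * reg.tail n)"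
    proof -
      have "real n \<le> 2 * real (n - n div 2)" by linarith
      from mult_right_mono[OF this reg.tail_bounds(1)[of n]] show ?thesis by (simp only: mult.assoc)
    qed
    also have "real (n - n div 2) * reg.tail n = (\<Sum>k\<in>{n div 2..<n}. reg.tail n)" by simp
    also have "\<dots> \<le> (\<Sum>k\<in>{n div 2..<n}. reg.tail k)"
      by (intro sum_mono reg.tail_antimono) auto
    also have "\<dots> = S n - S (n div 2)"
    proof -
      have "S n = S (n div 2) + (\<Sum>k\<in>{n div 2..<n}. reg.tail k)"
        unfolding S_def by (subst sum.union_disjoint[symmetric]) (auto intro!: sum.cong)
      then show ?thesis by simp
    qed
    finally show ?thesis by simp
  qed
  show ?thesis
    by (rule tendsto_sandwich[OF _ _ tendsto_const lim])
      (use le reg.tail_bounds(1) in \<open>auto intro!: always_eventually\<close>)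
qed

lemma erdos_word_entropy_rate: "(\<lambda>n. word_entropy erdos_measure n / n) \<longlonglongrightarrow> \<kappa>"
proof -
  let ?\<delta> = "\<lambda>n. (\<Sum>b\<in>short_blocks n. eta (bp b)) + eta (reg.tail n) - \<kappa> * (\<Sum>k<n. reg.tail k)"
  have "?\<delta> \<longlonglongrightarrow> block_entropy + 0 - \<kappa> * 9"
    using reg_tail_sums reg.tail_bounds
    by (intro tendsto_intros reg_entropy_sum eta_tendsto_0 reg.tail_tendsto) (auto simp: sums_def)
  then have \<delta>: "?\<delta> \<longlonglongrightarrow> 0" by (simp add: \<kappa>_def)
  obtain D :: "nat \<Rightarrow> real" where D: "mono D" "(\<lambda>n. D n / n) \<longlonglongrightarrow> 0"
    "\<And>n. \<bar>word_entropy reg_law n - \<kappa> * n\<bar> \<le> D n"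
    using renewal_sublinear[OF reg.centred_entropy_rec reg.c_nonneg reg.sum_c_le_1 \<delta>] by blast
  let ?\<delta>' = "\<lambda>n. (\<Sum>b\<in>short_blocks n. eta (bq b)) + eta (erdos.tail n) - \<kappa> * (\<Sum>k<n. erdos.tail k)"
  \<comment> \<open>The law of the first block under the Erdos measure is not compared with
    \<open>bp\<close>. Its entropy is bounded by its truncated mean length, which is o(n) since the
    tail tends to 0.\<close>
  have bq_sum: "(\<Sum>b\<in>short_blocks n. eta (bq b)) \<le> (\<Sum>k<n. erdos.tail k) * ln 2 + ln 3" for n
  proof -
    have "eta (bq b) \<le> bq b * (length b * ln 2 + ln 3)" for b
    proof (cases "bq b = 0")
      case False
      then have pos: "0 < bq b" using bq_nonneg[of b] by simp
      have "ln (1 / (3 * 2 ^ length b)) \<le> ln (bq b)"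
        using bq_ge(1)[OF False] by (intro ln_mono) auto
      then have "- ln (bq b) \<le> length b * ln 2 + ln 3" by (simp add: ln_div ln_mult ln_realpow)
      then have "bq b * - ln (bq b) \<le> bq b * (length b * ln 2 + ln 3)" using pos by (intro mult_left_mono) auto
      then show ?thesis by (simp add: eta_def)
    qed simp
    then have "(\<Sum>b\<in>short_blocks n. eta (bq b)) \<le> (\<Sum>b\<in>short_blocks n. bq b * (length b * ln 2 + ln 3))"
      by (intro sum_mono)
    also have "\<dots> = (\<Sum>b\<in>short_blocks n. bq b * length b) * ln 2 + (\<Sum>b\<in>short_blocks n. bq b) * ln 3"
      by (simp add: sum_distrib_right distrib_left sum.distrib mult.assoc)
    also have "\<dots> \<le> (\<Sum>k<n. erdos.tail k) * ln 2 + 1 * ln 3"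
      using erdos.sum_tail[of n] erdos.tail_bounds(1)[of n]
      by (intro add_mono mult_right_mono erdos.sum_c_le_1) auto
    finally show ?thesis by simp
  qed
  have bq_avg: "(\<lambda>n. (\<Sum>b\<in>short_blocks n. eta (bq b)) / n) \<longlonglongrightarrow> 0"
  proof (rule tendsto_sandwich[where f = "\<lambda>_. 0"])
    have "(\<lambda>n. (\<Sum>k<n. erdos.tail k) / n * ln 2 + ln 3 / n) \<longlonglongrightarrow> 0 * ln 2 + 0"
      by (intro tendsto_intros erdos.tail_average lim_const_over_n)
    then show "(\<lambda>n. (\<Sum>k<n. erdos.tail k) / n * ln 2 + ln 3 / n) \<longlonglongrightarrow> 0" by simp
    show "\<forall>\<^sub>F n in sequentially. (\<Sum>b\<in>short_blocks n. eta (bq b)) / n \<le> (\<Sum>k<n. erdos.tail k) / n * ln 2 + ln 3 / n"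
      using divide_right_mono[OF bq_sum] by (auto intro!: always_eventually simp: add_divide_distrib)
    have "bq b \<le> 1" for b by (simp add: bq_def)
    then show "\<forall>\<^sub>F n in sequentially. 0 \<le> (\<Sum>b\<in>short_blocks n. eta (bq b)) / real n"
      by (auto intro!: always_eventually divide_nonneg_nonneg sum_nonneg eta_nonneg bq_nonneg)
  qed simp
  have eta_avg: "(\<lambda>n. eta (erdos.tail n) / n) \<longlonglongrightarrow> 0"
  proof -
    have "(\<lambda>n. eta (erdos.tail n) * inverse (real n)) \<longlonglongrightarrow> 0 * 0"
      by (intro tendsto_mult eta_tendsto_0 erdos.tail_tendsto erdos.tail_bounds lim_inverse_n)
    then show ?thesis by (simp add: divide_inverse)
  qed
  have "(\<lambda>n. (\<Sum>b\<in>short_blocks n. eta (bq b)) / n + eta (erdos.tail n) / n - \<kappa> * ((\<Sum>k<n. erdos.tail k) / n)) \<longlonglongrightarrow> 0 + 0 - \<kappa> * 0"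
    by (intro tendsto_intros bq_avg eta_avg erdos.tail_average)
  then have "(\<lambda>n. ?\<delta>' n / n) \<longlonglongrightarrow> 0" by (simp add: add_divide_distrib diff_divide_distrib)
  from delayed_renewal_sublinear[OF erdos.centred_entropy_rec erdos.c_nonneg erdos.sum_c_le_1 this D]
  have "(\<lambda>n. (word_entropy erdos_measure n - \<kappa> * n) / n) \<longlonglongrightarrow> 0" .
  from tendsto_add[OF this tendsto_const[of \<kappa>]]
  have "(\<lambda>n. (word_entropy erdos_measure n - \<kappa> * n) / n + \<kappa>) \<longlonglongrightarrow> \<kappa>" by simp
  then show ?thesis
    by (rule Lim_transform_eventually)
      (use eventually_gt_at_top[of 0] in eventually_elim, simp add: field_simps)
qed

lemma erdos_word_age_rate: "(\<lambda>n. word_age erdos_measure n / n) \<longlonglongrightarrow> 0"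
proof -
  obtain D :: "nat \<Rightarrow> real" where D: "mono D" "(\<lambda>n. D n / n) \<longlonglongrightarrow> 0"
    "\<And>n. \<bar>word_age reg_law n\<bar> \<le> D n"
    using renewal_sublinear[OF reg.word_age_rec reg.c_nonneg reg.sum_c_le_1 reg_n_tail] by blast
  have "(\<lambda>n. real n * erdos.tail n / n) \<longlonglongrightarrow> 0"
    by (rule Lim_transform_eventually[OF erdos.tail_tendsto])
      (use eventually_gt_at_top[of 0] in eventually_elim, simp)
  from delayed_renewal_sublinear[OF erdos.word_age_rec erdos.c_nonneg erdos.sum_c_le_1 this D]
  show ?thesis .
qed

section \<open>Garsia's entropy\<close>

lemma word_to_interval:
  assumes "x \<in> {0..1}" "word_to n x = v"
  shows "val (concat v) \<le> x \<and> x \<le> val (concat v) + 1 / \<phi> ^ length (concat v)"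
  using assms
proof (induction v arbitrary: n x)
  case Nil
  then show ?case by simp
next
  case (Cons b w)
  then have x: "x \<in> {0..<1}" "0 < blen x" "blk x = b" "word_to (n - length b) (sh x) = w"
    by (auto simp: word_to_Cons_iff)
  have "sh x \<in> {0..1}" using funpow_range[OF x(1), of "blen x"] by (simp add: sh_def)
  from Cons.IH[OF this x(4)]
  have IH: "val (concat w) \<le> sh x" "sh x \<le> val (concat w) + 1 / \<phi> ^ length (concat w)" by auto
  have eq: "x = val b + sh x / \<phi> ^ length b"
    using digit_expansion[of x "blen x"] x(3) by (auto simp: blk_def sh_def)
  have "val (concat w) / \<phi> ^ length b \<le> sh x / \<phi> ^ length b"
    "sh x / \<phi> ^ length b \<le> (val (concat w) + 1 / \<phi> ^ length (concat w)) / \<phi> ^ length b"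
    using IH by (auto intro!: divide_right_mono)
  then show ?case
    unfolding concat.simps val_append length_append power_add
    by (subst (1 2) eq) (simp add: add_divide_distrib mult.commute)
qed

text \<open>Agreement at index n is included because the closing 1 of a block of length n stands
  there.\<close>

lemma word_to_cong:
  assumes "x \<in> {0..<1}" "y \<in> {0..<1}" "\<And>i. i \<le> n \<Longrightarrow> digit x i = digit y i"
  shows "word_to n x = word_to n y"
  using assms
proof (induction n arbitrary: x y rule: less_induct)
  case (less n)
  have block_end: "block_end x t \<longleftrightarrow> block_end y t" if "t \<le> n" for t
    using less.prems(3) that by (intro block_end_cong) auto
  have *: "blen v = blen u" if "0 < blen u" "blen u \<le> n" "\<And>t. t \<le> n \<Longrightarrow> block_end u t \<longleftrightarrow> block_end v t" for u v
  proof -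
    have rv: "block_end v (blen u)" using blen_block_end[OF that(1)] that by blast
    then have le: "blen v \<le> blen u" by (rule blen_le)
    have "0 < blen v" using rv blen_pos_iff by blast
    then have "block_end u (blen v)" using blen_block_end le that by (meson order_trans)
    then have "blen u \<le> blen v" by (rule blen_le)
    with le show ?thesis by simp
  qed
  show ?case
  proof (cases "0 < blen x \<and> blen x \<le> n")
    case True
    then have len: "blen y = blen x" using *[of x y] block_end by blast
    have "blk x = blk y"
      unfolding blk_def len using less.prems(3) True by (intro nth_equalityI) auto
    moreover have "word_to (n - blen x) (sh x) = word_to (n - blen x) (sh y)"
    proof (rule less.IH)
      show "n - blen x < n" using True by linarith
      show "sh x \<in> {0..<1}" "sh y \<in> {0..<1}"
        unfolding sh_def by (intro funpow_range less.prems)+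
      fix i assume "i \<le> n - blen x"
      then have "blen x + i \<le> n" using True by linarith
      from less.prems(3)[OF this] show "digit (sh x) i = digit (sh y) i"
        by (simp add: sh_def len digit_funpow)
    qed
    ultimately show ?thesis
      using less.prems(1,2) True len by (subst (1 2) word_to.simps) simp
  next
    case False
    then have "\<not> (0 < blen y \<and> blen y \<le> n)" using *[of y x] block_end by metis
    with False show ?thesis using word_to_Nil_iff by metis
  qed
qed

text \<open>At the first difference the point with digit 0 lies below 1/\<phi>, whereas the word
  with digit 1 has value at least 1/\<phi>.\<close>

lemma hor_digits_inj:
  assumes "x \<in> {0..<1}" "y \<in> {0..<1}" "hor \<phi> (digits x n) = hor \<phi> (digits y n)"
  shows "digits x n = digits y n"
  using assms
proof (induction n arbitrary: x y)
  case 0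
  then show ?case by (simp add: digits_def)
next
  case (Suc n)
  have Tx: "T x \<in> {0..<1}" "T y \<in> {0..<1}" using golden_map_range by auto
  have not10: False if u: "u \<in> {0..<1}" "v \<in> {0..<1}" and d: "digit u 0 = 1" "digit v 0 = 0"
    and h: "hor \<phi> (digits u (Suc n)) = hor \<phi> (digits v (Suc n))" for u v
  proof -
    have "val (digits v (Suc n)) \<le> v"
      using digit_expansion[of v "Suc n"] funpow_range[OF u(2), of "Suc n"]
      by (smt (verit) atLeastLessThan_iff divide_nonneg_nonneg phi_pos(2) zero_le_power)
    also have "v < 1 / \<phi>" using digit_0_eq_1_iff[OF u(2)] d(2) by simp
    also have "1 / \<phi> \<le> val (digits u (Suc n))"
    proof -
      have "0 \<le> hor \<phi> (digits (T u) n)"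
        using digits_in_words[of "T u" n] golden_map_range by (intro hor_nonneg) (auto simp: words_def)
      then have "0 \<le> val (digits (T u) n)" by (simp add: val_def)
      then show ?thesis unfolding digits_Suc val_Cons d(1) by (intro divide_right_mono) auto
    qed
    also have "\<dots> = val (digits v (Suc n))" using h by (simp add: val_def)
    finally show False by simp
  qed
  have "digit x 0 = digit y 0"
    using not10[of x y] not10[of y x] Suc.prems digit_0_1[of x 0] digit_0_1[of y 0] by auto
  moreover from this have "hor \<phi> (digits (T x) n) = hor \<phi> (digits (T y) n)"
    using Suc.prems(3) by (simp add: digits_Suc hor_Cons)
  ultimately show ?case using Suc.IH[OF Tx] by (simp add: digits_Suc)
qed

text \<open>Cells of length d contain at most one point each, so \<lfloor>(x - a)/d\<rfloor> is
  injective.\<close>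

lemma card_separated:
  fixes S :: "real set"
  assumes S: "S \<subseteq> {a..a + L}" and d: "d > 0" and L: "0 \<le> L"
    and sep: "\<And>x y. x \<in> S \<Longrightarrow> y \<in> S \<Longrightarrow> x \<noteq> y \<Longrightarrow> d < \<bar>x - y\<bar>"
  shows "finite S" "real (card S) \<le> L / d + 1"
proof -
  define f where "f x = nat \<lfloor>(x - a) / d\<rfloor>" for x
  have inj: "inj_on f S"
  proof (rule inj_onI, rule ccontr)
    fix x y assume xy: "x \<in> S" "y \<in> S" "f x = f y" "x \<noteq> y"
    have "0 \<le> (x - a) / d" "0 \<le> (y - a) / d" using xy S d by auto
    then have "\<lfloor>(x - a) / d\<rfloor> = \<lfloor>(y - a) / d\<rfloor>" using xy(3) by (simp add: f_def eq_nat_nat_iff)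
    then have "\<bar>(x - a) / d - (y - a) / d\<bar> < 1" by linarith
    then have "\<bar>(x - y) / d\<bar> < 1" by (simp add: diff_divide_distrib)
    then have "\<bar>x - y\<bar> < d" using d by (simp add: abs_divide)
    with sep[OF xy(1,2,4)] show False by simp
  qed
  have im: "f ` S \<subseteq> {..nat \<lfloor>L / d\<rfloor>}"
  proof
    fix k assume "k \<in> f ` S"
    then obtain x where x: "x \<in> S" "k = f x" by auto
    then have "(x - a) / d \<le> L / d" using S d by (intro divide_right_mono) auto
    then show "k \<in> {..nat \<lfloor>L / d\<rfloor>}" using x(2) by (simp add: f_def nat_mono floor_mono)
  qed
  show "finite S" using inj im finite_subset by (metis finite_atMost finite_imageD)
  have "card S = card (f ` S)" using inj by (rule card_image[symmetric])
  also have "\<dots> \<le> nat \<lfloor>L / d\<rfloor> + 1" using card_mono[OF _ im] by simp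
  finally have "real (card S) \<le> real (nat \<lfloor>L / d\<rfloor>) + 1" by linarith
  also have "real (nat \<lfloor>L / d\<rfloor>) \<le> L / d" using L d by simp
  finally show "real (card S) \<le> L / d + 1" by simp
qed

section \<open>Partial sums and block words determine each other up to few choices\<close>

definition coin_word :: "nat \<Rightarrow> (nat \<Rightarrow> bool) \<Rightarrow> int list" where
  "coin_word n \<omega> = map (\<lambda>k. of_bool (\<omega> k)) [0..<n]"

lemma coin_word_words: "coin_word n \<omega> \<in> words n"
  by (auto simp: coin_word_def words_def)

text \<open>The weights run from \<phi>^(-2) to \<phi>^(-(n+1)), hence the exponent n + 1.\<close>

lemma erdos_partial_sum_eq: "erdos_partial_sum n \<omega> * \<phi> ^ (n + 1) = hor \<phi> (coin_word n \<omega>)"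
proof (induction n)
  case 0
  show ?case by (simp add: erdos_partial_sum_def coin_word_def)
next
  case (Suc n)
  have "erdos_partial_sum (Suc n) \<omega> * \<phi> ^ (Suc n + 1) =
      \<phi> * (erdos_partial_sum n \<omega> * \<phi> ^ (n + 1)) + of_bool (\<omega> n)"
    by (simp add: erdos_partial_sum_def algebra_simps)
  also have "\<dots> = hor \<phi> (coin_word (Suc n) \<omega>)"
    unfolding Suc by (simp add: coin_word_def)
  finally show ?case .
qed

abbreviation erdos_point :: "(nat \<Rightarrow> bool) \<Rightarrow> real" where
  "erdos_point \<omega> \<equiv> coin_sum \<omega> / \<phi>"

lemma erdos_point_near: "erdos_partial_sum n \<omega> \<le> erdos_point \<omega>" "erdos_point \<omega> \<le> erdos_partial_sum n \<omega> + 1 / \<phi> ^ n"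
proof -
  let ?y = "coin_sum (\<lambda>k. \<omega> (k + n))"
  have "erdos_point \<omega> = (\<Sum>k<n. of_bool (\<omega> k) / \<phi> ^ (k + 1) / \<phi>) + ?y / \<phi> ^ n / \<phi>"
    by (subst coin_sum_split[of _ n]) (simp add: add_divide_distrib sum_divide_distrib)
  also have "(\<Sum>k<n. of_bool (\<omega> k) / \<phi> ^ (k + 1) / \<phi>) = erdos_partial_sum n \<omega>"
    by (simp add: erdos_partial_sum_def mult.commute)
  finally have eq: "erdos_point \<omega> = erdos_partial_sum n \<omega> + ?y / \<phi> / \<phi> ^ n" by (simp add: mult.commute)
  have "0 \<le> ?y / \<phi>" "?y / \<phi> \<le> 1" using coin_sum_bounds by auto
  from divide_nonneg_nonneg[OF this(1), of "\<phi> ^ n"] divide_right_mono[OF this(2), of "\<phi> ^ n"]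
  have "0 \<le> ?y / \<phi> / \<phi> ^ n" "?y / \<phi> / \<phi> ^ n \<le> 1 / \<phi> ^ n"
    by simp_all
  with eq show "erdos_partial_sum n \<omega> \<le> erdos_point \<omega>" "erdos_point \<omega> \<le> erdos_partial_sum n \<omega> + 1 / \<phi> ^ n"
    by auto
qed

lemma erdos_point_unit: "erdos_point \<omega> \<in> {0..1}"
  using coin_sum_bounds[of \<omega>] by simp

lemma partial_sums_given_word:
  assumes v: "v \<in> block_words n"
  shows "real (card {s. \<exists>\<omega>. erdos_partial_sum n \<omega> = s \<and> word_to n (erdos_point \<omega>) = v}) \<le>
    12 * \<phi> ^ (n - length (concat v))"
proof -
  let ?S = "{s. \<exists>\<omega>. erdos_partial_sum n \<omega> = s \<and> word_to n (erdos_point \<omega>) = v}"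
  define l where "l = length (concat v)"
  have l: "l \<le> n" using v by (simp add: l_def block_words_def)
  define q where "q = \<phi> ^ (n - l)"
  have q: "1 \<le> q" unfolding q_def by (rule one_le_power) simp
  have qn: "q = \<phi> ^ n / \<phi> ^ l" using l by (simp add: q_def power_diff)
  let ?S' = "(\<lambda>s. s * \<phi> ^ (n + 1)) ` ?S"
  \<comment> \<open>After scaling by \<phi>^(n+1) the points with word \<open>v\<close> fill at most
    an interval of length \<phi> q, and a partial sum lies below its point by at most
    \<phi>.\<close>
  define a where "a = val (concat v) * \<phi> ^ (n + 1) - \<phi>"
  have "real (card ?S') \<le> (\<phi> * q + \<phi>) / (1 / (\<phi> * \<phi>)) + 1"
  proof (rule card_separated(2))
    show "?S' \<subseteq> {a..a + (\<phi> * q + \<phi>)}"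
    proof safe
      fix \<omega> assume v: "v = word_to n (erdos_point \<omega>)"
      let ?s = "erdos_partial_sum n \<omega>" and ?x = "erdos_point \<omega>"
      have near: "?s \<le> ?x" "?x - 1 / \<phi> ^ n \<le> ?s" using erdos_point_near[where n = n and \<omega> = \<omega>] by auto
      have x: "val (concat v) \<le> ?x" "?x \<le> val (concat v) + 1 / \<phi> ^ l"
        using word_to_interval[OF erdos_point_unit v[symmetric]] by (auto simp: l_def)
      have "(val (concat v) - 1 / \<phi> ^ n) * \<phi> ^ (n + 1) \<le> ?s * \<phi> ^ (n + 1)"
        using near x by (intro mult_right_mono) auto
      moreover have "(val (concat v) - 1 / \<phi> ^ n) * \<phi> ^ (n + 1) = a"
        by (simp add: a_def left_diff_distrib)
      moreover have "?s * \<phi> ^ (n + 1) \<le> (val (concat v) + 1 / \<phi> ^ l) * \<phi> ^ (n + 1)"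
        using near x by (intro mult_right_mono) auto
      moreover have "(val (concat v) + 1 / \<phi> ^ l) * \<phi> ^ (n + 1) = a + (\<phi> * q + \<phi>)"
        by (simp add: a_def qn distrib_right)
      ultimately show "?s * \<phi> ^ (n + 1) \<in> {a..a + (\<phi> * q + \<phi>)}"
        unfolding atLeastAtMost_iff by linarith
    qed
    fix x y assume "x \<in> ?S'" "y \<in> ?S'" "x \<noteq> y"
    then obtain \<omega> \<omega>' where "x = hor \<phi> (coin_word n \<omega>)" "y = hor \<phi> (coin_word n \<omega>')"
      using erdos_partial_sum_eq by auto
    with \<open>x \<noteq> y\<close> show "1 / (\<phi> * \<phi>) < \<bar>x - y\<bar>"
      using hor_separation[OF coin_word_words coin_word_words] by blast
  qed (use q in auto)
  also have "\<dots> = (\<phi> * \<phi> * \<phi>) * q + (\<phi> * \<phi> * \<phi>) + 1" by (simp add: algebra_simps)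
  also have "\<dots> \<le> 5 * q + 5 + 1"
  proof -
    have "\<phi> * \<phi> * \<phi> = 2 * \<phi> + 1" using phi_square by (simp add: algebra_simps)
    then have "\<phi> * \<phi> * \<phi> \<le> 5" using phi_bounds by simp
    then show ?thesis using q by (intro add_mono mult_right_mono) auto
  qed
  also have "\<dots> \<le> 12 * q" using q by simp
  finally have "real (card ?S') \<le> 12 * q" .
  moreover have "card ?S' = card ?S" by (rule card_image) (auto simp: inj_on_def)
  ultimately show ?thesis by (simp add: q_def l_def)
qed

text \<open>The first n + 1 greedy digits determine the block word. Their values are separated, and
  the partial sum confines them to an interval of bounded length.\<close>

lemma words_given_partial_sum:
  "real (card {v. \<exists>\<omega>. word_to n (erdos_point \<omega>) = v \<and> erdos_partial_sum n \<omega> = s}) \<le> 12"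
proof -
  let ?V = "{v. \<exists>\<omega>. word_to n (erdos_point \<omega>) = v \<and> erdos_partial_sum n \<omega> = s}"
  define A where "A = {x \<in> {0..<1}. s \<le> x \<and> x \<le> s + 1 / \<phi> ^ n}"
  define g where "g x = hor \<phi> (digits x (n + 1))" for x
  \<comment> \<open>The 1 makes room for the tail in [0,1) that is cut off in
    \<open>g x\<close>.\<close>
  define a where "a = s * \<phi> ^ (n + 1) - 1"
  have g: "g ` A \<subseteq> {a..a + (\<phi> + 1)}"
  proof safe
    fix x assume "x \<in> A"
    then have x: "x \<in> {0..<1}" "s \<le> x" "x \<le> s + 1 / \<phi> ^ n" by (auto simp: A_def)
    have "x * \<phi> ^ (n + 1) = g x + (T ^^ (n + 1)) x"
      by (subst digit_expansion[of x "n + 1"]) (simp add: val_def g_def distrib_right del: funpow.simps)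
    moreover have "(T ^^ (n + 1)) x \<in> {0..<1}" by (rule funpow_range[OF x(1)])
    moreover have "s * \<phi> ^ (n + 1) \<le> x * \<phi> ^ (n + 1)" using x by (intro mult_right_mono) auto
    moreover have "x * \<phi> ^ (n + 1) \<le> (s + 1 / \<phi> ^ n) * \<phi> ^ (n + 1)" using x by (intro mult_right_mono) auto
    moreover have "(s + 1 / \<phi> ^ n) * \<phi> ^ (n + 1) = s * \<phi> ^ (n + 1) + \<phi>" by (simp add: distrib_right)
    ultimately show "g x \<in> {a..a + (\<phi> + 1)}" by (simp add: a_def)
  qed
  have sep: "1 / (\<phi> * \<phi>) < \<bar>u - v\<bar>" if uv: "u \<in> g ` A" "v \<in> g ` A" "u \<noteq> v" for u v
  proof -
    obtain x y where xy: "x \<in> {0..<1}" "y \<in> {0..<1}" "u = g x" "v = g y"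
      using uv by (auto simp: A_def)
    with uv(3) show ?thesis
      using hor_separation[OF digits_in_words[OF xy(1)] digits_in_words[OF xy(2)]] by (simp add: g_def)
  qed
  have fin: "finite (g ` A)" and card: "real (card (g ` A)) \<le> (\<phi> + 1) / (1 / (\<phi> * \<phi>)) + 1"
    by (rule card_separated[OF g _ _ sep]; simp)+
  define r where "r h = word_to n (SOME x. x \<in> A \<and> g x = h)" for h
  have "?V \<subseteq> insert [] (r ` g ` A)"
  proof
    fix v assume "v \<in> ?V"
    then obtain \<omega> where \<omega>: "word_to n (erdos_point \<omega>) = v" "erdos_partial_sum n \<omega> = s" by auto
    let ?x = "erdos_point \<omega>"
    show "v \<in> insert [] (r ` g ` A)"
    proof (cases "?x \<in> {0..<1}")
      case True
      then have xA: "?x \<in> A" using erdos_point_near[where n = n and \<omega> = \<omega>] \<omega>(2) by (auto simp: A_def)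
      define y where "y = (SOME y. y \<in> A \<and> g y = g ?x)"
      have y: "y \<in> A \<and> g y = g ?x" unfolding y_def by (rule someI[of _ ?x]) (use xA in simp)
      then have "y \<in> {0..<1}" by (simp add: A_def)
      have "digits y (n + 1) = digits ?x (n + 1)"
        using y by (intro hor_digits_inj \<open>y \<in> {0..<1}\<close> True) (simp add: g_def)
      then have "digit y i = digit ?x i" if "i \<le> n" for i
        using that nth_digits[of i "n + 1"] by (metis le_imp_less_Suc Suc_eq_plus1)
      then have "word_to n y = word_to n ?x" by (rule word_to_cong[OF \<open>y \<in> {0..<1}\<close> True])
      then have "r (g ?x) = v" using \<omega>(1) by (simp add: r_def y_def)
      with xA show ?thesis by blast
    next
      case False
      then have "v = []" using \<omega>(1) word_to_Nil_iff by metis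
      then show ?thesis by simp
    qed
  qed
  then have "card ?V \<le> card (insert [] (r ` g ` A))" using fin by (intro card_mono) auto
  also have "\<dots> \<le> Suc (card (r ` g ` A))" by (rule card_insert_le_m1) auto
  also have "\<dots> \<le> Suc (card (g ` A))" using card_image_le[OF fin] by simp
  finally have "real (card ?V) \<le> real (card (g ` A)) + 1" by linarith
  \<comment> \<open>One unit comes from counting separated points, the other from the empty word of
    the endpoint 1.\<close>
  also have "\<dots> \<le> (\<phi> + 1) * (\<phi> + 1) + 2"
    using card by (simp add: phi_square)
  also have "\<dots> \<le> 2.7 * 2.7 + 2"
    using phi_bounds by (intro add_mono mult_mono) auto
  finally show ?thesis by simp
qed

interpretation C: prob_space coin_space
  by (rule coin_prob_space)

lemma simple_partial_sum: "simple_function coin_space (erdos_partial_sum n)"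
proof (rule simple_function_borel_measurable)
  show "erdos_partial_sum n \<in> borel_measurable coin_space"
    unfolding erdos_partial_sum_def[abs_def] by measurable
  have "erdos_partial_sum n \<omega> = hor \<phi> (coin_word n \<omega>) / \<phi> ^ (n + 1)" for \<omega>
    using erdos_partial_sum_eq[of n \<omega>] by (simp add: field_simps)
  then have "erdos_partial_sum n ` space coin_space \<subseteq> (\<lambda>w. hor \<phi> w / \<phi> ^ (n + 1)) ` words n"
    using coin_word_words by blast
  then show "finite (erdos_partial_sum n ` space coin_space)" by (rule finite_subset) simp
qed

lemma word_fiber_event: "{\<omega>. word_to n (erdos_point \<omega>) = v} \<in> sets coin_space"
proof -
  have "{\<omega>. word_to n (erdos_point \<omega>) = v} = (\<lambda>\<omega>. erdos_point \<omega>) -` {x. word_to n x = v} \<inter> space coin_space"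
    by auto
  also have "\<dots> \<in> sets coin_space" by (rule measurable_sets[OF _ word_to_measurable]) measurable
  finally show ?thesis .
qed

lemma simple_word: "simple_function coin_space (\<lambda>\<omega>. word_to n (erdos_point \<omega>))"
  unfolding simple_function_def
proof (intro conjI ballI)
  show "finite ((\<lambda>\<omega>. word_to n (erdos_point \<omega>)) ` space coin_space)"
    by (rule finite_subset[OF _ finite_block_words[of n]]) (use word_to_block_words in auto)
  fix v
  show "(\<lambda>\<omega>. word_to n (erdos_point \<omega>)) -` {v} \<inter> space coin_space \<in> sets coin_space"
    using word_fiber_event[of n v] by (simp add: vimage_def)
qed

lemma prob_word: "C.prob {\<omega>. word_to n (erdos_point \<omega>) = v} = \<mu> {x. word_to n x = v}"
proof -
  have eq: "erdos_measure = distr coin_space borel erdos_point"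
    unfolding erdos_eq golden_law_def by (subst distr_distr) (auto simp: comp_def)
  have "\<mu> {x. word_to n x = v} = C.prob (erdos_point -` {x. word_to n x = v} \<inter> space coin_space)"
    unfolding eq by (rule measure_distr[OF _ word_to_measurable]) measurable
  then show ?thesis by (simp add: vimage_def)
qed

lemma (in prob_space) prob_pos_imp_ex: "0 < prob {x \<in> space M. P x} \<Longrightarrow> \<exists>x. P x"
proof (rule ccontr)
  assume pos: "0 < prob {x \<in> space M. P x}" and "\<nexists>x. P x"
  then have e: "{x \<in> space M. P x} = {}" by blast
  from pos show False unfolding e by simp
qed

lemma ent_word: "ent coin_space (\<lambda>\<omega>. word_to n (erdos_point \<omega>)) = word_entropy erdos_measure n"
  by (subst ent_superset[OF finite_block_words[of n]])
    (use word_to_block_words in \<open>auto simp: word_entropy_def prob_word\<close>)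

text \<open>The logarithm of the number of partial sums with a given word is at most ln 12 plus ln
  \<phi> times the number of digits after its last block; averaging turns the latter into
  \<open>word_age\<close>.\<close>

lemma ent_partial_sum_upper:
  "ent coin_space (erdos_partial_sum n) \<le> word_entropy erdos_measure n + ln 12 + ln \<phi> * word_age erdos_measure n"
proof -
  let ?s = "erdos_partial_sum n" and ?W = "\<lambda>\<omega>. word_to n (erdos_point \<omega>)"
  let ?k = "\<lambda>v. 12 * \<phi> ^ (n - length (concat v))"
  have "ent coin_space ?s \<le> ent coin_space (\<lambda>\<omega>. (?s \<omega>, ?W \<omega>))"
    using C.ent_compose_le[OF simple_function_pair[OF simple_partial_sum[of n] simple_word[of n]], where f = fst] by simp
  also have "\<dots> \<le> ent coin_space ?W +
      (\<Sum>v\<in>?W ` space coin_space. C.prob {\<omega> \<in> space coin_space. ?W \<omega> = v} * ln (?k v))"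
  proof (rule C.ent_pair_fiber_le[OF simple_partial_sum simple_word])
    fix v assume pos: "0 < C.prob {\<omega> \<in> space coin_space. ?W \<omega> = v}"
    have "v \<in> block_words n"
    proof (rule ccontr)
      assume "v \<notin> block_words n"
      then have e: "{\<omega> \<in> space coin_space. ?W \<omega> = v} = {}" using word_to_block_words by auto
      from pos show False unfolding e by simp
    qed
    from partial_sums_given_word[OF this]
    have bound: "real (card {s. \<exists>\<omega>. ?s \<omega> = s \<and> ?W \<omega> = v}) \<le> ?k v" .
    have "finite {s. \<exists>\<omega>. ?s \<omega> = s \<and> ?W \<omega> = v}"
      by (rule finite_subset[OF _ simple_functionD(1)[OF simple_partial_sum[of n]]]) auto
    moreover have "{s. 0 < C.prob {\<omega> \<in> space coin_space. ?s \<omega> = s \<and> ?W \<omega> = v}} \<subseteq>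
        {s. \<exists>\<omega>. ?s \<omega> = s \<and> ?W \<omega> = v}"
      by (intro subsetI CollectI, drule CollectD) (rule C.prob_pos_imp_ex)
    ultimately have "card {s. 0 < C.prob {\<omega> \<in> space coin_space. ?s \<omega> = s \<and> ?W \<omega> = v}} \<le>
        card {s. \<exists>\<omega>. ?s \<omega> = s \<and> ?W \<omega> = v}"
      by (rule card_mono)
    with bound show "real (card {s. 0 < C.prob {\<omega> \<in> space coin_space. ?s \<omega> = s \<and> ?W \<omega> = v}}) \<le> ?k v"
      by linarith
  qed
  also have "(\<Sum>v\<in>?W ` space coin_space. C.prob {\<omega> \<in> space coin_space. ?W \<omega> = v} * ln (?k v)) =
      (\<Sum>v\<in>block_words n. \<mu> {x. word_to n x = v} * ln (?k v))"
  proof (rule sum.mono_neutral_cong_left)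
    show "\<forall>v\<in>block_words n - ?W ` space coin_space. \<mu> {x. word_to n x = v} * ln (?k v) = 0"
    proof
      fix v assume "v \<in> block_words n - ?W ` space coin_space"
      then have e: "{\<omega>. ?W \<omega> = v} = {}" by auto
      have "\<mu> {x. word_to n x = v} = 0" unfolding prob_word[symmetric] e by simp
      then show "\<mu> {x. word_to n x = v} * ln (?k v) = 0" by simp
    qed
  qed (use word_to_block_words in \<open>auto simp: prob_word\<close>)
  also have "\<dots> = (\<Sum>v\<in>block_words n. \<mu> {x. word_to n x = v} * ln 12 +
      ln \<phi> * (\<mu> {x. word_to n x = v} * (real n - length (concat v))))"
  proof (rule sum.cong[OF refl])
    fix v assume "v \<in> block_words n"
    then have "length (concat v) \<le> n" by (simp add: block_words_def)
    then show "\<mu> {x. word_to n x = v} * ln (?k v) = \<mu> {x. word_to n x = v} * ln 12 +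
        ln \<phi> * (\<mu> {x. word_to n x = v} * (real n - length (concat v)))"
      by (simp add: ln_mult ln_realpow of_nat_diff algebra_simps del: length_concat)
  qed
  also have "\<dots> = (\<Sum>v\<in>block_words n. \<mu> {x. word_to n x = v}) * ln 12 + ln \<phi> * word_age erdos_measure n"
    by (simp add: sum.distrib sum_distrib_left sum_distrib_right word_age_def del: length_concat)
  also have "(\<Sum>v\<in>block_words n. \<mu> {x. word_to n x = v}) = 1"
    using C.sum_prob_fibers[OF simple_word finite_block_words[of n]] word_to_block_words
    by (auto simp: prob_word)
  finally show ?thesis by (simp add: ent_word)
qed

lemma ent_partial_sum_lower: "word_entropy erdos_measure n \<le> ent coin_space (erdos_partial_sum n) + ln 12"
proof -
  let ?s = "erdos_partial_sum n" and ?W = "\<lambda>\<omega>. word_to n (erdos_point \<omega>)"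
  have "word_entropy erdos_measure n \<le> ent coin_space (\<lambda>\<omega>. (?W \<omega>, ?s \<omega>))"
    using C.ent_compose_le[OF simple_function_pair[OF simple_word[of n] simple_partial_sum[of n]], where f = fst]
    by (simp add: ent_word)
  also have "\<dots> \<le> ent coin_space ?s +
      (\<Sum>v\<in>?s ` space coin_space. C.prob {\<omega> \<in> space coin_space. ?s \<omega> = v} * ln 12)"
  proof (rule C.ent_pair_fiber_le[OF simple_word simple_partial_sum])
    fix s
    have "finite {v. \<exists>\<omega>. ?W \<omega> = v \<and> ?s \<omega> = s}"
      by (rule finite_subset[OF _ finite_block_words[of n]]) (use word_to_block_words in auto)
    moreover have "{v. 0 < C.prob {\<omega> \<in> space coin_space. ?W \<omega> = v \<and> ?s \<omega> = s}} \<subseteq>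
        {v. \<exists>\<omega>. ?W \<omega> = v \<and> ?s \<omega> = s}"
      by (intro subsetI CollectI, drule CollectD) (rule C.prob_pos_imp_ex)
    ultimately have "card {v. 0 < C.prob {\<omega> \<in> space coin_space. ?W \<omega> = v \<and> ?s \<omega> = s}} \<le>
        card {v. \<exists>\<omega>. ?W \<omega> = v \<and> ?s \<omega> = s}"
      by (rule card_mono)
    with words_given_partial_sum[of n s]
    show "real (card {v. 0 < C.prob {\<omega> \<in> space coin_space. ?W \<omega> = v \<and> ?s \<omega> = s}}) \<le> 12"
      by linarith
  qed
  also have "(\<Sum>v\<in>?s ` space coin_space. C.prob {\<omega> \<in> space coin_space. ?s \<omega> = v} * ln 12) = ln 12"
    using C.sum_prob_fibers[OF simple_partial_sum[of n] simple_functionD(1)[OF simple_partial_sum[of n]] order.refl]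
    by (simp flip: sum_distrib_right)
  finally show ?thesis .
qed

lemma garsia_entropy_eq: "garsia_entropy = \<kappa> / ln \<phi>"
proof -
  let ?H = "\<lambda>n. ent coin_space (erdos_partial_sum n)"
  have "(\<lambda>n. ?H n / n) \<longlonglongrightarrow> \<kappa>"
  proof (rule tendsto_sandwich)
    have "(\<lambda>n. word_entropy erdos_measure n / n - ln 12 / real n) \<longlonglongrightarrow> \<kappa> - 0"
      by (intro tendsto_intros erdos_word_entropy_rate lim_const_over_n)
    then show "(\<lambda>n. word_entropy erdos_measure n / n - ln 12 / real n) \<longlonglongrightarrow> \<kappa>" by simp
    have "(\<lambda>n. word_entropy erdos_measure n / n + ln 12 / real n + ln \<phi> * (word_age erdos_measure n / n))
        \<longlonglongrightarrow> \<kappa> + 0 + ln \<phi> * 0"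
      by (intro tendsto_intros erdos_word_entropy_rate erdos_word_age_rate lim_const_over_n)
    then show "(\<lambda>n. word_entropy erdos_measure n / n + ln 12 / real n + ln \<phi> * (word_age erdos_measure n / n))
        \<longlonglongrightarrow> \<kappa>" by simp
    show "\<forall>\<^sub>F n in sequentially. word_entropy erdos_measure n / n - ln 12 / real n \<le> ?H n / n"
      unfolding diff_divide_distrib[symmetric]
      using ent_partial_sum_lower by (intro always_eventually allI divide_right_mono) (auto simp: diff_le_eq)
    show "\<forall>\<^sub>F n in sequentially. ?H n / n \<le>
        word_entropy erdos_measure n / n + ln 12 / real n + ln \<phi> * (word_age erdos_measure n / n)"
      using divide_right_mono[OF ent_partial_sum_upper]
      by (auto intro!: always_eventually simp: add_divide_distrib)
  qed
  then have lim: "(\<lambda>n. ?H n / n / ln \<phi>) \<longlonglongrightarrow> \<kappa> / ln \<phi>"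
    by (intro tendsto_divide tendsto_const) (use phi_bounds in auto)
  have "shannon_entropy (exp 1) coin_space (erdos_partial_sum n) = ?H n" for n
    by (simp add: shannon_entropy_def ent_def eta_def log_def sum_negf vimage_def)
  with lim show ?thesis
    unfolding garsia_entropy_def by (intro limI) (simp add: divide_divide_eq_left)
qed

theorem theorem3p3:
  shows "ks_entropy golden_ratio erdos_regular goldenshift = ereal (9 * garsia_entropy)"
  unfolding ks_entropy_goldenshift garsia_entropy_eq \<kappa>_def by simp

end
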